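(* There exist a self-similar tile set $\tau$ and positive integers $c_1<c_2$ such that $\tau$ is $(c_1,c_2)$-robust.
   Context: A tile set is a finite subset $\tau\subset C^4$ for a finite color set $C$; a $\tau$-tiling of a region $R\subset\mathbb{Z}^2$ is a map $R\to\tau$ such that adjacent cells of $R$ carry tiles with equal colors on their common side. For $N>1$, an $N\times N$ macro-tile is a $\tau$-tiling of an $N\times N$ square, with macro-colors the sequences of $N$ colors along its four sides. A simulation of $\rho$ by $\tau$ with zoom factor $N$ is an injective map $S$ from $\rho$ to $N\times N$ $\tau$-macro-tiles such that two $\rho$-tiles match iff their images have the corresponding macro-colors equal, and every $\tau$-tiling of the plane splits by horizontal and vertical lines into $N\times N$ macro-tiles from the range of $S$ in a unique way; $\tau$ is self-similar if it simulates itself with some $N>1$. Distances are $\ell_\infty$. $\tau$ is $(c_1,c_2)$-robust if for every $\Delta$, every $\Delta\times\Delta$ square $Q$ and every $\tau$-tiling $U$ of the $(c_2\Delta)$-neighborhood of $Q$ minus $Q$, there exists a $\tau$-tiling $V$ of the whole $(c_2\Delta)$-neighborhood of $Q$ that coincides with $U$ outside the $(c_1\Delta)$-neighborhood of $Q$. *)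

theory Defs
  imports Main
begin

(* A tile is a quadruple of colours (north, east, south, west).
   Colours are natural numbers: any finite colour set embeds into nat. *)
type_synonym tile = "nat \<times> nat \<times> nat \<times> nat"

definition north :: "tile \<Rightarrow> nat" where "north t = fst t"
definition east  :: "tile \<Rightarrow> nat" where "east t = fst (snd t)"
definition south :: "tile \<Rightarrow> nat" where "south t = fst (snd (snd t))"
definition west  :: "tile \<Rightarrow> nat" where "west t = snd (snd (snd t))"

type_synonym cell = "int \<times> int"

definition tiling :: "tile set \<Rightarrow> cell set \<Rightarrow> (cell \<Rightarrow> tile) \<Rightarrow> bool" where
  "tiling \<tau> R f \<longleftrightarrow>
     (\<forall>p\<in>R. f p \<in> \<tau>) \<and>
     (\<forall>x y. (x, y) \<in> R \<and> (x + 1, y) \<in> R \<longrightarrow> east (f (x, y)) = west (f (x + 1, y))) \<and>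
     (\<forall>x y. (x, y) \<in> R \<and> (x, y + 1) \<in> R \<longrightarrow> north (f (x, y)) = south (f (x, y + 1)))"

definition sq :: "nat \<Rightarrow> cell set" where
  "sq N = {(i, j). 0 \<le> i \<and> i < int N \<and> 0 \<le> j \<and> j < int N}"

definition macro_tile :: "tile set \<Rightarrow> nat \<Rightarrow> (cell \<Rightarrow> tile) \<Rightarrow> bool" where
  "macro_tile \<tau> N M \<longleftrightarrow> tiling \<tau> (sq N) M"

definition mnorth :: "nat \<Rightarrow> (cell \<Rightarrow> tile) \<Rightarrow> nat list" where
  "mnorth N M = map (\<lambda>i. north (M (int i, int N - 1))) [0..<N]"
definition msouth :: "nat \<Rightarrow> (cell \<Rightarrow> tile) \<Rightarrow> nat list" where
  "msouth N M = map (\<lambda>i. south (M (int i, 0))) [0..<N]"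
definition meast :: "nat \<Rightarrow> (cell \<Rightarrow> tile) \<Rightarrow> nat list" where
  "meast N M = map (\<lambda>j. east (M (int N - 1, int j))) [0..<N]"
definition mwest :: "nat \<Rightarrow> (cell \<Rightarrow> tile) \<Rightarrow> nat list" where
  "mwest N M = map (\<lambda>j. west (M (0, int j))) [0..<N]"

definition splits :: "tile set \<Rightarrow> nat \<Rightarrow> (tile \<Rightarrow> cell \<Rightarrow> tile) \<Rightarrow> (cell \<Rightarrow> tile) \<Rightarrow> int \<Rightarrow> int \<Rightarrow> bool" where
  "splits \<rho> N S U a b \<longleftrightarrow>
     (\<forall>i j :: int. \<exists>r\<in>\<rho>. \<forall>p\<in>sq N.
        U (a + i * int N + fst p, b + j * int N + snd p) = S r p)"

definition simulates :: "tile set \<Rightarrow> tile set \<Rightarrow> nat \<Rightarrow> (tile \<Rightarrow> cell \<Rightarrow> tile) \<Rightarrow> bool" where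
  "simulates \<tau> \<rho> N S \<longleftrightarrow>
     1 < N \<and>
     (\<forall>r\<in>\<rho>. macro_tile \<tau> N (S r)) \<and>
     (\<forall>r\<in>\<rho>. \<forall>s\<in>\<rho>. (\<forall>p\<in>sq N. S r p = S s p) \<longrightarrow> r = s) \<and>
     (\<forall>r\<in>\<rho>. \<forall>s\<in>\<rho>.
        (east r = west s \<longleftrightarrow> meast N (S r) = mwest N (S s)) \<and>
        (north r = south s \<longleftrightarrow> mnorth N (S r) = msouth N (S s))) \<and>
     (\<forall>U. tiling \<tau> UNIV U \<longrightarrow>
        (\<exists>!ab. 0 \<le> fst ab \<and> fst ab < int N \<and> 0 \<le> snd ab \<and> snd ab < int N \<and>
               splits \<rho> N S U (fst ab) (snd ab)))"

definition self_similar :: "tile set \<Rightarrow> bool" where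
  "self_similar \<tau> \<longleftrightarrow> (\<exists>N S. 1 < N \<and> simulates \<tau> \<tau> N S)"

definition nbhd :: "int \<Rightarrow> int \<Rightarrow> int \<Rightarrow> int \<Rightarrow> cell set" where
  "nbhd x0 y0 D r = {(x, y). x0 - r \<le> x \<and> x \<le> x0 + D - 1 + r \<and>
                              y0 - r \<le> y \<and> y \<le> y0 + D - 1 + r}"

definition robust :: "tile set \<Rightarrow> nat \<Rightarrow> nat \<Rightarrow> bool" where
  "robust \<tau> c1 c2 \<longleftrightarrow>
     (\<forall>D::nat. \<forall>x0 y0 :: int. \<forall>U.
        let Q = nbhd x0 y0 (int D) 0;
            Big = nbhd x0 y0 (int D) (int (c2 * D));
            Mid = nbhd x0 y0 (int D) (int (c1 * D))
        in tiling \<tau> (Big - Q) U \<longrightarrow>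
           (\<exists>V. tiling \<tau> Big V \<and> (\<forall>p \<in> Big - Mid. V p = U p)))"

end

theory Submission
  imports Defs "HOL-Library.Countable"
begin

text \<open>
  The tile set simulates itself with zoom factor 19. A tile carries its coordinates modulo 19 in its
  parent macro-tile, so the grid of macro-tiles is forced and stays in phase around a hole. Besides,
  every side of a tile carries one signal, and the only thing a macro-tile has to do is to read the
  coordinates and the four signals of the simulated tile from its border and to check that they fit
  together. The check is self-referential, but not circular: a signal is a pair of a tag and a digit,
  the border shows tag and digit on separate wires, a core circuit recombines them, marking an ordinary
  signal with the kind of gate the simulated tile is and leaving an already marked signal alone, and the
  gate at the centre of the core accepts exactly the marked quadruples of signals of some other kind of
  gate. If the simulated tile is itself such a centre, its signals arrive unchanged and are accepted
  for the same reason.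

  For robustness the core and its wires occur in three copies along the diagonal of the macro-tile. A
  hole of size 2 leaves one copy (the same one in all macro-tiles that meet the hole) intact; the
  macro-tiles meeting the hole are replaced by the images of the tiles that this copy encodes. A larger
  hole shrinks by a factor of about 19 when passing to the simulated tiles, so induction applies and the
  required margins stay linear in the size of the hole.
\<close>

section \<open>Geometry of blocks\<close>

text \<open>The construction is shaped by the fact that shrinking stalls at side 2: a 2 x 2 hole may
  lie across a corner of the grid, and then the macro-tiles that it meets form a 2 x 2 hole again,
  at every level. So macro-tiles must survive the loss of a 2 x 2 window at any offset. Modulo 19
  all the lost cells lie in one window, whichever macro-tile they belong to; therefore one and the
  same copy survives in each, and neighbours can be compared on the border cells of that copy alone.
  Three copies on a diagonal suffice because rows and columns are damaged independently: the long
  wires hit by the window belong to at most one copy for its columns and to at most one for its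
  rows. Redundancy has a price: copies that disagree would give macro-tiles outside the range of the
  simulation. Hence the link lines, and 19 = 3 * 5 + 2 * 2, three cores of side 5 with two link
  lines along each side. Tag and digit travel apart because an ordinary wire has tag
  \<open>Raw\<close> and can only show a digit; a pair therefore takes two wires, and pairs
  themselves occur only around \<open>Check\<close>.\<close>

definition rect :: "int \<Rightarrow> int \<Rightarrow> int \<Rightarrow> int \<Rightarrow> cell set" where
  "rect l r l' r' = {l..r} \<times> {l'..r'}"

definition adjacent :: "cell set \<Rightarrow> (cell \<times> cell) set" where
  "adjacent R = {(p, q). p \<in> R \<and> q \<in> R \<and>
     (q = (fst p + 1, snd p) \<or> q = (fst p, snd p + 1) \<or> p = (fst q + 1, snd q) \<or> p = (fst q, snd q + 1))}"

lemma linked_row: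
  assumes "x \<le> x'" "\<And>z. x \<le> z \<Longrightarrow> z \<le> x' \<Longrightarrow> (z, y) \<in> R"
  shows "((x, y), (x', y)) \<in> (adjacent R)\<^sup>*"
  using assms
proof (induction x' rule: int_ge_induct)
  case (step i)
  have "((i, y), (i + 1, y)) \<in> adjacent R" using step.prems step.hyps by (auto simp: adjacent_def)
  then show ?case using step by (meson rtrancl.rtrancl_into_rtrancl zle_add1_eq_le order_less_imp_le)
qed auto

lemma linked_col:
  assumes "y \<le> y'" "\<And>z. y \<le> z \<Longrightarrow> z \<le> y' \<Longrightarrow> (x, z) \<in> R"
  shows "((x, y), (x, y')) \<in> (adjacent R)\<^sup>*"
  using assms
proof (induction y' rule: int_ge_induct)
  case (step i)
  have "((x, i), (x, i + 1)) \<in> adjacent R" using step.prems step.hyps by (auto simp: adjacent_def)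
  then show ?case using step by (meson rtrancl.rtrancl_into_rtrancl zle_add1_eq_le order_less_imp_le)
qed auto

lemma linked_sym:
  assumes "(p, q) \<in> (adjacent R)\<^sup>*"
  shows "(q, p) \<in> (adjacent R)\<^sup>*"
proof -
  have "sym (adjacent R)" unfolding adjacent_def sym_def mem_Collect_eq prod.case by iprover
  from symD[OF sym_rtrancl[OF this] assms] show ?thesis .
qed

text \<open>A cell is reached along the bottom row and then up its column. Only for cells above the
  hole is that column blocked, and these are reached over the left column and the top row.\<close>

lemma linked_annulus:
  assumes "l < h" "h' < r" "l' < k" "k' < r'" "h \<le> h'" "k \<le> k'"
    and p: "p \<in> rect l r l' r' - rect h h' k k'"
  shows "((l, l'), p) \<in> (adjacent (rect l r l' r' - rect h h' k k'))\<^sup>*"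
proof -
  let ?R = "rect l r l' r' - rect h h' k k'"
  obtain x y where xy: "p = (x, y)" by (cases p)
  have b: "l \<le> x" "x \<le> r" "l' \<le> y" "y \<le> r'" "x < h \<or> h' < x \<or> y < k \<or> k' < y"
    using p by (auto simp: rect_def xy)
  show ?thesis
  proof (cases "h \<le> x \<and> x \<le> h' \<and> k' < y")
    case False
    have "((l, l'), (x, l')) \<in> (adjacent ?R)\<^sup>*"
      by (rule linked_row) (use b assms in \<open>auto simp: rect_def\<close>)
    also have "((x, l'), (x, y)) \<in> (adjacent ?R)\<^sup>*"
      by (rule linked_col) (use b assms False in \<open>auto simp: rect_def\<close>)
    finally show ?thesis by (simp add: xy)
  next
    case True
    have "((l, l'), (l, r')) \<in> (adjacent ?R)\<^sup>*"
      by (rule linked_col) (use b assms in \<open>auto simp: rect_def\<close>)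
    also have "((l, r'), (x, r')) \<in> (adjacent ?R)\<^sup>*"
      by (rule linked_row) (use b assms in \<open>auto simp: rect_def\<close>)
    also have "((x, r'), (x, y)) \<in> (adjacent ?R)\<^sup>*"
      by (rule linked_sym, rule linked_col) (use b assms True in \<open>auto simp: rect_def\<close>)
    finally show ?thesis by (simp add: xy)
  qed
qed

lemma linked_plane: "((0, 0), p) \<in> (adjacent UNIV)\<^sup>*"
proof -
  obtain x y where xy: "p = (x, y)" by (cases p)
  have "((0, 0), (x, 0)) \<in> (adjacent UNIV)\<^sup>*"
    by (cases "0 \<le> x") (auto intro: linked_row linked_sym[OF linked_row])
  also have "((x, 0), (x, y)) \<in> (adjacent UNIV)\<^sup>*"
    by (cases "0 \<le> y") (auto intro: linked_col linked_sym[OF linked_col])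
  finally show ?thesis by (simp add: xy)
qed

lemma div_mod_succ:
  fixes x N :: int
  assumes "1 < N"
  shows "x mod N = N - 1 \<Longrightarrow> (x + 1) div N = x div N + 1 \<and> (x + 1) mod N = 0"
    "x mod N \<noteq> N - 1 \<Longrightarrow> (x + 1) div N = x div N \<and> (x + 1) mod N = x mod N + 1"
proof -
  have e: "x + 1 = (x mod N + 1) + N * (x div N)" by (simp add: algebra_simps)
  have m: "0 \<le> x mod N" "x mod N < N" using assms by auto
  show "(x + 1) div N = x div N + 1 \<and> (x + 1) mod N = 0" if "x mod N = N - 1"
    unfolding e that using assms by simp
  show "(x + 1) div N = x div N \<and> (x + 1) mod N = x mod N + 1" if "x mod N \<noteq> N - 1"
    using int_div_pos_eq[of "x + 1" N "x div N" "x mod N + 1"] int_mod_pos_eq[of "x + 1" N "x div N" "x mod N + 1"]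
      e m that by (simp add: add.commute)
qed

lemma div_bounds:
  fixes y N :: int
  assumes "0 < N"
  shows "N * (y div N) \<le> y" "y < N * (y div N) + N"
proof -
  have "y = N * (y div N) + y mod N" by simp
  then show "N * (y div N) \<le> y" "y < N * (y div N) + N"
    using pos_mod_sign[OF assms, of y] pos_mod_bound[OF assms, of y] by linarith+
qed

text \<open>Bookkeeping in one coordinate for passing from cells to blocks of side \<open>N\<close>
  with grid offset \<open>a\<close>. Whatever the offset, \<open>u + 2\<close> consecutive cells
  meet at most \<open>u div N + 2\<close> blocks. The two extra blocks in \<open>N * (m + 2)\<close>
  absorb the unknown position of the hole in its first block and the rounding in
  \<open>u div N\<close>.\<close>

lemma line_frame:
  fixes N a :: int
  assumes N: "1 < N" and u: "0 \<le> u" and m: "0 \<le> m"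
    and l: "l \<le> h - N * (m + 2)" and r: "h + u + 1 + N * (m + 2) \<le> r"
  defines "k \<equiv> (h - a) div N"
  shows "k - m \<le> i \<Longrightarrow> i \<le> k + u div N + 1 + m \<Longrightarrow> l \<le> a + i * N \<and> a + i * N + N - 1 \<le> r"
    "h \<le> x \<Longrightarrow> x \<le> h + u + 1 \<Longrightarrow> k \<le> (x - a) div N \<and> (x - a) div N \<le> k + u div N + 1"
    "k - d \<le> (x - a) div N \<Longrightarrow> (x - a) div N \<le> k + u div N + 1 + d \<Longrightarrow>
       h - N * (d + 2) \<le> x \<and> x \<le> h + u + 1 + N * (d + 2)"
proof -
  have N0: "0 < N" using N by simp
  have kk: "N * k \<le> h - a" "h - a < N * k + N" unfolding k_def by (rule div_bounds[OF N0])+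
  note uu = div_bounds[OF N0, of u]
  have xx: "N * ((x - a) div N) \<le> x - a \<and> x - a < N * ((x - a) div N) + N" for x
    using div_bounds[OF N0] by blast
  show "l \<le> a + i * N \<and> a + i * N + N - 1 \<le> r" if i: "k - m \<le> i" "i \<le> k + u div N + 1 + m"
  proof -
    have "N * (k - m) \<le> N * i" "N * i \<le> N * (k + u div N + 1 + m)"
      using i N by (auto intro: mult_left_mono)
    then show ?thesis using kk uu l r by (simp add: algebra_simps)
  qed
  show "k \<le> (x - a) div N \<and> (x - a) div N \<le> k + u div N + 1" if x: "h \<le> x" "x \<le> h + u + 1"
  proof
    show "k \<le> (x - a) div N" unfolding k_def using x N by (intro zdiv_mono1) auto
    have "N * ((x - a) div N) < N * (k + u div N + 2)"
      using xx[of x] kk uu x N by (simp add: algebra_simps)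
    then have "(x - a) div N < k + u div N + 2" using N by simp
    then show "(x - a) div N \<le> k + u div N + 1" by simp
  qed
  show "h - N * (d + 2) \<le> x \<and> x \<le> h + u + 1 + N * (d + 2)"
    if x: "k - d \<le> (x - a) div N" "(x - a) div N \<le> k + u div N + 1 + d"
  proof -
    have "N * (k - d) \<le> N * ((x - a) div N)" "N * ((x - a) div N) \<le> N * (k + u div N + 1 + d)"
      using x N by (auto intro: mult_left_mono)
    then show ?thesis using kk uu xx[of x] N by (simp add: algebra_simps)
  qed
qed

text \<open>All that the repair argument uses of the gates. \<open>decode\<close> treats intact
  macro-tiles. \<open>redundant\<close> treats damaged ones: for a 2 x 2 window given modulo
  \<open>N\<close> it yields a set \<open>Q\<close> that avoids the window and still determines a
  tile. As \<open>Q\<close> depends on the window only, all macro-tiles around one hole use the same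
  \<open>Q\<close>, and the last clause turns equality of colours on the shared border cells into
  matching of the tiles read. \<open>seed\<close> is a tile strictly inside its own image, from
  which a tiling of the plane grows.\<close>

locale robust_substitution =
  fixes \<tau> :: "tile set" and N :: nat and S :: "tile \<Rightarrow> cell \<Rightarrow> tile" and cx cy :: "tile \<Rightarrow> int"
  assumes N: "2 < N"
    and coord_range: "t \<in> \<tau> \<Longrightarrow> 0 \<le> cx t \<and> cx t < int N \<and> 0 \<le> cy t \<and> cy t < int N"
    and coord_east: "t \<in> \<tau> \<Longrightarrow> u \<in> \<tau> \<Longrightarrow> east t = west u \<Longrightarrow> cx u = (cx t + 1) mod int N \<and> cy u = cy t"
    and coord_north: "t \<in> \<tau> \<Longrightarrow> u \<in> \<tau> \<Longrightarrow> north t = south u \<Longrightarrow> cx u = cx t \<and> cy u = (cy t + 1) mod int N"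
    and S_tiling: "t \<in> \<tau> \<Longrightarrow> tiling \<tau> (sq N) (S t)"
    and S_coord: "t \<in> \<tau> \<Longrightarrow> p \<in> sq N \<Longrightarrow> cx (S t p) = fst p \<and> cy (S t p) = snd p"
    and S_inj: "r \<in> \<tau> \<Longrightarrow> s \<in> \<tau> \<Longrightarrow> (\<forall>p\<in>sq N. S r p = S s p) \<Longrightarrow> r = s"
    and S_east: "r \<in> \<tau> \<Longrightarrow> s \<in> \<tau> \<Longrightarrow>
       east r = west s \<longleftrightarrow> (\<forall>j. 0 \<le> j \<and> j < int N \<longrightarrow> east (S r (int N - 1, j)) = west (S s (0, j)))"
    and S_north: "r \<in> \<tau> \<Longrightarrow> s \<in> \<tau> \<Longrightarrow>
       north r = south s \<longleftrightarrow> (\<forall>i. 0 \<le> i \<and> i < int N \<longrightarrow> north (S r (i, int N - 1)) = south (S s (i, 0)))"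
    and decode: "tiling \<tau> (sq N) M \<Longrightarrow> (\<forall>p\<in>sq N. cx (M p) = fst p \<and> cy (M p) = snd p) \<Longrightarrow>
       \<exists>t\<in>\<tau>. \<forall>p\<in>sq N. M p = S t p"
    and redundant: "\<exists>Q \<subseteq> sq N.
       (\<forall>p\<in>Q. \<not> ((fst p - a) mod int N \<in> {0, 1} \<and> (snd p - b) mod int N \<in> {0, 1})) \<and>
       (\<forall>M. tiling \<tau> Q M \<longrightarrow> (\<forall>p\<in>Q. cx (M p) = fst p \<and> cy (M p) = snd p) \<longrightarrow>
          (\<exists>t\<in>\<tau>. (\<forall>j. (0, j) \<in> Q \<and> (int N - 1, j) \<in> Q \<longrightarrow>
                west (M (0, j)) = west (S t (0, j)) \<and> east (M (int N - 1, j)) = east (S t (int N - 1, j))) \<and>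
              (\<forall>i. (i, 0) \<in> Q \<and> (i, int N - 1) \<in> Q \<longrightarrow>
                south (M (i, 0)) = south (S t (i, 0)) \<and> north (M (i, int N - 1)) = north (S t (i, int N - 1))))) \<and>
       (\<forall>r\<in>\<tau>. \<forall>s\<in>\<tau>.
          ((\<forall>j. (0, j) \<in> Q \<and> (int N - 1, j) \<in> Q \<longrightarrow> east (S r (int N - 1, j)) = west (S s (0, j))) \<longrightarrow> east r = west s) \<and>
          ((\<forall>i. (i, 0) \<in> Q \<and> (i, int N - 1) \<in> Q \<longrightarrow> north (S r (i, int N - 1)) = south (S s (i, 0))) \<longrightarrow> north r = south s))"
    and seed: "\<exists>t\<in>\<tau>. \<exists>p q. 1 \<le> p \<and> p \<le> int N - 2 \<and> 1 \<le> q \<and> q \<le> int N - 2 \<and> S t (p, q) = t"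
begin

lemma tilingD:
  assumes "tiling \<tau> R U"
  shows "p \<in> R \<Longrightarrow> U p \<in> \<tau>"
    "(x, y) \<in> R \<Longrightarrow> (x + 1, y) \<in> R \<Longrightarrow> east (U (x, y)) = west (U (x + 1, y))"
    "(x, y) \<in> R \<Longrightarrow> (x, y + 1) \<in> R \<Longrightarrow> north (U (x, y)) = south (U (x, y + 1))"
  using assms unfolding tiling_def by auto

text \<open>Position minus coordinate, modulo \<open>N\<close>, is unchanged across a common side,
  hence constant on a connected region. Connectedness is what carries the grid around a
  hole.\<close>

lemma phase:
  assumes U: "tiling \<tau> R U" and root: "p0 \<in> R"
    and link: "\<And>p. p \<in> R \<Longrightarrow> (p0, p) \<in> (adjacent R)\<^sup>*"
  obtains a b where "0 \<le> a" "a < int N" "0 \<le> b" "b < int N"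
    "\<And>x y. (x, y) \<in> R \<Longrightarrow> cx (U (x, y)) = (x - a) mod int N \<and> cy (U (x, y)) = (y - b) mod int N"
proof -
  define f where "f p = ((fst p - cx (U p)) mod int N, (snd p - cy (U p)) mod int N)" for p
  have east: "f (x + 1, y) = f (x, y)" if "(x, y) \<in> R" "(x + 1, y) \<in> R" for x y
  proof -
    have "cx (U (x + 1, y)) = (cx (U (x, y)) + 1) mod int N \<and> cy (U (x + 1, y)) = cy (U (x, y))"
      by (rule coord_east) (use tilingD[OF U] that in auto)
    then show ?thesis by (simp add: f_def mod_diff_right_eq)
  qed
  have north: "f (x, y + 1) = f (x, y)" if "(x, y) \<in> R" "(x, y + 1) \<in> R" for x y
  proof -
    have "cx (U (x, y + 1)) = cx (U (x, y)) \<and> cy (U (x, y + 1)) = (cy (U (x, y)) + 1) mod int N"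
      by (rule coord_north) (use tilingD[OF U] that in auto)
    then show ?thesis by (simp add: f_def mod_diff_right_eq)
  qed
  have step: "f q = f p" if "(p, q) \<in> adjacent R" for p q
    using that east[of "fst p" "snd p"] north[of "fst p" "snd p"] east[of "fst q" "snd q"] north[of "fst q" "snd q"]
    unfolding adjacent_def by auto
  have const: "f p = f p0" if "p \<in> R" for p
    using link[OF that] by (induction rule: rtrancl_induct) (auto simp: step)
  have N0: "0 < int N" using N by simp
  have "cx (U (x, y)) = (x - fst (f p0)) mod int N \<and> cy (U (x, y)) = (y - snd (f p0)) mod int N" if "(x, y) \<in> R" for x y
    using coord_range[OF tilingD(1)[OF U that]] unfolding const[OF that, symmetric]
    by (simp add: f_def mod_diff_right_eq)
  moreover have "0 \<le> fst (f p0)" "fst (f p0) < int N" "0 \<le> snd (f p0)" "snd (f p0) < int N"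
    using N0 by (simp_all add: f_def)
  ultimately show thesis using that by blast
qed

section \<open>Block coordinates and expansion of a tiling of blocks\<close>

definition block :: "int \<Rightarrow> int \<Rightarrow> cell \<Rightarrow> cell \<Rightarrow> cell" where
  "block a b ij p = (a + fst ij * int N + fst p, b + snd ij * int N + snd p)"

definition index :: "int \<Rightarrow> int \<Rightarrow> cell \<Rightarrow> cell" where
  "index a b z = ((fst z - a) div int N, (snd z - b) div int N)"

definition pos :: "int \<Rightarrow> int \<Rightarrow> cell \<Rightarrow> cell" where
  "pos a b z = ((fst z - a) mod int N, (snd z - b) mod int N)"

lemma pos_sq: "pos a b z \<in> sq N"
  using N by (simp add: pos_def sq_def)

lemma block_index_pos: "block a b (index a b z) (pos a b z) = z"
  by (cases z) (simp add: block_def index_def pos_def)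

lemma sqD: "p \<in> sq N \<Longrightarrow> 0 \<le> fst p \<and> fst p < int N \<and> 0 \<le> snd p \<and> snd p < int N"
  by (auto simp: sq_def)

lemma index_block: "p \<in> sq N \<Longrightarrow> index a b (block a b ij p) = ij"
  and pos_block: "p \<in> sq N \<Longrightarrow> pos a b (block a b ij p) = p"
  using sqD[of p] by (cases ij; cases p; simp add: block_def index_def pos_def)+

lemma block_tiling:
  assumes U: "tiling \<tau> R U" and "\<And>p. p \<in> Q \<Longrightarrow> block a b ij p \<in> R"
  shows "tiling \<tau> Q (\<lambda>p. U (block a b ij p))"
  unfolding tiling_def
proof (intro conjI allI impI ballI)
  fix p assume "p \<in> Q" then show "U (block a b ij p) \<in> \<tau>" using tilingD(1)[OF U] assms(2) by blast
next
  fix x y assume q: "(x, y) \<in> Q \<and> (x + 1, y) \<in> Q"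
  have "block a b ij (x + 1, y) = (fst (block a b ij (x, y)) + 1, snd (block a b ij (x, y)))"
    by (simp add: block_def)
  then show "east (U (block a b ij (x, y))) = west (U (block a b ij (x + 1, y)))"
    using tilingD(2)[OF U] assms(2) q by (metis prod.collapse)
next
  fix x y assume q: "(x, y) \<in> Q \<and> (x, y + 1) \<in> Q"
  have "block a b ij (x, y + 1) = (fst (block a b ij (x, y)), snd (block a b ij (x, y)) + 1)"
    by (simp add: block_def)
  then show "north (U (block a b ij (x, y))) = south (U (block a b ij (x, y + 1)))"
    using tilingD(3)[OF U] assms(2) q by (metis prod.collapse)
qed

lemma block_coord:
  assumes "\<And>x y. (x, y) \<in> R \<Longrightarrow> cx (U (x, y)) = (x - a) mod int N \<and> cy (U (x, y)) = (y - b) mod int N"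
    and "p \<in> sq N" "block a b ij p \<in> R"
  shows "cx (U (block a b ij p)) = fst p \<and> cy (U (block a b ij p)) = snd p"
  using assms(1)[of "fst (block a b ij p)" "snd (block a b ij p)"] assms(3) pos_block[OF assms(2), of a b ij]
  by (simp add: pos_def prod_eq_iff)

lemma block_decode:
  assumes U: "tiling \<tau> R U"
    and ph: "\<And>x y. (x, y) \<in> R \<Longrightarrow> cx (U (x, y)) = (x - a) mod int N \<and> cy (U (x, y)) = (y - b) mod int N"
    and R: "\<And>p. p \<in> sq N \<Longrightarrow> block a b ij p \<in> R"
  shows "\<exists>t\<in>\<tau>. \<forall>p\<in>sq N. U (block a b ij p) = S t p"
  using decode[OF block_tiling[OF U R]] block_coord[where U=U and R=R and a=a and b=b, OF ph _ R] by blast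

lemma index_pos_east:
  "fst (pos a b (x, y)) = int N - 1 \<Longrightarrow>
     index a b (x + 1, y) = (fst (index a b (x, y)) + 1, snd (index a b (x, y))) \<and>
     pos a b (x + 1, y) = (0, snd (pos a b (x, y)))"
  "fst (pos a b (x, y)) \<noteq> int N - 1 \<Longrightarrow>
     index a b (x + 1, y) = index a b (x, y) \<and>
     pos a b (x + 1, y) = (fst (pos a b (x, y)) + 1, snd (pos a b (x, y)))"
  using div_mod_succ[of "int N" "x - a"] N by (auto simp: index_def pos_def algebra_simps)

lemma index_pos_north:
  "snd (pos a b (x, y)) = int N - 1 \<Longrightarrow>
     index a b (x, y + 1) = (fst (index a b (x, y)), snd (index a b (x, y)) + 1) \<and>
     pos a b (x, y + 1) = (fst (pos a b (x, y)), 0)"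
  "snd (pos a b (x, y)) \<noteq> int N - 1 \<Longrightarrow>
     index a b (x, y + 1) = index a b (x, y) \<and>
     pos a b (x, y + 1) = (fst (pos a b (x, y)), snd (pos a b (x, y)) + 1)"
  using div_mod_succ[of "int N" "y - b"] N by (auto simp: index_def pos_def algebra_simps)

definition expand :: "int \<Rightarrow> int \<Rightarrow> (cell \<Rightarrow> tile) \<Rightarrow> cell \<Rightarrow> tile" where
  "expand a b V z = S (V (index a b z)) (pos a b z)"

lemma expand_in: "V (index a b z) \<in> \<tau> \<Longrightarrow> expand a b V z \<in> \<tau>"
  unfolding expand_def using tilingD(1)[OF S_tiling] pos_sq by blast

lemma expand_east:
  assumes V: "V (index a b (x, y)) \<in> \<tau>" "V (index a b (x + 1, y)) \<in> \<tau>"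
    and adj: "\<And>i j. index a b (x, y) = (i, j) \<Longrightarrow> index a b (x + 1, y) = (i + 1, j) \<Longrightarrow>
       fst (pos a b (x, y)) = int N - 1 \<Longrightarrow> east (V (i, j)) = west (V (i + 1, j))"
  shows "east (expand a b V (x, y)) = west (expand a b V (x + 1, y))"
proof (cases "fst (pos a b (x, y)) = int N - 1")
  case True
  note p = index_pos_east(1)[OF True]
  obtain i j where ij: "index a b (x, y) = (i, j)" by (cases "index a b (x, y)")
  then have "east (V (i, j)) = west (V (i + 1, j))" using adj[of i j] p True by simp
  then have "\<forall>j'. 0 \<le> j' \<and> j' < int N \<longrightarrow> east (S (V (i, j)) (int N - 1, j')) = west (S (V (i + 1, j)) (0, j'))"
    using S_east V ij p by simp
  then have "east (S (V (i, j)) (int N - 1, snd (pos a b (x, y)))) = west (S (V (i + 1, j)) (0, snd (pos a b (x, y))))"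
    using sqD[OF pos_sq[of a b "(x, y)"]] by blast
  moreover have "pos a b (x, y) = (int N - 1, snd (pos a b (x, y)))" using True by (simp add: prod_eq_iff)
  ultimately show ?thesis using p ij by (simp add: expand_def)
next
  case False
  note p = index_pos_east(2)[OF False]
  show ?thesis
    using tilingD(2)[OF S_tiling[OF V(1)], of "fst (pos a b (x, y))" "snd (pos a b (x, y))"]
      pos_sq[of a b "(x, y)"] pos_sq[of a b "(x + 1, y)"] p by (simp add: expand_def)
qed

lemma expand_north:
  assumes V: "V (index a b (x, y)) \<in> \<tau>" "V (index a b (x, y + 1)) \<in> \<tau>"
    and adj: "\<And>i j. index a b (x, y) = (i, j) \<Longrightarrow> index a b (x, y + 1) = (i, j + 1) \<Longrightarrow>
       snd (pos a b (x, y)) = int N - 1 \<Longrightarrow> north (V (i, j)) = south (V (i, j + 1))"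
  shows "north (expand a b V (x, y)) = south (expand a b V (x, y + 1))"
proof (cases "snd (pos a b (x, y)) = int N - 1")
  case True
  note p = index_pos_north(1)[OF True]
  obtain i j where ij: "index a b (x, y) = (i, j)" by (cases "index a b (x, y)")
  then have "north (V (i, j)) = south (V (i, j + 1))" using adj[of i j] p True by simp
  then have "\<forall>i'. 0 \<le> i' \<and> i' < int N \<longrightarrow> north (S (V (i, j)) (i', int N - 1)) = south (S (V (i, j + 1)) (i', 0))"
    using S_north V ij p by simp
  then have "north (S (V (i, j)) (fst (pos a b (x, y)), int N - 1)) = south (S (V (i, j + 1)) (fst (pos a b (x, y)), 0))"
    using sqD[OF pos_sq[of a b "(x, y)"]] by blast
  moreover have "pos a b (x, y) = (fst (pos a b (x, y)), int N - 1)" using True by (simp add: prod_eq_iff)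
  ultimately show ?thesis using p ij by (simp add: expand_def)
next
  case False
  note p = index_pos_north(2)[OF False]
  show ?thesis
    using tilingD(3)[OF S_tiling[OF V(1)], of "fst (pos a b (x, y))" "snd (pos a b (x, y))"]
      pos_sq[of a b "(x, y)"] pos_sq[of a b "(x, y + 1)"] p by (simp add: expand_def)
qed

text \<open>Whole blocks are replaced, so a seam can only run between a block of \<open>K\<close>
  and a neighbouring one. The neighbour lies in \<open>B\<close>, where \<open>U\<close> already is
  the expansion of \<open>V\<close>; both ends of such an edge thus come from the same expansion.
  Every other edge avoids \<open>K\<close>, hence also \<open>H\<close>, and is an edge of
  \<open>U\<close>.\<close>

lemma patch:
  assumes U: "tiling \<tau> (R - H) U" and V: "tiling \<tau> B V"
    and K: "K \<subseteq> B" "\<And>i j. (i, j) \<in> K \<Longrightarrow> (i + 1, j) \<in> B \<and> (i - 1, j) \<in> B \<and> (i, j + 1) \<in> B \<and> (i, j - 1) \<in> B"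
    and H: "\<And>z. z \<in> H \<Longrightarrow> index a b z \<in> K"
    and agree: "\<And>z. z \<in> R \<Longrightarrow> index a b z \<in> B - K \<Longrightarrow> U z = expand a b V z"
  shows "tiling \<tau> R (\<lambda>z. if index a b z \<in> K then expand a b V z else U z)" (is "tiling \<tau> R ?W")
proof -
  have A: "?W z = expand a b V z" if "z \<in> R" "index a b z \<in> B" for z
    using agree that by auto
  have ie: "index a b (x + 1, y) = index a b (x, y) \<or>
      index a b (x + 1, y) = (fst (index a b (x, y)) + 1, snd (index a b (x, y)))" for x y
    using index_pos_east[of a b x y] by blast
  have ino: "index a b (x, y + 1) = index a b (x, y) \<or>
      index a b (x, y + 1) = (fst (index a b (x, y)), snd (index a b (x, y)) + 1)" for x y
    using index_pos_north[of a b x y] by blast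
  show ?thesis unfolding tiling_def
  proof (intro conjI allI impI ballI)
    fix z assume z: "z \<in> R"
    show "?W z \<in> \<tau>"
    proof (cases "index a b z \<in> K")
      case True
      then have "V (index a b z) \<in> \<tau>" using tilingD(1)[OF V] K(1) by blast
      then have "expand a b V z \<in> \<tau>" by (rule expand_in[of V a b z])
      then show ?thesis using True by simp
    next
      case False
      then have "z \<in> R - H" using z H by blast
      then show ?thesis using tilingD(1)[OF U] False by simp
    qed
  next
    fix x y assume q: "(x, y) \<in> R \<and> (x + 1, y) \<in> R"
    show "east (?W (x, y)) = west (?W (x + 1, y))"
    proof (cases "index a b (x, y) \<in> K \<or> index a b (x + 1, y) \<in> K")
      case True
      have B: "index a b (x, y) \<in> B" "index a b (x + 1, y) \<in> B"
        using True ie[of x y] K(1) K(2)[of "fst (index a b (x, y))" "snd (index a b (x, y))"]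
          K(2)[of "fst (index a b (x + 1, y))" "snd (index a b (x + 1, y))"] by auto
      have "east (expand a b V (x, y)) = west (expand a b V (x + 1, y))"
        by (rule expand_east) (use tilingD[OF V] B in auto)
      then show ?thesis using A[of "(x, y)"] A[of "(x + 1, y)"] q B by simp
    next
      case False
      then have "(x, y) \<in> R - H" "(x + 1, y) \<in> R - H" using q H by auto
      then show ?thesis using tilingD(2)[OF U, of x y] False by simp
    qed
  next
    fix x y assume q: "(x, y) \<in> R \<and> (x, y + 1) \<in> R"
    show "north (?W (x, y)) = south (?W (x, y + 1))"
    proof (cases "index a b (x, y) \<in> K \<or> index a b (x, y + 1) \<in> K")
      case True
      have B: "index a b (x, y) \<in> B" "index a b (x, y + 1) \<in> B"
        using True ino[of x y] K(1) K(2)[of "fst (index a b (x, y))" "snd (index a b (x, y))"]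
          K(2)[of "fst (index a b (x, y + 1))" "snd (index a b (x, y + 1))"] by auto
      have "north (expand a b V (x, y)) = south (expand a b V (x, y + 1))"
        by (rule expand_north) (use tilingD[OF V] B in auto)
      then show ?thesis using A[of "(x, y)"] A[of "(x, y + 1)"] q B by simp
    next
      case False
      then have "(x, y) \<in> R - H" "(x, y + 1) \<in> R - H" using q H by auto
      then show ?thesis using tilingD(3)[OF U, of x y] False by simp
    qed
  qed
qed

section \<open>Repairing holes\<close>

definition box :: "int \<Rightarrow> int \<Rightarrow> int \<Rightarrow> int \<Rightarrow> cell set" where
  "box h k u d = rect (h - d) (h + u + 1 + d) (k - d) (k + u + 1 + d)"

text \<open>The hole is a square of side \<open>u + 2\<close>; side 2 is the fixed point of passing to blocks.\<close>

definition repairable :: "int \<Rightarrow> int \<Rightarrow> int \<Rightarrow> bool" where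
  "repairable u m d \<longleftrightarrow> (\<forall>l r l' r' h k U. box h k u m \<subseteq> rect l r l' r' \<longrightarrow>
     tiling \<tau> (rect l r l' r' - box h k u 0) U \<longrightarrow>
     (\<exists>V. tiling \<tau> (rect l r l' r') V \<and> (\<forall>p \<in> rect l r l' r' - box h k u d. V p = U p)))"

lemma box_subset_rect:
  assumes "0 \<le> u" "0 \<le> m"
  shows "box h k u m \<subseteq> rect l r l' r' \<longleftrightarrow> l \<le> h - m \<and> h + u + 1 + m \<le> r \<and> l' \<le> k - m \<and> k + u + 1 + m \<le> r'"
proof
  assume s: "box h k u m \<subseteq> rect l r l' r'"
  have "(h - m, k - m) \<in> box h k u m" "(h + u + 1 + m, k + u + 1 + m) \<in> box h k u m"
    using assms by (auto simp: box_def rect_def)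
  then show "l \<le> h - m \<and> h + u + 1 + m \<le> r \<and> l' \<le> k - m \<and> k + u + 1 + m \<le> r'"
    using s by (auto simp: rect_def)
qed (auto simp: box_def rect_def)

text \<open>Lifts a repair from blocks to cells: \<open>m\<close> and \<open>d\<close> are here the
  available margin and the radius of change counted in blocks. The condition
  \<open>d + 1 \<le> m\<close> leaves a ring of unchanged blocks around the replaced ones, as
  \<open>patch\<close> demands. What remains for the caller is to find the tiles \<open>V\<close> of
  the blocks.\<close>

lemma repair_via_blocks:
  assumes u: "0 \<le> u" and d: "0 \<le> d" "d + 1 \<le> m"
    and blocks: "\<And>R U a b h k h' k'. tiling \<tau> (R - box h k u 0) U \<Longrightarrow>
        (\<And>x y. (x, y) \<in> R - box h k u 0 \<Longrightarrow> cx (U (x, y)) = (x - a) mod int N \<and> cy (U (x, y)) = (y - b) mod int N) \<Longrightarrow>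
        (\<And>ij p. ij \<in> box h' k' (u div int N) m \<Longrightarrow> p \<in> sq N \<Longrightarrow> block a b ij p \<in> R) \<Longrightarrow>
        (\<And>z. z \<in> box h k u 0 \<Longrightarrow> index a b z \<in> box h' k' (u div int N) 0) \<Longrightarrow>
        \<exists>V. tiling \<tau> (box h' k' (u div int N) m) V \<and>
          (\<forall>ij \<in> box h' k' (u div int N) m - box h' k' (u div int N) d. \<forall>p\<in>sq N. U (block a b ij p) = S (V ij) p)"
  shows "repairable u (int N * (m + 2)) (int N * (d + 2))"
  unfolding repairable_def
proof (intro allI impI)
  fix l r l' r' h k U
  let ?M = "int N * (m + 2)" and ?R = "rect l r l' r'"
  assume sub: "box h k u ?M \<subseteq> ?R" and U: "tiling \<tau> (?R - box h k u 0) U"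
  have N1: "1 < int N" using N by simp
  have M: "2 \<le> ?M" using N d mult_mono[of 1 "int N" 2 "m + 2"] by simp
  have b: "l \<le> h - ?M" "h + u + 1 + ?M \<le> r" "l' \<le> k - ?M" "k + u + 1 + ?M \<le> r'"
    using sub box_subset_rect[OF u, of ?M] M by auto
  have link: "((l, l'), p) \<in> (adjacent (?R - box h k u 0))\<^sup>*" if "p \<in> ?R - box h k u 0" for p
    using that unfolding box_def by (intro linked_annulus) (use b M u in auto)
  have root: "(l, l') \<in> ?R - box h k u 0" using b M u by (auto simp: box_def rect_def)
  obtain a b' where ph: "\<And>x y. (x, y) \<in> ?R - box h k u 0 \<Longrightarrow>
      cx (U (x, y)) = (x - a) mod int N \<and> cy (U (x, y)) = (y - b') mod int N"
    by (rule phase[OF U root link]) (assumption, rule that)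
  define h' k' u' where "h' = (h - a) div int N" and "k' = (k - b') div int N" and "u' = u div int N"
  have m0: "0 \<le> m" using d by simp
  note fx = line_frame[where a = a, OF N1 u m0 b(1,2), folded h'_def u'_def]
  note fy = line_frame[where a = b', OF N1 u m0 b(3,4), folded k'_def u'_def]
  have inside: "block a b' ij p \<in> ?R" if "ij \<in> box h' k' u' m" "p \<in> sq N" for ij p
    using fx(1)[of "fst ij"] fy(1)[of "snd ij"] that sqD[OF that(2)]
    by (auto simp: box_def rect_def block_def)
  have hole: "index a b' z \<in> box h' k' u' 0" if "z \<in> box h k u 0" for z
    using fx(2)[of "fst z"] fy(2)[of "snd z"] that by (auto simp: box_def rect_def index_def)
  have near: "z \<in> box h k u (int N * (d + 2))" if "index a b' z \<in> box h' k' u' d" for z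
    using fx(3)[of d "fst z"] fy(3)[of d "snd z"] that by (cases z) (auto simp: box_def rect_def index_def)
  obtain V where V: "tiling \<tau> (box h' k' u' m) V"
    and agree: "\<And>ij p. ij \<in> box h' k' u' m - box h' k' u' d \<Longrightarrow> p \<in> sq N \<Longrightarrow> U (block a b' ij p) = S (V ij) p"
    using blocks[OF U ph, folded u'_def, OF _ inside hole] by blast
  let ?W = "\<lambda>z. if index a b' z \<in> box h' k' u' d then expand a b' V z else U z"
  have "tiling \<tau> ?R ?W"
  proof (rule patch[OF U V])
    show "box h' k' u' d \<subseteq> box h' k' u' m" using d by (auto simp: box_def rect_def)
    show "(i + 1, j) \<in> box h' k' u' m \<and> (i - 1, j) \<in> box h' k' u' m \<and> (i, j + 1) \<in> box h' k' u' m \<and> (i, j - 1) \<in> box h' k' u' m"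
      if "(i, j) \<in> box h' k' u' d" for i j using that d by (auto simp: box_def rect_def)
    show "index a b' z \<in> box h' k' u' d" if "z \<in> box h k u 0" for z
      using hole[OF that] d by (auto simp: box_def rect_def)
    show "U z = expand a b' V z" if "index a b' z \<in> box h' k' u' m - box h' k' u' d" for z
      using agree[OF that pos_sq[of a b' z]] by (simp add: block_index_pos expand_def)
  qed
  moreover have "\<forall>p \<in> ?R - box h k u (int N * (d + 2)). ?W p = U p" using near by auto
  ultimately show "\<exists>V. tiling \<tau> ?R V \<and> (\<forall>p \<in> ?R - box h k u (int N * (d + 2)). V p = U p)" by blast
qed

lemma blocks_tiling:
  assumes V: "\<And>ij. ij \<in> B \<Longrightarrow> V ij \<in> \<tau>"
    and U: "tiling \<tau> R U"
    and east: "\<And>i j. (i, j) \<in> B \<Longrightarrow> (i + 1, j) \<in> B \<Longrightarrow> east (V (i, j)) = west (V (i + 1, j))"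
    and north: "\<And>i j. (i, j) \<in> B \<Longrightarrow> (i, j + 1) \<in> B \<Longrightarrow> north (V (i, j)) = south (V (i, j + 1))"
  shows "tiling \<tau> B V"
  using assms unfolding tiling_def by auto

lemma block_next_east: "block a b (i + 1, j) (0, q) = (fst (block a b (i, j) (int N - 1, q)) + 1, snd (block a b (i, j) (int N - 1, q)))"
  by (simp add: block_def algebra_simps)

lemma block_next_north: "block a b (i, j + 1) (p, 0) = (fst (block a b (i, j) (p, int N - 1)), snd (block a b (i, j) (p, int N - 1)) + 1)"
  by (simp add: block_def algebra_simps)

text \<open>The blocks that miss the hole decode to tiles, and these form a tiling one level up
  around a hole of side \<open>u div int N + 2\<close>. The hypothesis fills that hole, and the
  result is expanded.\<close>

lemma repairable_step:
  assumes IH: "repairable (u div int N) m d" and u: "0 \<le> u" and d: "0 \<le> d" "d + 1 \<le> m"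
  shows "repairable u (int N * (m + 2)) (int N * (d + 2))"
proof (rule repair_via_blocks[OF u d])
  fix R U a b h k h' k'
  let ?u = "u div int N" and ?H = "box h k u 0"
  let ?B = "box h' k' ?u m - box h' k' ?u 0"
  assume U: "tiling \<tau> (R - ?H) U"
    and ph: "\<And>x y. (x, y) \<in> R - ?H \<Longrightarrow> cx (U (x, y)) = (x - a) mod int N \<and> cy (U (x, y)) = (y - b) mod int N"
    and inside: "\<And>ij p. ij \<in> box h' k' ?u m \<Longrightarrow> p \<in> sq N \<Longrightarrow> block a b ij p \<in> R"
    and hole: "\<And>z. z \<in> ?H \<Longrightarrow> index a b z \<in> box h' k' ?u 0"
  have bl: "block a b ij p \<in> R - ?H" if "ij \<in> ?B" "p \<in> sq N" for ij p
    using inside[of ij p] hole[of "block a b ij p"] index_block[OF that(2), of a b ij] that by auto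
  have "\<exists>t\<in>\<tau>. \<forall>p\<in>sq N. U (block a b ij p) = S t p" if "ij \<in> ?B" for ij
    by (rule block_decode[OF U ph bl[OF that]])
  then obtain V where V: "\<And>ij. ij \<in> ?B \<Longrightarrow> V ij \<in> \<tau> \<and> (\<forall>p\<in>sq N. U (block a b ij p) = S (V ij) p)"
    by metis
  have sqb: "(int N - 1, q) \<in> sq N" "(0, q) \<in> sq N" "(q, int N - 1) \<in> sq N" "(q, 0) \<in> sq N" if "0 \<le> q" "q < int N" for q
    using that by (auto simp: sq_def)
  have "tiling \<tau> ?B V"
  proof (rule blocks_tiling[OF _ U])
    fix i j assume B: "(i, j) \<in> ?B" "(i + 1, j) \<in> ?B"
    have "east (S (V (i, j)) (int N - 1, q)) = west (S (V (i + 1, j)) (0, q))" if "0 \<le> q" "q < int N" for q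
    proof -
      have e: "S (V (i, j)) (int N - 1, q) = U (block a b (i, j) (int N - 1, q))"
        "S (V (i + 1, j)) (0, q) = U (block a b (i + 1, j) (0, q))"
        using V[OF B(1)] V[OF B(2)] sqb(1,2)[OF that] by simp_all
      show ?thesis unfolding e
        using tilingD(2)[OF U, of "fst (block a b (i, j) (int N - 1, q))" "snd (block a b (i, j) (int N - 1, q))"]
          bl[OF B(1) sqb(1)[OF that]] bl[OF B(2) sqb(2)[OF that]] unfolding block_next_east by simp
    qed
    then show "east (V (i, j)) = west (V (i + 1, j))" using S_east V[OF B(1)] V[OF B(2)] by blast
  next
    fix i j assume B: "(i, j) \<in> ?B" "(i, j + 1) \<in> ?B"
    have "north (S (V (i, j)) (q, int N - 1)) = south (S (V (i, j + 1)) (q, 0))" if "0 \<le> q" "q < int N" for q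
    proof -
      have e: "S (V (i, j)) (q, int N - 1) = U (block a b (i, j) (q, int N - 1))"
        "S (V (i, j + 1)) (q, 0) = U (block a b (i, j + 1) (q, 0))"
        using V[OF B(1)] V[OF B(2)] sqb(3,4)[OF that] by simp_all
      show ?thesis unfolding e
        using tilingD(3)[OF U, of "fst (block a b (i, j) (q, int N - 1))" "snd (block a b (i, j) (q, int N - 1))"]
          bl[OF B(1) sqb(3)[OF that]] bl[OF B(2) sqb(4)[OF that]] unfolding block_next_north by simp
    qed
    then show "north (V (i, j)) = south (V (i, j + 1))" using S_north V[OF B(1)] V[OF B(2)] by blast
  qed (use V in blast)
  then obtain V' where V': "tiling \<tau> (box h' k' ?u m) V'"
    and eq: "\<And>ij. ij \<in> box h' k' ?u m - box h' k' ?u d \<Longrightarrow> V' ij = V ij"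
    using IH[unfolded repairable_def, rule_format, of h' k' "h' - m" "h' + ?u + 1 + m" "k' - m" "k' + ?u + 1 + m" V]
    by (auto simp: box_def)
  have "box h' k' ?u 0 \<subseteq> box h' k' ?u d" using d by (auto simp: box_def rect_def)
  then have "U (block a b ij p) = S (V' ij) p" if "ij \<in> box h' k' ?u m - box h' k' ?u d" "p \<in> sq N" for ij p
    using eq[OF that(1)] V[of ij] that by auto
  then show "\<exists>V. tiling \<tau> (box h' k' ?u m) V \<and>
          (\<forall>ij \<in> box h' k' ?u m - box h' k' ?u d. \<forall>p\<in>sq N. U (block a b ij p) = S (V ij) p)"
    using V' by blast
qed

text \<open>One level up the hole has side 2 again, so going up gains nothing. Instead every block,
  damaged or not, is read through the set \<open>Q\<close> that the window spares. All blocks get a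
  tile at once, so no hole is left above: radius 0 and margin 1 in blocks, which
  \<open>repair_via_blocks\<close> turns into \<open>int N * 2\<close> and
  \<open>int N * 3\<close>.\<close>

lemma repairable_base: "repairable 0 (int N * 3) (int N * 2)"
proof -
  have "repairable 0 (int N * (1 + 2)) (int N * (0 + 2))"
  proof (rule repair_via_blocks)
    fix R U a b h k h' k'
    let ?H = "box h k 0 0" and ?K = "box h' k' (0 div int N) 1"
    assume U: "tiling \<tau> (R - ?H) U"
      and ph: "\<And>x y. (x, y) \<in> R - ?H \<Longrightarrow> cx (U (x, y)) = (x - a) mod int N \<and> cy (U (x, y)) = (y - b) mod int N"
      and inside: "\<And>ij p. ij \<in> ?K \<Longrightarrow> p \<in> sq N \<Longrightarrow> block a b ij p \<in> R"
      and hole: "\<And>z. z \<in> ?H \<Longrightarrow> index a b z \<in> box h' k' (0 div int N) 0"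
    \<comment> \<open>The offset \<open>(h - a, k - b)\<close> is the position of the hole relative
      to the grid; it is the same modulo \<open>N\<close> for all blocks, so one \<open>Q\<close>
      serves them all.\<close>
    obtain Q where Q: "Q \<subseteq> sq N"
      and avoid: "\<forall>p\<in>Q. \<not> ((fst p - (h - a)) mod int N \<in> {0, 1} \<and> (snd p - (k - b)) mod int N \<in> {0, 1})"
      and read: "\<forall>M. tiling \<tau> Q M \<longrightarrow> (\<forall>p\<in>Q. cx (M p) = fst p \<and> cy (M p) = snd p) \<longrightarrow>
          (\<exists>t\<in>\<tau>. (\<forall>j. (0, j) \<in> Q \<and> (int N - 1, j) \<in> Q \<longrightarrow>
                west (M (0, j)) = west (S t (0, j)) \<and> east (M (int N - 1, j)) = east (S t (int N - 1, j))) \<and>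
              (\<forall>i. (i, 0) \<in> Q \<and> (i, int N - 1) \<in> Q \<longrightarrow>
                south (M (i, 0)) = south (S t (i, 0)) \<and> north (M (i, int N - 1)) = north (S t (i, int N - 1))))"
      and east_north: "\<forall>r\<in>\<tau>. \<forall>s\<in>\<tau>.
          ((\<forall>j. (0, j) \<in> Q \<and> (int N - 1, j) \<in> Q \<longrightarrow> east (S r (int N - 1, j)) = west (S s (0, j))) \<longrightarrow> east r = west s) \<and>
          ((\<forall>i. (i, 0) \<in> Q \<and> (i, int N - 1) \<in> Q \<longrightarrow> north (S r (i, int N - 1)) = south (S s (i, 0))) \<longrightarrow> north r = south s)"
      using redundant[of "h - a" "k - b"] by (elim exE conjE) (rule that)
    define reads where "reads ij t \<longleftrightarrow>
       (\<forall>j. (0, j) \<in> Q \<and> (int N - 1, j) \<in> Q \<longrightarrow>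
          west (U (block a b ij (0, j))) = west (S t (0, j)) \<and>
          east (U (block a b ij (int N - 1, j))) = east (S t (int N - 1, j))) \<and>
       (\<forall>i. (i, 0) \<in> Q \<and> (i, int N - 1) \<in> Q \<longrightarrow>
          south (U (block a b ij (i, 0))) = south (S t (i, 0)) \<and>
          north (U (block a b ij (i, int N - 1))) = north (S t (i, int N - 1)))" for ij t
    have blQ: "block a b ij p \<in> R - ?H" if "ij \<in> ?K" "p \<in> Q" for ij p
    proof
      show "block a b ij p \<in> R" using inside that Q by blast
      have mod: "(fst p - (h - a)) mod int N = (fst (block a b ij p) - h) mod int N"
        "(snd p - (k - b)) mod int N = (snd (block a b ij p) - k) mod int N"
      proof -
        have e: "fst (block a b ij p) - h = fst p - (h - a) + fst ij * int N"
          "snd (block a b ij p) - k = snd p - (k - b) + snd ij * int N" by (simp_all add: block_def)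
        show "(fst p - (h - a)) mod int N = (fst (block a b ij p) - h) mod int N"
          "(snd p - (k - b)) mod int N = (snd (block a b ij p) - k) mod int N"
          unfolding e by (rule mod_mult_self1[symmetric])+
      qed
      have near: "(x - c) mod int N \<in> {0, 1}" if "c \<le> x" "x \<le> c + 1" for x c :: int
      proof -
        have "x - c = 0 \<or> x - c = 1" using that by linarith
        then show ?thesis using N by (elim disjE) simp_all
      qed
      show "block a b ij p \<notin> ?H" using bspec[OF avoid that(2)] near[of h "fst (block a b ij p)"] near[of k "snd (block a b ij p)"]
        unfolding mod by (auto simp: box_def rect_def)
    qed
    have bl: "block a b ij p \<in> R - ?H" if "ij \<in> ?K - box h' k' (0 div int N) 0" "p \<in> sq N" for ij p
      using inside[of ij p] hole[of "block a b ij p"] index_block[OF that(2), of a b ij] that by auto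
    \<comment> \<open>A block clear of the hole must receive its own decoded tile, since all its
      cells are later compared with the expansion; the weaker property \<open>reads\<close> is then
      inherited. For the other blocks \<open>reads\<close> is all there is, and it is what makes
      neighbours of both kinds comparable.\<close>
    have "\<exists>t\<in>\<tau>. reads ij t \<and> (ij \<notin> box h' k' (0 div int N) 0 \<longrightarrow> (\<forall>p\<in>sq N. U (block a b ij p) = S t p))"
      if ij: "ij \<in> ?K" for ij
    proof (cases "ij \<in> box h' k' (0 div int N) 0")
      case True
      have "tiling \<tau> Q (\<lambda>p. U (block a b ij p))" by (rule block_tiling[OF U]) (rule blQ[OF ij])
      moreover have "\<forall>p\<in>Q. cx (U (block a b ij p)) = fst p \<and> cy (U (block a b ij p)) = snd p"
        using block_coord[OF ph _ blQ[OF ij]] Q by blast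
      ultimately show ?thesis using read[rule_format, of "\<lambda>p. U (block a b ij p)"] True unfolding reads_def by simp
    next
      case False
      then obtain t where "t \<in> \<tau>" and t: "\<And>p. p \<in> sq N \<Longrightarrow> U (block a b ij p) = S t p"
        using block_decode[OF U ph bl] ij by blast
      moreover have tQ: "U (block a b ij p) = S t p" if "p \<in> Q" for p using t Q that by blast
      have "reads ij t" unfolding reads_def by (simp add: tQ)
      ultimately show ?thesis using t by blast
    qed
    then obtain V where V: "\<And>ij. ij \<in> ?K \<Longrightarrow> V ij \<in> \<tau>" "\<And>ij. ij \<in> ?K \<Longrightarrow> reads ij (V ij)"
      and full: "\<And>ij p. ij \<in> ?K - box h' k' (0 div int N) 0 \<Longrightarrow> p \<in> sq N \<Longrightarrow> U (block a b ij p) = S (V ij) p"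
      by (metis DiffD1 DiffD2)
    have "tiling \<tau> ?K V"
    proof (rule blocks_tiling[OF V(1) U])
      fix i j assume B: "(i, j) \<in> ?K" "(i + 1, j) \<in> ?K"
      have "east (S (V (i, j)) (int N - 1, q)) = west (S (V (i + 1, j)) (0, q))"
        if q: "(0, q) \<in> Q" "(int N - 1, q) \<in> Q" for q
      proof -
        have "east (S (V (i, j)) (int N - 1, q)) = east (U (block a b (i, j) (int N - 1, q)))"
          "west (S (V (i + 1, j)) (0, q)) = west (U (block a b (i + 1, j) (0, q)))"
          using V(2)[OF B(1)] V(2)[OF B(2)] q unfolding reads_def by simp_all
        moreover have "east (U (block a b (i, j) (int N - 1, q))) = west (U (block a b (i + 1, j) (0, q)))"
          using tilingD(2)[OF U, of "fst (block a b (i, j) (int N - 1, q))" "snd (block a b (i, j) (int N - 1, q))"]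
            blQ[OF B(1) q(2)] blQ[OF B(2) q(1)] unfolding block_next_east by simp
        ultimately show ?thesis by simp
      qed
      then show "east (V (i, j)) = west (V (i + 1, j))" using bspec[OF bspec[OF east_north V(1)[OF B(1)]] V(1)[OF B(2)]] by blast
    next
      fix i j assume B: "(i, j) \<in> ?K" "(i, j + 1) \<in> ?K"
      have "north (S (V (i, j)) (q, int N - 1)) = south (S (V (i, j + 1)) (q, 0))"
        if q: "(q, 0) \<in> Q" "(q, int N - 1) \<in> Q" for q
      proof -
        have "north (S (V (i, j)) (q, int N - 1)) = north (U (block a b (i, j) (q, int N - 1)))"
          "south (S (V (i, j + 1)) (q, 0)) = south (U (block a b (i, j + 1) (q, 0)))"
          using V(2)[OF B(1)] V(2)[OF B(2)] q unfolding reads_def by simp_all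
        moreover have "north (U (block a b (i, j) (q, int N - 1))) = south (U (block a b (i, j + 1) (q, 0)))"
          using tilingD(3)[OF U, of "fst (block a b (i, j) (q, int N - 1))" "snd (block a b (i, j) (q, int N - 1))"]
            blQ[OF B(1) q(2)] blQ[OF B(2) q(1)] unfolding block_next_north by simp
        ultimately show ?thesis by simp
      qed
      then show "north (V (i, j)) = south (V (i, j + 1))" using bspec[OF bspec[OF east_north V(1)[OF B(1)]] V(1)[OF B(2)]] by blast
    qed
    then show "\<exists>V. tiling \<tau> ?K V \<and>
          (\<forall>ij \<in> ?K - box h' k' (0 div int N) 0. \<forall>p\<in>sq N. U (block a b ij p) = S (V ij) p)"
      using full by blast
  qed auto
  then show ?thesis by simp
qed

section \<open>Margins linear in the side of the hole\<close>

lemma tiling_subset: "tiling \<tau> R U \<Longrightarrow> R' \<subseteq> R \<Longrightarrow> tiling \<tau> R' U"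
  unfolding tiling_def by blast

lemma box_mono: "d \<le> d' \<Longrightarrow> box h k u d \<subseteq> box h k u d'"
  by (auto simp: box_def rect_def)

lemma repairable_mono:
  assumes "repairable u m d" "m \<le> m'" "d \<le> d'"
  shows "repairable u m' d'"
  unfolding repairable_def
proof (intro allI impI)
  fix l r l' r' h k U
  assume "box h k u m' \<subseteq> rect l r l' r'" "tiling \<tau> (rect l r l' r' - box h k u 0) U"
  then obtain V where "tiling \<tau> (rect l r l' r') V" "\<forall>p \<in> rect l r l' r' - box h k u d. V p = U p"
    using assms(1)[unfolded repairable_def] box_mono[OF assms(2), of h k u] by blast
  then show "\<exists>V. tiling \<tau> (rect l r l' r') V \<and> (\<forall>p \<in> rect l r l' r' - box h k u d'. V p = U p)"
    using box_mono[OF assms(3), of h k u] by blast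
qed

text \<open>Chosen so that \<open>scale * 1 - 4\<close> is \<open>int N * (int N * 3 + 2)\<close>,
  the margin that one step makes of the margin \<open>int N * 3\<close> of the base case.\<close>

definition scale :: int where "scale = int N * (int N * 3 + 2) + 4"

text \<open>A step sends a margin \<open>m\<close> to \<open>int N * (m + 2)\<close>, so a bound
  without constant term would not reproduce itself. With the offset 4 the step yields
  \<open>scale * (int N * v) - 2 * int N\<close> for \<open>v = u div int N\<close>, which is at
  most \<open>scale * u - 4\<close>; likewise the offset 5 of the radius turns into
  \<open>3 * int N\<close>.\<close>

lemma repairable_linear:
  assumes "1 \<le> u"
  shows "repairable u (scale * u - 4) (scale * u - 5)"
  using assms
proof (induction "nat u" arbitrary: u rule: less_induct)
  case less
  let ?v = "u div int N"
  have N3: "3 \<le> int N" using N by simp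
  have v: "0 \<le> ?v" "int N * ?v \<le> u" using less.prems N3 div_bounds[of "int N" u] by (auto simp: pos_imp_zdiv_nonneg_iff)
  have sc: "37 \<le> scale" using N3 mult_mono[of 3 "int N" 11 "int N * 3 + 2"] by (simp add: scale_def)
  show ?case
  proof (cases "?v = 0")
    case True
    have "repairable ?v (int N * 3) (int N * 3 - 1)"
      unfolding True by (rule repairable_mono[OF repairable_base]) (use N3 in auto)
    then have "repairable u (int N * (int N * 3 + 2)) (int N * (int N * 3 - 1 + 2))"
      by (rule repairable_step) (use less.prems N3 in auto)
    moreover have "scale * 1 \<le> scale * u" using sc less.prems by (intro mult_left_mono) auto
    ultimately show ?thesis
      by (elim repairable_mono) (use N3 in \<open>auto simp: scale_def algebra_simps\<close>)
  next
    case False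
    then have v1: "1 \<le> ?v" using v by simp
    have lt: "nat ?v < nat u" 
    proof -
      have "3 * ?v \<le> int N * ?v" using N3 v by (intro mult_right_mono) auto
      then have "?v < u" using v(2) v1 by linarith
      then show ?thesis using v(1) by simp
    qed
    have "scale * 1 \<le> scale * ?v" using sc v1 by (intro mult_left_mono) auto
    then have s1: "scale \<le> scale * ?v" by (simp only: mult_1_right)
    have "repairable u (int N * (scale * ?v - 4 + 2)) (int N * (scale * ?v - 5 + 2))"
      by (rule repairable_step[OF less.hyps[OF lt v1]]) (use s1 sc less.prems in linarith)+
    moreover have "scale * (int N * ?v) \<le> scale * u" using v(2) sc by (intro mult_left_mono) auto
    ultimately show ?thesis
      by (elim repairable_mono) (use N3 in \<open>auto simp: algebra_simps\<close>)
  qed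
qed

lemma robust_scale: "robust \<tau> (nat scale) (nat scale + 1)"
  unfolding robust_def Let_def
proof (intro allI impI)
  fix D :: nat and x y :: int and U
  let ?Big = "nbhd x y (int D) (int ((nat scale + 1) * D))"
  let ?Mid = "nbhd x y (int D) (int (nat scale * D))"
  assume U: "tiling \<tau> (?Big - nbhd x y (int D) 0) U"
  have N3: "3 \<le> int N" using N by simp
  have sc: "37 \<le> scale" "int N * 3 + 6 \<le> scale"
    using N3 mult_mono[of 3 "int N" 11 "int N * 3 + 2"] mult_right_mono[of 3 "int N" "int N * 3 + 2"]
    by (auto simp: scale_def)
  show "\<exists>V. tiling \<tau> ?Big V \<and> (\<forall>p\<in>?Big - ?Mid. V p = U p)"
  proof (cases "D = 0")
    case True
    then show ?thesis by (intro exI[of _ U]) (auto simp: nbhd_def tiling_def)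
  next
    case D: False
    \<comment> \<open>A single cell is enlarged to a hole of side 2. This adds a cell to the north
      and east only; the \<open>+ 1\<close> in the bounds below and in \<open>box_nbhd\<close> pays
      for it.\<close>
    define u where "u = max 0 (int D - 2)"
    define e where "e = (if u = 0 then int N * 3 else scale * u - 4)"
    define f where "f = (if u = 0 then int N * 2 else scale * u - 5)"
    have rep: "repairable u e f"
      using repairable_base repairable_linear[of u] by (auto simp: e_def f_def u_def)
    have D1: "1 \<le> int D" using D by simp
    have "scale * 1 \<le> scale * int D" using sc D1 by (intro mult_left_mono) auto
    then have sD: "scale \<le> scale * int D" by (simp only: mult_1_right)
    have ef: "e + 1 \<le> scale * int D" "f + 1 \<le> scale * int D" "0 \<le> e"
    proof -
      have "e + 1 \<le> scale * int D \<and> f + 1 \<le> scale * int D \<and> 0 \<le> e"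
      proof (cases "u = 0")
        case True
        then have "e = int N * 3" "f = int N * 2" by (simp_all add: e_def f_def)
        then show ?thesis using sD sc N3 by linarith
      next
        case False
        then have ef: "e = scale * u - 4" "f = scale * u - 5" by (simp_all add: e_def f_def)
        have "scale * u \<le> scale * int D" using sc by (intro mult_left_mono) (auto simp: u_def)
        moreover have "scale * 1 \<le> scale * u" using sc False by (intro mult_left_mono) (auto simp: u_def)
        then have "scale \<le> scale * u" by (simp only: mult_1_right)
        ultimately show ?thesis using sc ef by linarith
      qed
      then show "e + 1 \<le> scale * int D" "f + 1 \<le> scale * int D" "0 \<le> e" by auto
    qed
    have u: "0 \<le> u" "int D - 2 \<le> u" "u \<le> int D - 1" using D1 by (auto simp: u_def)
    have c: "int ((nat scale + 1) * D) = scale * int D + int D" "int (nat scale * D) = scale * int D"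
      using sc by (simp_all add: algebra_simps)
    have Big: "?Big = rect (x - int ((nat scale + 1) * D)) (x + int D - 1 + int ((nat scale + 1) * D))
        (y - int ((nat scale + 1) * D)) (y + int D - 1 + int ((nat scale + 1) * D))"
      by (auto simp: nbhd_def rect_def)
    have U': "tiling \<tau> (?Big - box x y u 0) U"
    proof (rule tiling_subset[OF U])
      have "nbhd x y (int D) 0 \<subseteq> box x y u 0"
      proof
        fix z assume "z \<in> nbhd x y (int D) 0"
        then have "x \<le> fst z" "fst z \<le> x + int D - 1" "y \<le> snd z" "snd z \<le> y + int D - 1"
          by (auto simp: nbhd_def)
        then have "x \<le> fst z" "fst z \<le> x + u + 1" "y \<le> snd z" "snd z \<le> y + u + 1" using u by linarith+
        then show "z \<in> box x y u 0" by (cases z) (simp add: box_def rect_def)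
      qed
      then show "?Big - box x y u 0 \<subseteq> ?Big - nbhd x y (int D) 0" by blast
    qed
    have box_nbhd: "box x y u m \<subseteq> nbhd x y (int D) M" if "m + 1 \<le> M" for m M
    proof
      fix z assume "z \<in> box x y u m"
      then have "x - m \<le> fst z" "fst z \<le> x + u + 1 + m" "y - m \<le> snd z" "snd z \<le> y + u + 1 + m"
        by (auto simp: box_def rect_def)
      then have "x - M \<le> fst z" "fst z \<le> x + int D - 1 + M" "y - M \<le> snd z" "snd z \<le> y + int D - 1 + M"
        using that u by linarith+
      then show "z \<in> nbhd x y (int D) M" by (simp add: nbhd_def case_prod_unfold)
    qed
    have "e + 1 \<le> scale * int D + int D" using ef(1) D1 by linarith
    then have "box x y u e \<subseteq> ?Big" unfolding c by (rule box_nbhd)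
    with U' obtain V where V: "tiling \<tau> ?Big V" "\<forall>p \<in> ?Big - box x y u f. V p = U p"
      using rep unfolding repairable_def Big by blast
    have "box x y u f \<subseteq> ?Mid" unfolding c by (rule box_nbhd[OF ef(2)])
    then show ?thesis using V by blast
  qed
qed

section \<open>Self-similarity and existence of tilings\<close>

lemma simulates_self: "simulates \<tau> \<tau> N S"
  unfolding simulates_def
proof (intro conjI allI impI ballI)
  show "1 < N" using N by simp
  show "macro_tile \<tau> N (S r)" if "r \<in> \<tau>" for r using S_tiling[OF that] by (simp add: macro_tile_def)
  show "r = s" if "r \<in> \<tau>" "s \<in> \<tau>" "\<forall>p\<in>sq N. S r p = S s p" for r s using S_inj that by blast
  have all_int: "(\<forall>i<N. P (int i)) \<longleftrightarrow> (\<forall>i. 0 \<le> i \<and> i < int N \<longrightarrow> P i)" for P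
    by (metis nat_0_le nat_less_iff of_nat_0_le_iff of_nat_less_iff)
  show "east r = west s \<longleftrightarrow> meast N (S r) = mwest N (S s)" if "r \<in> \<tau>" "s \<in> \<tau>" for r s
    unfolding S_east[OF that] meast_def mwest_def by (auto simp: all_int[symmetric])
  show "north r = south s \<longleftrightarrow> mnorth N (S r) = msouth N (S s)" if "r \<in> \<tau>" "s \<in> \<tau>" for r s
    unfolding S_north[OF that] mnorth_def msouth_def by (auto simp: all_int[symmetric])
  fix U assume U: "tiling \<tau> UNIV U"
  obtain a b where ab: "0 \<le> a" "a < int N" "0 \<le> b" "b < int N"
    and ph: "\<And>x y. (x, y) \<in> UNIV \<Longrightarrow> cx (U (x, y)) = (x - a) mod int N \<and> cy (U (x, y)) = (y - b) mod int N"
    using phase[OF U, of "(0, 0)"] linked_plane by blast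
  show "\<exists>!ab. 0 \<le> fst ab \<and> fst ab < int N \<and> 0 \<le> snd ab \<and> snd ab < int N \<and> splits \<tau> N S U (fst ab) (snd ab)"
  proof (rule ex1I[of _ "(a, b)"])
    have "splits \<tau> N S U a b" unfolding splits_def
      using block_decode[OF U ph] unfolding block_def by fastforce
    then show "0 \<le> fst (a, b) \<and> fst (a, b) < int N \<and> 0 \<le> snd (a, b) \<and> snd (a, b) < int N \<and>
        splits \<tau> N S U (fst (a, b)) (snd (a, b))" using ab by simp
  next
    fix ab assume A: "0 \<le> fst ab \<and> fst ab < int N \<and> 0 \<le> snd ab \<and> snd ab < int N \<and> splits \<tau> N S U (fst ab) (snd ab)"
    obtain a' b' where ab': "ab = (a', b')" by (cases ab)
    obtain r where r: "r \<in> \<tau>" "\<And>p. p \<in> sq N \<Longrightarrow> U (a' + 0 * int N + fst p, b' + 0 * int N + snd p) = S r p"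
      using A unfolding splits_def ab' by (metis fst_conv snd_conv)
    have z: "(0, 0) \<in> sq N" using N by (simp add: sq_def)
    \<comment> \<open>The lower left cell of any image shows the coordinates 0 and 0, which ties
      every admissible origin to the phase \<open>(a, b)\<close>.\<close>
    have "cx (U (a', b')) = 0 \<and> cy (U (a', b')) = 0" using r(2)[OF z] S_coord[OF r(1) z] by simp
    then have "(a' - a) mod int N = 0" "(b' - b) mod int N = 0" using ph[of a' b'] by simp_all
    then have "a' mod int N = a mod int N" "b' mod int N = b mod int N" by (metis mod_eq_dvd_iff dvd_eq_mod_eq_0)+
    then show "ab = (a, b)" using A ab ab' by simp
  qed
qed

text \<open>This excludes degenerate witnesses such as the empty tile set. The substitution is
  iterated with the origin placed at the cell \<open>(p, q)\<close> where \<open>t\<close>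
  reproduces itself; every cell is eventually constant, and the limit is a fixed point of
  \<open>expand\<close>. Matching is proved for the limit only, by descent to the edges inside a
  block.\<close>

lemma plane_tiling: "\<exists>U. tiling \<tau> UNIV U"
proof -
  obtain t p q where t: "t \<in> \<tau>" and p: "1 \<le> p" "p \<le> int N - 2" and q: "1 \<le> q" "q \<le> int N - 2"
    and t_child: "S t (p, q) = t" using seed by blast
  let ?i = "index (- p) (- q)" and ?p = "pos (- p) (- q)"
  define size where "size z = nat (\<bar>fst z\<bar> + \<bar>snd z\<bar>)" for z :: cell
  have N3: "3 \<le> int N" using N by simp
  \<comment> \<open>The bounds on \<open>r\<close> say that the origin is off the border of its
    block, and they leave 0 as the only fixed point: for \<open>r = 0\<close> also -1 would be
    fixed, and for \<open>r = int N - 1\<close> also 1.\<close>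
  have shrink: "\<bar>(x + r) div int N\<bar> \<le> \<bar>x\<bar>" "x \<noteq> 0 \<Longrightarrow> \<bar>(x + r) div int N\<bar> < \<bar>x\<bar>"
    if r: "1 \<le> r" "r \<le> int N - 2" for x r :: int
  proof -
    define d m where "d = (x + r) div int N" and "m = int N * d"
    have b: "m \<le> x + r" "x + r < m + int N" using div_bounds[of "int N"] N3 by (auto simp: d_def m_def)
    have up: "3 * d - 3 \<le> m - int N" if "1 \<le> d"
    proof -
      have "3 * (d - 1) \<le> int N * (d - 1)" using that N3 by (intro mult_right_mono) auto
      then show ?thesis by (simp add: m_def right_diff_distrib)
    qed
    have down: "- 3 * d - 3 \<le> - m - int N" if "d \<le> - 1"
    proof -
      have "3 * (- d - 1) \<le> int N * (- d - 1)" using that N3 by (intro mult_right_mono) auto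
      then show ?thesis by (simp add: m_def right_diff_distrib)
    qed
    have "d < x" if "1 \<le> d" using up[OF that] b(1) r(2) that by linarith
    moreover have "x < d" if "d \<le> - 1" using down[OF that] b(2) r(1) that by linarith
    ultimately have "\<bar>d\<bar> < \<bar>x\<bar> \<or> x = 0 \<and> d = 0"
      by (cases "d = 0"; cases "1 \<le> d") auto
    then show "\<bar>(x + r) div int N\<bar> \<le> \<bar>x\<bar>" "x \<noteq> 0 \<Longrightarrow> \<bar>(x + r) div int N\<bar> < \<bar>x\<bar>"
      by (auto simp: d_def)
  qed
  have size_less: "size (?i z) < size z" if "z \<noteq> (0, 0)" for z
    using shrink[OF p, of "fst z"] shrink[OF q, of "snd z"] that
    by (cases z) (auto simp: size_def index_def)
  have index0: "?i (0, 0) = (0, 0)" and pos0: "?p (0, 0) = (p, q)"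
    using p q by (simp_all add: index_def pos_def)
  \<comment> \<open>The constant start is no tiling in general; its influence on a cell
    \<open>z\<close> is gone after \<open>size z\<close> rounds.\<close>
  define F where "F n = ((\<lambda>V. expand (- p) (- q) V) ^^ n) (\<lambda>_. t)" for n :: nat
  have F_Suc: "F (Suc n) z = S (F n (?i z)) (?p z)" for n z by (simp add: F_def expand_def)
  have F_in: "F n z \<in> \<tau>" for n z
  proof (induction n arbitrary: z)
    case (Suc n)
    have "F (Suc n) z = expand (- p) (- q) (F n) z" by (simp add: F_def)
    then show ?case using expand_in[of "F n" "- p" "- q" z] Suc by simp
  qed (simp add: F_def t)
  have F0: "F n (0, 0) = t" for n
    by (induction n) (simp add: F_def, simp add: F_Suc index0 pos0 t_child)
  have stable: "size z \<le> n \<Longrightarrow> F (Suc n) z = F n z" for n z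
  proof (induction n arbitrary: z)
    case 0
    then have "z = (0, 0)" by (cases z) (auto simp: size_def)
    then show ?case by (simp add: F0)
  next
    case (Suc n)
    show ?case
    proof (cases "z = (0, 0)")
      case True then show ?thesis by (simp add: F0)
    next
      case False
      then have "F (Suc n) (?i z) = F n (?i z)" using Suc.IH[of "?i z"] size_less[OF False] Suc.prems by simp
      then show ?thesis by (simp add: F_Suc)
    qed
  qed
  define U where "U z = F (size z) z" for z
  have FU: "F n z = U z" if "size z \<le> n" for n z
    using that by (induction n rule: dec_induct) (simp_all add: U_def stable)
  have U: "U z = expand (- p) (- q) U z" for z
  proof (cases "z = (0, 0)")
    case True then show ?thesis by (simp add: U_def F0 expand_def index0 pos0 t_child)
  next
    case False
    have "U z = F (Suc (size z)) z" using FU[of z "Suc (size z)"] by simp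
    also have "\<dots> = S (U (?i z)) (?p z)" unfolding F_Suc using FU[of "?i z" "size z"] size_less[OF False] by simp
    finally show ?thesis by (simp add: expand_def)
  qed
  have U_in: "U z \<in> \<tau>" for z by (simp add: U_def F_in)
  \<comment> \<open>An edge between two blocks comes from the edge between their indices one level
    up. This measure of an edge strictly drops, so the descent ends at an edge inside a block, where
    the image of a single tile matches by itself.\<close>
  have edge: "\<bar>(x + r) div int N\<bar> + \<bar>(x + r) div int N + 1\<bar> < \<bar>x\<bar> + \<bar>x + 1\<bar>"
    if r: "1 \<le> r" "r \<le> int N - 2" and e: "(x + r) mod int N = int N - 1" for x r :: int
  proof -
    define d m where "d = (x + r) div int N" and "m = int N * d"
    have b: "x + r = m + int N - 1" using mult_div_mod_eq[of "int N" "x + r"] e by (simp add: d_def m_def)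
    have "\<bar>d\<bar> + \<bar>d + 1\<bar> < \<bar>x\<bar> + \<bar>x + 1\<bar>"
    proof (cases "0 \<le> d")
      case True
      then have "3 * d \<le> m" unfolding m_def using N3 by (intro mult_right_mono) auto
      then have "d < x" using b r(2) True by linarith
      then show ?thesis using True by simp
    next
      case False
      then have "3 * (- d - 1) \<le> int N * (- d - 1)" using N3 by (intro mult_right_mono) auto
      then have "- 3 * d - 3 \<le> - m - int N" by (simp add: m_def right_diff_distrib)
      then have "x < d" using b r(1) False by linarith
      then show ?thesis using False by simp
    qed
    then show ?thesis by (simp add: d_def)
  qed
  have east: "east (U (x, y)) = west (U (x + 1, y))" for x y
  proof (induction "nat (\<bar>x\<bar> + \<bar>x + 1\<bar>)" arbitrary: x y rule: less_induct)
    case less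
    show ?case unfolding U[of "(x, y)"] U[of "(x + 1, y)"]
    proof (rule expand_east[OF U_in U_in])
      fix i j assume "?i (x, y) = (i, j)" "fst (?p (x, y)) = int N - 1"
      then have "i = (x + p) div int N" "(x + p) mod int N = int N - 1" by (auto simp: index_def pos_def)
      then show "east (U (i, j)) = west (U (i + 1, j))" using less[of i j] edge[OF p, of x] by simp
    qed
  qed
  have north: "north (U (x, y)) = south (U (x, y + 1))" for x y
  proof (induction "nat (\<bar>y\<bar> + \<bar>y + 1\<bar>)" arbitrary: x y rule: less_induct)
    case less
    show ?case unfolding U[of "(x, y)"] U[of "(x, y + 1)"]
    proof (rule expand_north[OF U_in U_in])
      fix i j assume "?i (x, y) = (i, j)" "snd (?p (x, y)) = int N - 1"
      then have "j = (y + q) div int N" "(y + q) mod int N = int N - 1" by (auto simp: index_def pos_def)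
      then show "north (U (i, j)) = south (U (i, j + 1))" using less[of j i] edge[OF q, of y] by simp
    qed
  qed
  show ?thesis unfolding tiling_def using U_in east north by blast
qed

end

section \<open>Gates and signals\<close>

text \<open>\<open>Raw\<close> is the neutral tag and not a gate proper: no quadruple of signals
  satisfies it. The suffixes \<open>R\<close> and \<open>C\<close> stand for row and column:
  \<open>FirstR\<close> starts a horizontal line with a copy of the vertical wire that it crosses,
  \<open>LastR\<close> ends one, and \<open>FirstC\<close> and \<open>LastC\<close> do the same for
  vertical lines.\<close>

datatype gate = Raw | Cross | Link | FirstR | LastR | FirstC | LastC | LinkP | PosN | PosE
  | TagN | TagE | TagS | TagW | MergeN | MergeE | MergeS | MergeW | Check

datatype dig = Blank | Place nat nat | Tag gate

datatype side = No | Ea | So | We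

instance gate :: countable by countable_datatype
instance dig :: countable by countable_datatype

text \<open>
  The tag of a signal is \<open>Raw\<close> on ordinary wires; the other tags, names of gates, occur only next to
  \<open>Check\<close> gates.
\<close>

type_synonym signal = "gate \<times> dig"

text \<open>Rows are listed from south to north: \<open>core ! y ! x\<close>.\<close>

definition core :: "gate list list" where
  "core = [[FirstR, TagS, Cross, MergeS, Cross],
           [Cross, Cross, MergeW, Check, MergeE],
           [FirstR, TagN, Cross, MergeN, Cross],
           [Cross, Cross, TagW, Cross, TagE],
           [PosN, Cross, LastC, Cross, PosE]]"

text \<open>
  Columns 0, 1, 17, 18 and rows 0, 1, 17, 18 carry links that equate the tags (in 0 and 17) and the digits
  (in 1 and 18) that the three copies read on one and the same side.
\<close>

definition gate_at :: "nat \<Rightarrow> nat \<Rightarrow> gate" where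
  "gate_at x y =
    (let k = (x - 2) div 5; l = (y - 2) div 5; i = (x - 2) mod 5; j = (y - 2) mod 5;
         inx = (2 \<le> x \<and> x < 17); iny = (2 \<le> y \<and> y < 17) in
     if inx \<and> iny then
       if k = l then core ! j ! i else if k < l \<and> i = 0 \<and> j = 4 then LinkP else Cross
     else if inx \<and> ((y = 0 \<or> y = 17) \<and> i = 1 \<or> (y = 1 \<or> y = 18) \<and> i = 3) then [FirstR, Link, LastR] ! k
     else if iny \<and> ((x = 0 \<or> x = 17) \<and> j = 3 \<or> (x = 1 \<or> x = 18) \<and> j = 1) then [FirstC, Link, LastC] ! l
     else Cross)"

text \<open>The sides that carry a marked signal: all sides of \<open>Check\<close>, and of each
  merging gate the one that faces \<open>Check\<close>.\<close>

fun merged :: "gate \<Rightarrow> side \<Rightarrow> bool" where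
  "merged Check _ = True"
| "merged MergeN d = (d = So)"
| "merged MergeE d = (d = We)"
| "merged MergeS d = (d = No)"
| "merged MergeW d = (d = Ea)"
| "merged _ _ = False"

definition lift_tag :: "gate \<Rightarrow> side \<Rightarrow> gate \<Rightarrow> gate" where
  "lift_tag g d t = (if merged g d then t else g)"

definition lift :: "gate \<Rightarrow> side \<Rightarrow> signal \<Rightarrow> signal" where
  "lift g d b = (lift_tag g d (fst b), snd b)"

text \<open>The place \<open>p\<close> of the simulated tile reveals its gate. The tag
  \<open>t\<close> must be \<open>Raw\<close> exactly on the sides that this gate does not mark; the
  output \<open>u\<close> is the mark under which the signal is to arrive at
  \<open>Check\<close>.\<close>

definition tagging :: "side \<Rightarrow> dig \<Rightarrow> dig \<Rightarrow> dig \<Rightarrow> bool" where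
  "tagging d p t u \<longleftrightarrow> (\<exists>a b c. a < 19 \<and> b < 19 \<and> p = Place a b \<and> t = Tag c \<and>
     (merged (gate_at a b) d \<longleftrightarrow> c \<noteq> Raw) \<and> u = Tag (lift_tag (gate_at a b) d c))"

definition inc :: "nat \<Rightarrow> nat" where "inc a = (a + 1) mod 19"

text \<open>For \<open>LinkP\<close>, the vertical place wire comes from a copy further south and
  has already passed its \<open>PosN\<close>, while the horizontal one has yet to reach the
  \<open>PosE\<close> of its own copy. Equal places therefore appear there as \<open>b\<close>
  against \<open>inc b\<close>.\<close>

fun raw_rel :: "gate \<Rightarrow> dig \<Rightarrow> dig \<Rightarrow> dig \<Rightarrow> dig \<Rightarrow> bool" where
  "raw_rel Cross n e s w = (n = s \<and> e = w)"
| "raw_rel Link n e s w = (n = s \<and> e = w \<and> e = n)"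
| "raw_rel FirstR n e s w = (n = s \<and> e = n \<and> w = Blank)"
| "raw_rel LastR n e s w = (n = s \<and> w = n \<and> e = Blank)"
| "raw_rel FirstC n e s w = (e = w \<and> n = w \<and> s = Blank)"
| "raw_rel LastC n e s w = (e = w \<and> s = w \<and> n = Blank)"
| "raw_rel LinkP n e s w = (n = s \<and> e = w \<and> (\<exists>a b. w = Place a b \<and> s = Place a (inc b)))"
| "raw_rel PosN n e s w = (e = w \<and> s = w \<and> (\<exists>a b. a < 19 \<and> b < 19 \<and> w = Place a b \<and> n = Place a (inc b)))"
| "raw_rel PosE n e s w = (s = w \<and> n = Blank \<and> (\<exists>a b. w = Place a b \<and> e = Place (inc a) b))"
| "raw_rel TagN n e s w = (s = Blank \<and> tagging No w n e)"
| "raw_rel TagS n e s w = (n = Blank \<and> tagging So w s e)"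
| "raw_rel TagW n e s w = (e = Blank \<and> tagging We n w s)"
| "raw_rel TagE n e s w = (w = Blank \<and> tagging Ea n e s)"
| "raw_rel _ n e s w = False"

definition merging :: "signal \<Rightarrow> signal \<Rightarrow> signal \<Rightarrow> signal \<Rightarrow> bool" where
  "merging u h m z \<longleftrightarrow> (\<exists>c v. c \<noteq> Raw \<and> u = (Raw, Tag c) \<and> h = (Raw, v) \<and> m = (c, v) \<and> z = (Raw, Blank))"

fun base_rel :: "gate \<Rightarrow> signal \<Rightarrow> signal \<Rightarrow> signal \<Rightarrow> signal \<Rightarrow> bool" where
  "base_rel MergeN n e s w = merging w n s e"
| "base_rel MergeS n e s w = merging w s n e"
| "base_rel MergeW n e s w = merging n w e s"
| "base_rel MergeE n e s w = merging n e w s"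
| "base_rel g n e s w = (fst n = Raw \<and> fst e = Raw \<and> fst s = Raw \<and> fst w = Raw \<and>
     raw_rel g (snd n) (snd e) (snd s) (snd w))"

text \<open>The gates other than \<open>Check\<close> do not refer to \<open>Check\<close>, so this is not recursive.\<close>

definition rel :: "gate \<Rightarrow> signal \<Rightarrow> signal \<Rightarrow> signal \<Rightarrow> signal \<Rightarrow> bool" where
  "rel g n e s w \<longleftrightarrow>
     (if g = Check then \<exists>g' n' e' s' w'. base_rel g' n' e' s' w' \<and>
        n = lift g' No n' \<and> e = lift g' Ea e' \<and> s = lift g' So s' \<and> w = lift g' We w'
      else base_rel g n e s w)"

lemma base_rel_imp: "base_rel g n e s w \<Longrightarrow> g \<noteq> Check \<and> g \<noteq> Raw"
  by (cases g) auto

lemma base_rel_merged: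
  assumes "base_rel g n e s w"
  shows "(merged g No \<longleftrightarrow> fst n \<noteq> Raw)" "(merged g Ea \<longleftrightarrow> fst e \<noteq> Raw)"
    "(merged g So \<longleftrightarrow> fst s \<noteq> Raw)" "(merged g We \<longleftrightarrow> fst w \<noteq> Raw)"
  using assms by (cases g; auto simp: merging_def)+

lemma lift_tag_not_Raw:
  assumes "base_rel g n e s w"
  shows "lift_tag g No (fst n) \<noteq> Raw" "lift_tag g Ea (fst e) \<noteq> Raw"
    "lift_tag g So (fst s) \<noteq> Raw" "lift_tag g We (fst w) \<noteq> Raw"
  using base_rel_merged[OF assms] base_rel_imp[OF assms] by (auto simp: lift_tag_def)

lemma rel_merged:
  assumes "rel g n e s w"
  shows "(merged g No \<longleftrightarrow> fst n \<noteq> Raw)" "(merged g Ea \<longleftrightarrow> fst e \<noteq> Raw)"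
    "(merged g So \<longleftrightarrow> fst s \<noteq> Raw)" "(merged g We \<longleftrightarrow> fst w \<noteq> Raw)"
  using assms base_rel_merged lift_tag_not_Raw
  by (auto simp: rel_def lift_def split: if_splits)

text \<open>Neither gate is \<open>Check\<close>, so each has at most one merged side. Hence some
  side is merged for neither, and there the two marks are \<open>g\<close> and \<open>g'\<close>
  themselves.\<close>

lemma lift_gate_eq:
  assumes "base_rel g' n' e' s' w'" "g \<noteq> Check"
    "lift g No n = lift g' No n'" "lift g Ea e = lift g' Ea e'"
    "lift g So s = lift g' So s'" "lift g We w = lift g' We w'"
  shows "g' = g"
  using assms(2-) base_rel_imp[OF assms(1)]
  by (cases g; cases g') (auto simp: lift_def lift_tag_def)

lemma lift_Check: "lift Check d b = b"
  by (simp add: lift_def lift_tag_def)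

text \<open>The table of \<open>Check\<close> mentions no particular gate, yet tests the right one:
  the marks name \<open>g\<close> by \<open>lift_gate_eq\<close>, and lifting forgets nothing, since
  the tag that it overwrites is known to be \<open>Raw\<close>. For \<open>g = Check\<close> lifting
  is the identity.\<close>

lemma rel_from_lift:
  assumes "rel Check (lift g No n) (lift g Ea e) (lift g So s) (lift g We w)"
    and "(merged g No \<longleftrightarrow> fst n \<noteq> Raw)" "(merged g Ea \<longleftrightarrow> fst e \<noteq> Raw)"
    "(merged g So \<longleftrightarrow> fst s \<noteq> Raw)" "(merged g We \<longleftrightarrow> fst w \<noteq> Raw)"
  shows "rel g n e s w"
proof (cases "g = Check")
  case True then show ?thesis using assms(1) by (simp add: lift_Check)
next
  case False
  obtain g' n' e' s' w' where b: "base_rel g' n' e' s' w'"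
    and l: "lift g No n = lift g' No n'" "lift g Ea e = lift g' Ea e'"
      "lift g So s = lift g' So s'" "lift g We w = lift g' We w'"
    using assms(1) unfolding rel_def by auto
  have g: "g' = g" by (rule lift_gate_eq[OF b False l])
  have inj: "c = c'" if "lift g d c = lift g d c'" "merged g d \<longleftrightarrow> fst c \<noteq> Raw" "merged g d \<longleftrightarrow> fst c' \<noteq> Raw" for d c c'
    using that by (cases c; cases c') (auto simp: lift_def lift_tag_def split: if_splits)
  have "n = n'" "e = e'" "s = s'" "w = w'"
    using base_rel_merged[OF b] l assms(2-5) inj unfolding g by blast+
  then show ?thesis using b False by (simp add: g rel_def)
qed

lemma rel_imp_lift:
  assumes "rel g n e s w"
  shows "rel Check (lift g No n) (lift g Ea e) (lift g So s) (lift g We w)"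
proof (cases "g = Check")
  case True then show ?thesis using assms by (simp add: lift_Check)
next
  case False then show ?thesis using assms unfolding rel_def by (simp del: split_paired_Ex) blast
qed

abbreviation raw :: "dig \<Rightarrow> signal" where "raw v \<equiv> (Raw, v)"

type_synonym ctile = "nat \<times> nat \<times> signal \<times> signal \<times> signal \<times> signal"

section \<open>The image of a tile\<close>

text \<open>
  Below, \<open>V x y\<close> is the signal on the south side of the cell \<open>(x, y)\<close> and on the north side of
  \<open>(x, y - 1)\<close>, and \<open>H x y\<close> the one on the west side of \<open>(x, y)\<close> and on the east side of \<open>(x - 1, y)\<close>.
\<close>

fun core_col :: "gate \<Rightarrow> ctile \<Rightarrow> nat \<Rightarrow> nat \<Rightarrow> nat \<Rightarrow> signal" where
  "core_col g (a, b, n, e, s, w) c i y =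
    (if i = 0 then if y \<le> c + 4 then raw (Place a b) else raw (Place a (inc b))
     else if i = 1 then if y \<le> c then raw (Tag (fst s)) else if y \<le> c + 2 then raw Blank else raw (Tag (fst n))
     else if i = 3 then if y \<le> c then raw (snd s) else if y = c + 1 then lift g So s
       else if y = c + 2 then lift g No n else raw (snd n)
     else if y \<le> c + 1 then raw Blank
       else if y \<le> c + 3 then raw (Tag (if i = 2 then lift_tag g We (fst w) else lift_tag g Ea (fst e)))
       else if y = c + 4 then raw (Place a b) else raw Blank)"

fun core_row :: "gate \<Rightarrow> ctile \<Rightarrow> nat \<Rightarrow> nat \<Rightarrow> nat \<Rightarrow> signal" where
  "core_row g (a, b, n, e, s, w) c j x =
    (if j = 4 then if x \<le> c + 4 then raw (Place a b) else raw (Place (inc a) b)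
     else if j = 3 then if x \<le> c + 2 then raw (Tag (fst w)) else if x \<le> c + 4 then raw Blank else raw (Tag (fst e))
     else if j = 1 then if x \<le> c + 2 then raw (snd w) else if x = c + 3 then lift g We w
       else if x = c + 4 then lift g Ea e else raw (snd e)
     else if x \<le> c then raw Blank
       else if x = c + 1 then raw (Place a b)
       else if x \<le> c + 3 then raw (Tag (if j = 0 then lift_tag g So (fst s) else lift_tag g No (fst n)))
       else raw Blank)"

definition link_line :: "nat \<Rightarrow> nat \<Rightarrow> dig \<Rightarrow> nat \<Rightarrow> signal" where
  "link_line lo hi v y = (if y \<le> lo \<or> hi < y then raw Blank else raw v)"

fun vert :: "gate \<Rightarrow> ctile \<Rightarrow> nat \<Rightarrow> nat \<Rightarrow> signal" where
  "vert g (a, b, n, e, s, w) x y =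
    (if x = 0 then link_line 5 15 (Tag (fst w)) y
     else if x = 1 then link_line 3 13 (snd w) y
     else if x = 17 then link_line 5 15 (Tag (fst e)) y
     else if x = 18 then link_line 3 13 (snd e) y
     else core_col g (a, b, n, e, s, w) (2 + 5 * ((x - 2) div 5)) ((x - 2) mod 5) y)"

fun horiz :: "gate \<Rightarrow> ctile \<Rightarrow> nat \<Rightarrow> nat \<Rightarrow> signal" where
  "horiz g (a, b, n, e, s, w) x y =
    (if y = 0 then link_line 3 13 (Tag (fst s)) x
     else if y = 1 then link_line 5 15 (snd s) x
     else if y = 17 then link_line 3 13 (Tag (fst n)) x
     else if y = 18 then link_line 5 15 (snd n) x
     else core_row g (a, b, n, e, s, w) (2 + 5 * ((y - 2) div 5)) ((y - 2) mod 5) x)"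

lemma less_19_cases:
  assumes "(x::nat) < 19"
  shows "x = 0 \<or> x = 1 \<or> x = 2 \<or> x = 3 \<or> x = 4 \<or> x = 5 \<or> x = 6 \<or> x = 7 \<or> x = 8 \<or> x = 9 \<or>
    x = 10 \<or> x = 11 \<or> x = 12 \<or> x = 13 \<or> x = 14 \<or> x = 15 \<or> x = 16 \<or> x = 17 \<or> x = 18"
  using assms by presburger

lemma inc_less: "inc a < 19" by (simp add: inc_def)

text \<open>The 361 cells are checked one by one. Everything known about the simulated tile is put
  into hypotheses that serve directly as rewrite rules at the tagging, merging and checking gates,
  so \<open>lift\<close> and \<open>tagging\<close> stay folded; the remaining cells only compare
  wires.\<close>

lemma child_valid_aux:
  assumes ab: "a < 19" "b < 19"
    and tg: "tagging No (Place a b) (Tag (fst n)) (Tag (lift_tag g No (fst n)))"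
      "tagging Ea (Place a b) (Tag (fst e)) (Tag (lift_tag g Ea (fst e)))"
      "tagging So (Place a b) (Tag (fst s)) (Tag (lift_tag g So (fst s)))"
      "tagging We (Place a b) (Tag (fst w)) (Tag (lift_tag g We (fst w)))"
    and nr: "lift_tag g No (fst n) \<noteq> Raw" "lift_tag g Ea (fst e) \<noteq> Raw"
      "lift_tag g So (fst s) \<noteq> Raw" "lift_tag g We (fst w) \<noteq> Raw"
    and chk: "rel Check (lift g No n) (lift g Ea e) (lift g So s) (lift g We w)"
    and x: "x < 19" and y: "y < 19"
  shows "rel (gate_at x y) (vert g (a, b, n, e, s, w) x (Suc y)) (horiz g (a, b, n, e, s, w) (Suc x) y)
           (vert g (a, b, n, e, s, w) x y) (horiz g (a, b, n, e, s, w) x y)"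
proof -
  have [simp]: "rel g' p q r t = base_rel g' p q r t" if "g' \<noteq> Check" for g' p q r t
    using that by (simp add: rel_def)
  have [simp]: "merging (Raw, Tag (lift_tag g d (fst u))) (Raw, snd u) (lift g d u) (Raw, Blank)"
    if "lift_tag g d (fst u) \<noteq> Raw" for d u
    using that by (simp add: merging_def lift_def)
  from less_19_cases[OF x] less_19_cases[OF y] show ?thesis
    apply (elim disjE)
    apply (simp_all add: ab tg nr chk gate_at_def core_def link_line_def)
    done
qed

lemma child_valid:
  assumes ab: "a < 19" "b < 19" and r: "rel (gate_at a b) n e s w" and xy: "x < 19" "y < 19"
  defines "g \<equiv> gate_at a b"
  shows "rel (gate_at x y) (vert g (a, b, n, e, s, w) x (Suc y)) (horiz g (a, b, n, e, s, w) (Suc x) y)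
           (vert g (a, b, n, e, s, w) x y) (horiz g (a, b, n, e, s, w) x y)"
proof -
  have g: "g \<noteq> Raw" using r by (auto simp: g_def rel_def dest: base_rel_imp split: if_splits)
  have m: "merged g No \<longleftrightarrow> fst n \<noteq> Raw" "merged g Ea \<longleftrightarrow> fst e \<noteq> Raw"
     "merged g So \<longleftrightarrow> fst s \<noteq> Raw" "merged g We \<longleftrightarrow> fst w \<noteq> Raw"
    using rel_merged[OF r] by (simp_all add: g_def)
  show ?thesis
  proof (rule child_valid_aux[OF ab _ _ _ _ _ _ _ _ _ xy])
    show "rel Check (lift g No n) (lift g Ea e) (lift g So s) (lift g We w)"
      using rel_imp_lift[OF r] by (simp add: g_def)
  qed (use g m ab in \<open>auto simp: tagging_def lift_tag_def g_def\<close>)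
qed

section \<open>Decoding a macro-tile\<close>

lemma rel_Cross: "rel Cross n e s w \<Longrightarrow> n = s \<and> e = w"
  by (simp add: rel_def prod_eq_iff)

lemma col_pass:
  assumes "rel g n e s w" "g \<in> {Cross, Link, FirstR, LastR, LinkP}"
  shows "n = s"
  using assms by (auto simp: rel_def prod_eq_iff)

lemma row_pass:
  assumes "rel g n e s w" "g \<in> {Cross, Link, FirstC, LastC, LinkP}"
  shows "e = w"
  using assms by (auto simp: rel_def prod_eq_iff)

text \<open>The values are forced along the flow of data. \<open>PosN\<close> reads the place, which
  travels down column 0 and along row 4 and branches off to the four tagging gates; column 1 and row
  3 bring the tags, column 3 and row 1 the digits. Tagging and merging gates hand the marked signals
  to \<open>Check\<close>, and \<open>rel_from_lift\<close> turns its acceptance into the relation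
  of the simulated gate. At the cell \<open>(4, 0)\<close> only blanks cross; without it just its
  outer sides \<open>v 4 0\<close> and \<open>h 5 0\<close> remain open.\<close>

lemma core_decode:
  fixes v h :: "nat \<Rightarrow> nat \<Rightarrow> signal"
  assumes cell: "\<And>i j. i < 5 \<Longrightarrow> j < 5 \<Longrightarrow> (i, j) \<noteq> (4, 0) \<Longrightarrow>
      rel (core ! j ! i) (v i (Suc j)) (h (Suc i) j) (v i j) (h i j)"
  obtains a b n e s w where "a < 19" "b < 19" "rel (gate_at a b) n e s w"
    "\<And>i j. i < 5 \<Longrightarrow> j \<le> 5 \<Longrightarrow> (i, j) \<noteq> (4, 0) \<Longrightarrow> v i j = core_col (gate_at a b) (a, b, n, e, s, w) 0 i j"
    "\<And>i j. i \<le> 5 \<Longrightarrow> j < 5 \<Longrightarrow> (i, j) \<noteq> (5, 0) \<Longrightarrow> h i j = core_row (gate_at a b) (a, b, n, e, s, w) 0 j i"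
proof -
  have c00: "rel FirstR (v 0 1) (h 1 0) (v 0 0) (h 0 0)" using cell[of 0 0] by (simp add: core_def)
  have c10: "rel TagS (v 1 1) (h 2 0) (v 1 0) (h 1 0)" using cell[of 1 0] by (simp add: core_def numeral_eq_Suc)
  have c20: "rel Cross (v 2 1) (h 3 0) (v 2 0) (h 2 0)" using cell[of 2 0] by (simp add: core_def numeral_eq_Suc)
  have c30: "rel MergeS (v 3 1) (h 4 0) (v 3 0) (h 3 0)" using cell[of 3 0] by (simp add: core_def numeral_eq_Suc)
  have c01: "rel Cross (v 0 2) (h 1 1) (v 0 1) (h 0 1)" using cell[of 0 1] by (simp add: core_def numeral_eq_Suc)
  have c11: "rel Cross (v 1 2) (h 2 1) (v 1 1) (h 1 1)" using cell[of 1 1] by (simp add: core_def numeral_eq_Suc)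
  have c21: "rel MergeW (v 2 2) (h 3 1) (v 2 1) (h 2 1)" using cell[of 2 1] by (simp add: core_def numeral_eq_Suc)
  have c31: "rel Check (v 3 2) (h 4 1) (v 3 1) (h 3 1)" using cell[of 3 1] by (simp add: core_def numeral_eq_Suc)
  have c41: "rel MergeE (v 4 2) (h 5 1) (v 4 1) (h 4 1)" using cell[of 4 1] by (simp add: core_def numeral_eq_Suc)
  have c02: "rel FirstR (v 0 3) (h 1 2) (v 0 2) (h 0 2)" using cell[of 0 2] by (simp add: core_def numeral_eq_Suc)
  have c12: "rel TagN (v 1 3) (h 2 2) (v 1 2) (h 1 2)" using cell[of 1 2] by (simp add: core_def numeral_eq_Suc)
  have c22: "rel Cross (v 2 3) (h 3 2) (v 2 2) (h 2 2)" using cell[of 2 2] by (simp add: core_def numeral_eq_Suc)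
  have c32: "rel MergeN (v 3 3) (h 4 2) (v 3 2) (h 3 2)" using cell[of 3 2] by (simp add: core_def numeral_eq_Suc)
  have c42: "rel Cross (v 4 3) (h 5 2) (v 4 2) (h 4 2)" using cell[of 4 2] by (simp add: core_def numeral_eq_Suc)
  have c03: "rel Cross (v 0 4) (h 1 3) (v 0 3) (h 0 3)" using cell[of 0 3] by (simp add: core_def numeral_eq_Suc)
  have c13: "rel Cross (v 1 4) (h 2 3) (v 1 3) (h 1 3)" using cell[of 1 3] by (simp add: core_def numeral_eq_Suc)
  have c23: "rel TagW (v 2 4) (h 3 3) (v 2 3) (h 2 3)" using cell[of 2 3] by (simp add: core_def numeral_eq_Suc)
  have c33: "rel Cross (v 3 4) (h 4 3) (v 3 3) (h 3 3)" using cell[of 3 3] by (simp add: core_def numeral_eq_Suc)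
  have c43: "rel TagE (v 4 4) (h 5 3) (v 4 3) (h 4 3)" using cell[of 4 3] by (simp add: core_def numeral_eq_Suc)
  have c04: "rel PosN (v 0 5) (h 1 4) (v 0 4) (h 0 4)" using cell[of 0 4] by (simp add: core_def numeral_eq_Suc)
  have c14: "rel Cross (v 1 5) (h 2 4) (v 1 4) (h 1 4)" using cell[of 1 4] by (simp add: core_def numeral_eq_Suc)
  have c24: "rel LastC (v 2 5) (h 3 4) (v 2 4) (h 2 4)" using cell[of 2 4] by (simp add: core_def numeral_eq_Suc)
  have c34: "rel Cross (v 3 5) (h 4 4) (v 3 4) (h 3 4)" using cell[of 3 4] by (simp add: core_def numeral_eq_Suc)
  have c44: "rel PosE (v 4 5) (h 5 4) (v 4 4) (h 4 4)" using cell[of 4 4] by (simp add: core_def numeral_eq_Suc)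
  obtain a b where ab: "a < 19" "b < 19" and p: "h 0 4 = raw (Place a b)" "h 1 4 = raw (Place a b)"
    "v 0 4 = raw (Place a b)" "v 0 5 = raw (Place a (inc b))"
    using c04 by (auto simp: rel_def prod_eq_iff)
  have p2: "h 2 4 = raw (Place a b)" "h 3 4 = raw (Place a b)" "h 4 4 = raw (Place a b)" "v 2 4 = raw (Place a b)" "v 2 5 = raw Blank"
    "v 4 4 = raw (Place a b)" "v 4 5 = raw Blank" "h 5 4 = raw (Place (inc a) b)"
    "v 0 3 = raw (Place a b)" "v 0 2 = raw (Place a b)" "v 0 1 = raw (Place a b)" "v 0 0 = raw (Place a b)"
    "h 0 0 = raw Blank" "h 1 0 = raw (Place a b)" "h 0 2 = raw Blank" "h 1 2 = raw (Place a b)"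
    using p c14 c24 c34 c44 c03 c02 c01 c00 by (auto simp: rel_def prod_eq_iff)
  define g where "g = gate_at a b"
  obtain tw where tw: "h 2 3 = raw (Tag tw)" "merged g We \<longleftrightarrow> tw \<noteq> Raw" "v 2 3 = raw (Tag (lift_tag g We tw))" "h 3 3 = raw Blank"
    using c23 p2(4) by (auto simp: rel_def prod_eq_iff tagging_def g_def)
  obtain te where te: "h 5 3 = raw (Tag te)" "merged g Ea \<longleftrightarrow> te \<noteq> Raw" "v 4 3 = raw (Tag (lift_tag g Ea te))" "h 4 3 = raw Blank"
    using c43 p2(6) by (auto simp: rel_def prod_eq_iff tagging_def g_def)
  obtain tn where tn: "v 1 3 = raw (Tag tn)" "merged g No \<longleftrightarrow> tn \<noteq> Raw" "h 2 2 = raw (Tag (lift_tag g No tn))" "v 1 2 = raw Blank"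
    using c12 p2(16) by (auto simp: rel_def prod_eq_iff tagging_def g_def)
  obtain ts where ts: "v 1 0 = raw (Tag ts)" "merged g So \<longleftrightarrow> ts \<noteq> Raw" "h 2 0 = raw (Tag (lift_tag g So ts))" "v 1 1 = raw Blank"
    using c10 p2(14) by (auto simp: rel_def prod_eq_iff tagging_def g_def)
  have q: "v 1 4 = raw (Tag tn)" "v 1 5 = raw (Tag tn)" "h 0 3 = raw (Tag tw)" "h 1 3 = raw (Tag tw)"
    "v 2 2 = v 2 3" "h 3 2 = h 2 2" "v 4 2 = v 4 3" "h 5 2 = h 4 2" "h 3 0 = h 2 0" "v 2 0 = v 2 1"
    "v 3 4 = v 3 3" "v 3 5 = v 3 3" "h 0 1 = h 2 1" "h 1 1 = h 2 1"
    using tn tw rel_Cross[OF c14] rel_Cross[OF c03] rel_Cross[OF c13] rel_Cross[OF c22] rel_Cross[OF c42] rel_Cross[OF c20]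
      rel_Cross[OF c33] rel_Cross[OF c34] rel_Cross[OF c01] rel_Cross[OF c11] by metis+
  obtain hn where hn: "v 3 3 = raw hn" "v 3 2 = (lift_tag g No tn, hn)" "h 4 2 = raw Blank"
    using c32 q(6) tn(3) by (auto simp: rel_def merging_def)
  obtain hs where hs: "v 3 0 = raw hs" "v 3 1 = (lift_tag g So ts, hs)" "h 4 0 = raw Blank"
    using c30 q(9) ts(3) by (auto simp: rel_def merging_def)
  obtain hw where hw: "h 2 1 = raw hw" "h 3 1 = (lift_tag g We tw, hw)" "v 2 1 = raw Blank"
    using c21 q(5) tw(3) by (auto simp: rel_def merging_def)
  obtain he where he: "h 5 1 = raw he" "h 4 1 = (lift_tag g Ea te, he)" "v 4 1 = raw Blank"
    using c41 q(7) te(3) by (auto simp: rel_def merging_def)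
  have rl: "rel g (tn, hn) (te, he) (ts, hs) (tw, hw)"
    by (rule rel_from_lift) (use c31 hn hs hw he tn te ts tw in \<open>simp_all add: lift_def\<close>)
  show thesis
  proof (rule that[OF ab rl[unfolded g_def]])
    fix i j :: nat
    have five: "k < 5 \<Longrightarrow> k = 0 \<or> k = 1 \<or> k = 2 \<or> k = 3 \<or> k = 4"
      "k \<le> 5 \<Longrightarrow> k = 0 \<or> k = 1 \<or> k = 2 \<or> k = 3 \<or> k = 4 \<or> k = 5" for k :: nat by presburger+
    show "v i j = core_col (gate_at a b) (a, b, (tn, hn), (te, he), (ts, hs), (tw, hw)) 0 i j"
      if "i < 5" "j \<le> 5" "(i, j) \<noteq> (4, 0)"
      using five(1)[OF that(1)] five(2)[OF that(2)] that(3) unfolding g_def[symmetric]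
      by (elim disjE) (simp_all del: One_nat_def add: p p2 tw te tn ts q hn hs hw he lift_def)
    show "h i j = core_row (gate_at a b) (a, b, (tn, hn), (te, he), (ts, hs), (tw, hw)) 0 j i"
      if "i \<le> 5" "j < 5" "(i, j) \<noteq> (5, 0)"
      using five(2)[OF that(1)] five(1)[OF that(2)] that(3) unfolding g_def[symmetric]
      by (elim disjE) (simp_all del: One_nat_def add: p p2 tw te tn ts q hn hs hw he lift_def)
  qed
qed

text \<open>
  The blank south-east cell of a core is not listed: a hole that covers it may touch the two neighbouring
  copies as well.
\<close>

definition needed :: "nat \<Rightarrow> nat \<Rightarrow> nat \<Rightarrow> bool" where
  "needed k x y \<longleftrightarrow> (let c = 2 + 5 * k in
     x \<in> {c, c + 1, c + 3} \<or> y \<in> {c + 1, c + 3, c + 4} \<or>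
     (x, y) \<in> {(c + 2, c), (c + 2, c + 2), (c + 4, c + 2)})"

lemma const_between:
  fixes f :: "nat \<Rightarrow> 'a"
  assumes "\<And>x. m \<le> x \<Longrightarrow> x < n \<Longrightarrow> f (Suc x) = f x" "m \<le> x" "x \<le> n"
  shows "f x = f m"
  using assms(2,3) by (induction x rule: dec_induct) (auto simp: assms(1))

lemma gate_at_core:
  assumes "k < 3" "i < 5" "j < 5"
  shows "gate_at (2 + 5 * k + i) (2 + 5 * k + j) = core ! j ! i"
  using assms by (simp add: gate_at_def)

lemma gate_at_col:
  assumes "k < 3" "i < 5" "y < 19" "y < 2 + 5 * k \<or> 7 + 5 * k \<le> y"
  shows "gate_at (2 + 5 * k + i) y \<in> {Cross, Link, FirstR, LastR, LinkP}"
proof -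
  have c: "(2 + 5 * k + i - 2) div 5 = k" "(2 + 5 * k + i - 2) mod 5 = i"
    "2 \<le> 2 + 5 * k + i" "2 + 5 * k + i < 17"
    using assms by auto
  have k: "[FirstR, Link, LastR] ! k \<in> {Cross, Link, FirstR, LastR, LinkP}"
    using assms(1) by (auto simp: less_Suc_eq numeral_eq_Suc)
  have "k \<noteq> (y - 2) div 5" if "2 \<le> y"
  proof
    assume "k = (y - 2) div 5"
    then have "5 * k \<le> y - 2 \<and> y - 2 < 5 * k + 5"
      using div_mult_mod_eq[of "y - 2" 5] mod_less_divisor[of 5 "y - 2"] by linarith
    then show False using assms(4) that by linarith
  qed
  then show ?thesis unfolding gate_at_def Let_def c using c k by (simp split: if_split)
qed

lemma gate_at_row:
  assumes "k < 3" "j < 5" "x < 19" "x < 2 + 5 * k \<or> 7 + 5 * k \<le> x"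
  shows "gate_at x (2 + 5 * k + j) \<in> {Cross, Link, FirstC, LastC, LinkP}"
proof -
  have c: "(2 + 5 * k + j - 2) div 5 = k" "(2 + 5 * k + j - 2) mod 5 = j"
    "2 \<le> 2 + 5 * k + j" "2 + 5 * k + j < 17"
    using assms by auto
  have k: "[FirstC, Link, LastC] ! k \<in> {Cross, Link, FirstC, LastC, LinkP}"
    using assms(1) by (auto simp: less_Suc_eq numeral_eq_Suc)
  have "(x - 2) div 5 \<noteq> k" if "2 \<le> x"
  proof
    assume "(x - 2) div 5 = k"
    then have "5 * k \<le> x - 2 \<and> x - 2 < 5 * k + 5"
      using div_mult_mod_eq[of "x - 2" 5] mod_less_divisor[of 5 "x - 2"] by linarith
    then show False using assms(4) that by linarith
  qed
  then show ?thesis unfolding gate_at_def Let_def c using c k by (simp split: if_split)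
qed

lemma core_col_shift: "core_col g t c i (c + j) = core_col g t 0 i j"
  by (cases t) auto

lemma core_row_shift: "core_row g t c j (c + i) = core_row g t 0 j i"
  by (cases t) auto

lemma core_col_outside:
  "y \<le> c \<Longrightarrow> core_col g t c i y = core_col g t c i c"
  "c + 5 \<le> y \<Longrightarrow> core_col g t c i y = core_col g t c i (c + 5)"
  by (cases t; auto)+

lemma core_row_outside:
  "x \<le> c \<Longrightarrow> core_row g t c j x = core_row g t c j c"
  "c + 5 \<le> x \<Longrightarrow> core_row g t c j x = core_row g t c j (c + 5)"
  by (cases t; auto)+

text \<open>Off the diagonal a core column meets only gates that pass the vertical signal on, so the
  value at either end of the core extends unchanged to the border.\<close>

lemma col_outside:
  fixes V :: "nat \<Rightarrow> nat \<Rightarrow> signal"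
  assumes k: "k < 3" and i: "i < 5" and c: "c = 2 + 5 * k"
    and cell: "\<And>y. y < 19 \<Longrightarrow> y < c \<or> c + 5 \<le> y \<Longrightarrow>
       rel (gate_at (c + i) y) (V (c + i) (Suc y)) (H (Suc (c + i)) y) (V (c + i) y) (H (c + i) y)"
    and ins: "\<And>j. j \<le> 5 \<Longrightarrow> V (c + i) (c + j) = core_col g t 0 i j"
    and y: "y \<le> 19"
  shows "V (c + i) y = core_col g t c i y"
proof -
  have p: "V (c + i) (Suc y) = V (c + i) y" if "y < 19" "y < c \<or> c + 5 \<le> y" for y
    by (rule col_pass[OF cell[OF that]]) (use gate_at_col[OF k i that(1)] that c in auto)
  consider "y \<le> c" | j where "j \<le> 5" "y = c + j" | "c + 5 \<le> y"
    by (metis le_add_diff_inverse nat_le_linear add_le_cancel_left)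
  then show ?thesis
  proof cases
    case 1
    have "V (c + i) y = V (c + i) 0" using const_between[of 0 c "V (c + i)" y] p 1 c k by simp
    also have "\<dots> = V (c + i) c" using const_between[of 0 c "V (c + i)" c] p c k by simp
    also have "\<dots> = core_col g t c i y"
      using ins[of 0] core_col_outside(1)[OF 1] core_col_shift[of g t c i 0] by simp
    finally show ?thesis .
  next
    case 2 then show ?thesis using ins core_col_shift by simp
  next
    case 3
    have "V (c + i) y = V (c + i) (c + 5)" by (rule const_between[of _ 19]) (use p 3 y in auto)
    then show ?thesis using ins[of 5] core_col_outside(2)[OF 3] core_col_shift[of g t c i 5] by simp
  qed
qed

lemma row_outside:
  fixes H :: "nat \<Rightarrow> nat \<Rightarrow> signal"
  assumes k: "k < 3" and j: "j < 5" and c: "c = 2 + 5 * k"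
    and cell: "\<And>x. x < 19 \<Longrightarrow> x < c \<or> c + 5 \<le> x \<Longrightarrow>
       rel (gate_at x (c + j)) (V x (Suc (c + j))) (H (Suc x) (c + j)) (V x (c + j)) (H x (c + j))"
    and ins: "\<And>i. i \<le> 5 \<Longrightarrow> H (c + i) (c + j) = core_row g t 0 j i"
    and x: "x \<le> 19"
  shows "H x (c + j) = core_row g t c j x"
proof -
  have p: "H (Suc x) (c + j) = H x (c + j)" if "x < 19" "x < c \<or> c + 5 \<le> x" for x
    by (rule row_pass[OF cell[OF that]]) (use gate_at_row[OF k j that(1)] that c in auto)
  consider "x \<le> c" | i where "i \<le> 5" "x = c + i" | "c + 5 \<le> x"
    by (metis le_add_diff_inverse nat_le_linear add_le_cancel_left)
  then show ?thesis
  proof cases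
    case 1
    have "H x (c + j) = H 0 (c + j)" using const_between[of 0 c "\<lambda>x. H x (c + j)" x] p 1 c k by simp
    also have "\<dots> = H c (c + j)" using const_between[of 0 c "\<lambda>x. H x (c + j)" c] p c k by simp
    also have "\<dots> = core_row g t c j x"
      using ins[of 0] core_row_outside(1)[OF 1] core_row_shift[of g t c j 0] by simp
    finally show ?thesis .
  next
    case 2 then show ?thesis using ins core_row_shift by simp
  next
    case 3
    have "H x (c + j) = H (c + 5) (c + j)"
      by (rule const_between[of _ 19 "\<lambda>x. H x (c + j)"]) (use p 3 x in auto)
    then show ?thesis using ins[of 5] core_row_outside(2)[OF 3] core_row_shift[of g t c j 5] by simp
  qed
qed

lemma copy_decode:
  fixes V H :: "nat \<Rightarrow> nat \<Rightarrow> signal"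
  assumes k: "k < 3" and c: "c = 2 + 5 * k"
    and cell: "\<And>x y. x < 19 \<Longrightarrow> y < 19 \<Longrightarrow> needed k x y \<Longrightarrow>
       rel (gate_at x y) (V x (Suc y)) (H (Suc x) y) (V x y) (H x y)"
  obtains a b n e s w where "a < 19" "b < 19" "rel (gate_at a b) n e s w"
    "\<And>i j. i < 5 \<Longrightarrow> j \<le> 5 \<Longrightarrow> (i, j) \<noteq> (4, 0) \<Longrightarrow>
       V (c + i) (c + j) = core_col (gate_at a b) (a, b, n, e, s, w) 0 i j"
    "\<And>i j. i \<le> 5 \<Longrightarrow> j < 5 \<Longrightarrow> (i, j) \<noteq> (5, 0) \<Longrightarrow>
       H (c + i) (c + j) = core_row (gate_at a b) (a, b, n, e, s, w) 0 j i"
    "\<And>i y. i \<in> {0, 1, 3} \<Longrightarrow> y \<le> 19 \<Longrightarrow> V (c + i) y = core_col (gate_at a b) (a, b, n, e, s, w) c i y"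
    "\<And>j x. j \<in> {1, 3, 4} \<Longrightarrow> x \<le> 19 \<Longrightarrow> H x (c + j) = core_row (gate_at a b) (a, b, n, e, s, w) c j x"
proof -
  have five: "i < 5 \<Longrightarrow> i = 0 \<or> i = 1 \<or> i = 2 \<or> i = 3 \<or> i = 4" for i :: nat by presburger
  have cr: "rel (core ! j ! i) (V (c + i) (c + Suc j)) (H (c + Suc i) (c + j)) (V (c + i) (c + j)) (H (c + i) (c + j))"
    if "i < 5" "j < 5" "(i, j) \<noteq> (4, 0)" for i j
  proof -
    have "needed k (c + i) (c + j)"
      using five[OF that(1)] five[OF that(2)] that(3) unfolding needed_def Let_def c by auto
    then show ?thesis
      using cell[of "c + i" "c + j"] gate_at_core[OF k that(1,2)] that k c by simp
  qed
  show thesis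
  proof (rule core_decode[of "\<lambda>i j. V (c + i) (c + j)" "\<lambda>i j. H (c + i) (c + j)"], rule cr)
    fix a b n e s w
    assume o: "a < 19" "b < 19" "rel (gate_at a b) n e s w"
    assume vv: "\<And>i j. i < 5 \<Longrightarrow> j \<le> 5 \<Longrightarrow> (i, j) \<noteq> (4, 0) \<Longrightarrow>
       V (c + i) (c + j) = core_col (gate_at a b) (a, b, n, e, s, w) 0 i j"
    assume hh: "\<And>i j. i \<le> 5 \<Longrightarrow> j < 5 \<Longrightarrow> (i, j) \<noteq> (5, 0) \<Longrightarrow>
       H (c + i) (c + j) = core_row (gate_at a b) (a, b, n, e, s, w) 0 j i"
    show thesis
    proof (rule that[OF o])
      show "V (c + i) (c + j) = core_col (gate_at a b) (a, b, n, e, s, w) 0 i j"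
        if "i < 5" "j \<le> 5" "(i, j) \<noteq> (4, 0)" for i j by (rule vv[OF that])
      show "H (c + i) (c + j) = core_row (gate_at a b) (a, b, n, e, s, w) 0 j i"
        if "i \<le> 5" "j < 5" "(i, j) \<noteq> (5, 0)" for i j by (rule hh[OF that])
      fix i y :: nat assume i: "i \<in> {0, 1, 3}" and y: "y \<le> 19"
      have i5: "i < 5" "i \<noteq> 4" using i by auto
      show "V (c + i) y = core_col (gate_at a b) (a, b, n, e, s, w) c i y"
      proof (rule col_outside[OF k i5(1) c _ _ y])
        show "rel (gate_at (c + i) y) (V (c + i) (Suc y)) (H (Suc (c + i)) y) (V (c + i) y) (H (c + i) y)"
          if "y < 19" for y
          by (rule cell) (use that i k c in \<open>auto simp: needed_def Let_def\<close>)
        show "V (c + i) (c + j) = core_col (gate_at a b) (a, b, n, e, s, w) 0 i j" if "j \<le> 5" for j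
          by (rule vv) (use that i5 in simp_all)
      qed
    next
      fix j x :: nat assume j: "j \<in> {1, 3, 4}" and x: "x \<le> 19"
      have j5: "j < 5" "j \<noteq> 0" using j by auto
      show "H x (c + j) = core_row (gate_at a b) (a, b, n, e, s, w) c j x"
      proof (rule row_outside[OF k j5(1) c _ _ x])
        show "rel (gate_at x (c + j)) (V x (Suc (c + j))) (H (Suc x) (c + j)) (V x (c + j)) (H x (c + j))"
          if "x < 19" for x
          by (rule cell) (use that j k c in \<open>auto simp: needed_def Let_def\<close>)
        show "H (c + i) (c + j) = core_row (gate_at a b) (a, b, n, e, s, w) 0 j i" if "i \<le> 5" for i
          by (rule hh) (use that j5 in simp_all)
      qed
    qed
  qed
qed

section \<open>Link lines and agreement of the three copies\<close>

lemma link_line_eq: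
  fixes f :: "nat \<Rightarrow> signal"
  assumes step: "\<And>x. x < 19 \<Longrightarrow> x \<notin> {lo, lo + 5, lo + 10} \<Longrightarrow> f (Suc x) = f x"
    and lo: "lo + 10 < 19"
    and f: "f lo = raw Blank" "f (Suc lo) = raw u0"
       "f (lo + 5) = raw u1" "f (Suc (lo + 5)) = raw u1" "f (lo + 10) = raw u2" "f (Suc (lo + 10)) = raw Blank"
  shows "u0 = u1" "u1 = u2" "x \<le> 19 \<Longrightarrow> f x = link_line lo (lo + 10) u0 x"
proof -
  have a: "f x = raw Blank" if "x \<le> lo" for x
  proof -
    have "f x = f 0" by (rule const_between[of 0 lo]) (use step lo that in auto)
    moreover have "f lo = f 0" by (rule const_between[of 0 lo]) (use step lo in auto)
    ultimately show ?thesis using f by simp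
  qed
  have b: "f x = raw u0" if "Suc lo \<le> x" "x \<le> lo + 5" for x
    using const_between[of "Suc lo" "lo + 5" f x] step lo f that by simp
  have c: "f x = raw u1" if "Suc (lo + 5) \<le> x" "x \<le> lo + 10" for x
    using const_between[of "Suc (lo + 5)" "lo + 10" f x] step lo f that by simp
  have d: "f x = raw Blank" if "Suc (lo + 10) \<le> x" "x \<le> 19" for x
    using const_between[of "Suc (lo + 10)" 19 f x] step lo f that by simp
  show u: "u0 = u1" "u1 = u2" using b[of "lo + 5"] c[of "lo + 10"] f by auto
  show "f x = link_line lo (lo + 10) u0 x" if "x \<le> 19"
    using a[of x] b[of x] c[of x] d[of x] that u
    by (cases "x \<le> lo"; cases "x \<le> lo + 5"; cases "x \<le> lo + 10") (auto simp: link_line_def)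
qed

lemma link_row:
  fixes V H :: "nat \<Rightarrow> nat \<Rightarrow> signal"
  assumes cell: "\<And>x. x < 19 \<Longrightarrow> rel (gate_at x y) (V x (Suc y)) (H (Suc x) y) (V x y) (H x y)"
    and g: "\<And>x. x < 19 \<Longrightarrow> gate_at x y =
       (if x = lo then FirstR else if x = lo + 5 then Link else if x = lo + 10 then LastR else Cross)"
    and lo: "lo + 10 < 19"
    and v: "V lo y = raw u0" "V (lo + 5) y = raw u1" "V (lo + 10) y = raw u2"
  shows "u0 = u1" "u1 = u2" "x \<le> 19 \<Longrightarrow> H x y = link_line lo (lo + 10) u0 x"
proof -
  have s: "H (Suc x) y = H x y" if "x < 19" "x \<notin> {lo, lo + 5, lo + 10}" for x
    using rel_Cross cell[OF that(1)] g[OF that(1)] that(2) by auto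
  have "rel FirstR (V lo (Suc y)) (H (Suc lo) y) (V lo y) (H lo y)"
    "rel Link (V (lo + 5) (Suc y)) (H (Suc (lo + 5)) y) (V (lo + 5) y) (H (lo + 5) y)"
    "rel LastR (V (lo + 10) (Suc y)) (H (Suc (lo + 10)) y) (V (lo + 10) y) (H (lo + 10) y)"
    using cell[of lo] cell[of "lo + 5"] cell[of "lo + 10"] g[of lo] g[of "lo + 5"] g[of "lo + 10"] lo by simp_all
  then have "H lo y = raw Blank" "H (Suc lo) y = raw u0" "H (lo + 5) y = raw u1" "H (Suc (lo + 5)) y = raw u1"
    "H (lo + 10) y = raw u2" "H (Suc (lo + 10)) y = raw Blank"
    using v by (auto simp: rel_def prod_eq_iff)
  note l = link_line_eq[of lo "\<lambda>x. H x y", OF s lo this]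
  show "u0 = u1" "u1 = u2" "x \<le> 19 \<Longrightarrow> H x y = link_line lo (lo + 10) u0 x" using l by auto
qed

lemma link_col:
  fixes V H :: "nat \<Rightarrow> nat \<Rightarrow> signal"
  assumes cell: "\<And>y. y < 19 \<Longrightarrow> rel (gate_at x y) (V x (Suc y)) (H (Suc x) y) (V x y) (H x y)"
    and g: "\<And>y. y < 19 \<Longrightarrow> gate_at x y =
       (if y = lo then FirstC else if y = lo + 5 then Link else if y = lo + 10 then LastC else Cross)"
    and lo: "lo + 10 < 19"
    and v: "H x lo = raw u0" "H x (lo + 5) = raw u1" "H x (lo + 10) = raw u2"
  shows "u0 = u1" "u1 = u2" "y \<le> 19 \<Longrightarrow> V x y = link_line lo (lo + 10) u0 y"
proof -
  have s: "V x (Suc y) = V x y" if "y < 19" "y \<notin> {lo, lo + 5, lo + 10}" for y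
    using rel_Cross cell[OF that(1)] g[OF that(1)] that(2) by auto
  have "rel FirstC (V x (Suc lo)) (H (Suc x) lo) (V x lo) (H x lo)"
    "rel Link (V x (Suc (lo + 5))) (H (Suc x) (lo + 5)) (V x (lo + 5)) (H x (lo + 5))"
    "rel LastC (V x (Suc (lo + 10))) (H (Suc x) (lo + 10)) (V x (lo + 10)) (H x (lo + 10))"
    using cell[of lo] cell[of "lo + 5"] cell[of "lo + 10"] g[of lo] g[of "lo + 5"] g[of "lo + 10"] lo by simp_all
  then have "V x lo = raw Blank" "V x (Suc lo) = raw u0" "V x (lo + 5) = raw u1" "V x (Suc (lo + 5)) = raw u1"
    "V x (lo + 10) = raw u2" "V x (Suc (lo + 10)) = raw Blank"
    using v by (auto simp: rel_def prod_eq_iff)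
  note l = link_line_eq[of lo "V x", OF s lo this]
  show "u0 = u1" "u1 = u2" "y \<le> 19 \<Longrightarrow> V x y = link_line lo (lo + 10) u0 y" using l by auto
qed

lemma inc_inj: "b < 19 \<Longrightarrow> b' < 19 \<Longrightarrow> inc b = inc b' \<Longrightarrow> b = b'"
  by (auto simp: inc_def mod_if split: if_splits)

lemma gate_at_link_row:
  assumes "x < 19"
  shows "y \<in> {0, 17} \<Longrightarrow> gate_at x y = (if x = 3 then FirstR else if x = 3 + 5 then Link else if x = 3 + 10 then LastR else Cross)"
    "y \<in> {1, 18} \<Longrightarrow> gate_at x y = (if x = 5 then FirstR else if x = 5 + 5 then Link else if x = 5 + 10 then LastR else Cross)"
  using less_19_cases[OF assms] by (elim disjE; auto simp: gate_at_def)+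

lemma gate_at_link_col:
  assumes "y < 19"
  shows "x \<in> {0, 17} \<Longrightarrow> gate_at x y = (if y = 5 then FirstC else if y = 5 + 5 then Link else if y = 5 + 10 then LastC else Cross)"
    "x \<in> {1, 18} \<Longrightarrow> gate_at x y = (if y = 3 then FirstC else if y = 3 + 5 then Link else if y = 3 + 10 then LastC else Cross)"
  using less_19_cases[OF assms] by (elim disjE; auto simp: gate_at_def)+

fun tile_gate :: "ctile \<Rightarrow> gate" where
  "tile_gate (a, b, n, e, s, w) = gate_at a b"

fun valid :: "ctile \<Rightarrow> bool" where
  "valid (a, b, n, e, s, w) \<longleftrightarrow> a < 19 \<and> b < 19 \<and> rel (gate_at a b) n e s w"

definition encodes_core :: "nat \<Rightarrow> (nat \<Rightarrow> nat \<Rightarrow> signal) \<Rightarrow> (nat \<Rightarrow> nat \<Rightarrow> signal) \<Rightarrow> ctile \<Rightarrow> bool" where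
  "encodes_core c V H t \<longleftrightarrow>
     (\<forall>i j. i < 5 \<longrightarrow> j \<le> 5 \<longrightarrow> (i, j) \<noteq> (4, 0) \<longrightarrow> V (c + i) (c + j) = core_col (tile_gate t) t 0 i j) \<and>
     (\<forall>i j. i \<le> 5 \<longrightarrow> j < 5 \<longrightarrow> (i, j) \<noteq> (5, 0) \<longrightarrow> H (c + i) (c + j) = core_row (tile_gate t) t 0 j i)"

text \<open>Only the six lines that run from border to border within the needed cells. They already
  carry the place, the four tags and the four digits, hence the entire tile; the other lines of a
  core may be cut by the hole outside of it.\<close>

definition encodes :: "nat \<Rightarrow> (nat \<Rightarrow> nat \<Rightarrow> signal) \<Rightarrow> (nat \<Rightarrow> nat \<Rightarrow> signal) \<Rightarrow> ctile \<Rightarrow> bool" where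
  "encodes c V H t \<longleftrightarrow>
     (\<forall>i y. i \<in> {0, 1, 3} \<longrightarrow> y \<le> 19 \<longrightarrow> V (c + i) y = core_col (tile_gate t) t c i y) \<and>
     (\<forall>j x. j \<in> {1, 3, 4} \<longrightarrow> x \<le> 19 \<longrightarrow> H x (c + j) = core_row (tile_gate t) t c j x)"

lemma copy_encodes:
  assumes k: "k < 3" and c: "c = 2 + 5 * k"
    and cell: "\<And>x y. x < 19 \<Longrightarrow> y < 19 \<Longrightarrow> needed k x y \<Longrightarrow>
       rel (gate_at x y) (V x (Suc y)) (H (Suc x) y) (V x y) (H x y)"
  shows "\<exists>t. valid t \<and> encodes_core c V H t \<and> encodes c V H t"
proof (rule copy_decode[OF k c cell], assumption, assumption, assumption)
  fix a b n e s w
  assume A: "a < 19" "b < 19" "rel (gate_at a b) n e s w"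
    "\<And>i j. i < 5 \<Longrightarrow> j \<le> 5 \<Longrightarrow> (i, j) \<noteq> (4, 0) \<Longrightarrow>
       V (c + i) (c + j) = core_col (gate_at a b) (a, b, n, e, s, w) 0 i j"
    "\<And>i j. i \<le> 5 \<Longrightarrow> j < 5 \<Longrightarrow> (i, j) \<noteq> (5, 0) \<Longrightarrow>
       H (c + i) (c + j) = core_row (gate_at a b) (a, b, n, e, s, w) 0 j i"
    "\<And>i y. i \<in> {0, 1, 3} \<Longrightarrow> y \<le> 19 \<Longrightarrow> V (c + i) y = core_col (gate_at a b) (a, b, n, e, s, w) c i y"
    "\<And>j x. j \<in> {1, 3, 4} \<Longrightarrow> x \<le> 19 \<Longrightarrow> H x (c + j) = core_row (gate_at a b) (a, b, n, e, s, w) c j x"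
  have "encodes_core c V H (a, b, n, e, s, w)" "encodes c V H (a, b, n, e, s, w)"
    unfolding encodes_core_def encodes_def tile_gate.simps using A(4-7) by blast+
  then show ?thesis using A(1-3) valid.simps by blast
qed

lemma encodes_col:
  assumes "encodes c V H t" "i \<in> {0, 1, 3}" "y \<le> 19" "x = c + i"
  shows "V x y = core_col (tile_gate t) t c i y"
  using assms unfolding encodes_def by blast

lemma encodes_row:
  assumes "encodes c V H t" "j \<in> {1, 3, 4}" "x \<le> 19" "y = c + j"
  shows "H x y = core_row (tile_gate t) t c j x"
  using assms unfolding encodes_def by blast

lemma encodes_core_col:
  assumes "encodes_core c V H t" "i < 5" "j \<le> 5" "(i, j) \<noteq> (4, 0)"
  shows "V (c + i) (c + j) = core_col (tile_gate t) t 0 i j"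
  using assms unfolding encodes_core_def by blast

lemma encodes_core_row:
  assumes "encodes_core c V H t" "i \<le> 5" "j < 5" "(i, j) \<noteq> (5, 0)"
  shows "H (c + i) (c + j) = core_row (tile_gate t) t 0 j i"
  using assms unfolding encodes_core_def by blast

lemma encodes_lines:
  assumes "encodes c V H (a, b, n, e, s, w)"
  shows "\<And>x y. x = c \<Longrightarrow> y \<le> c + 4 \<Longrightarrow> y \<le> 19 \<Longrightarrow> V x y = raw (Place a b)"
    "\<And>x y. x = c \<Longrightarrow> c + 5 \<le> y \<Longrightarrow> y \<le> 19 \<Longrightarrow> V x y = raw (Place a (inc b))"
    "\<And>x y. x = c + 1 \<Longrightarrow> y \<le> c \<Longrightarrow> y \<le> 19 \<Longrightarrow> V x y = raw (Tag (fst s))"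
    "\<And>x y. x = c + 1 \<Longrightarrow> c + 3 \<le> y \<Longrightarrow> y \<le> 19 \<Longrightarrow> V x y = raw (Tag (fst n))"
    "\<And>x y. x = c + 3 \<Longrightarrow> y \<le> c \<Longrightarrow> y \<le> 19 \<Longrightarrow> V x y = raw (snd s)"
    "\<And>x y. x = c + 3 \<Longrightarrow> c + 3 \<le> y \<Longrightarrow> y \<le> 19 \<Longrightarrow> V x y = raw (snd n)"
    "\<And>x y. y = c + 4 \<Longrightarrow> x \<le> c + 4 \<Longrightarrow> x \<le> 19 \<Longrightarrow> H x y = raw (Place a b)"
    "\<And>x y. y = c + 4 \<Longrightarrow> c + 5 \<le> x \<Longrightarrow> x \<le> 19 \<Longrightarrow> H x y = raw (Place (inc a) b)"
    "\<And>x y. y = c + 3 \<Longrightarrow> x \<le> c + 2 \<Longrightarrow> x \<le> 19 \<Longrightarrow> H x y = raw (Tag (fst w))"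
    "\<And>x y. y = c + 3 \<Longrightarrow> c + 5 \<le> x \<Longrightarrow> x \<le> 19 \<Longrightarrow> H x y = raw (Tag (fst e))"
    "\<And>x y. y = c + 1 \<Longrightarrow> x \<le> c + 2 \<Longrightarrow> x \<le> 19 \<Longrightarrow> H x y = raw (snd w)"
    "\<And>x y. y = c + 1 \<Longrightarrow> c + 5 \<le> x \<Longrightarrow> x \<le> 19 \<Longrightarrow> H x y = raw (snd e)"
proof -
  have "V (c + i) y = core_col (gate_at a b) (a, b, n, e, s, w) c i y" if "i \<in> {0, 1, 3}" "y \<le> 19" for i y
    using assms that unfolding encodes_def tile_gate.simps by blast
  note v = this[of 0, simplified] this[of 1, simplified] this[of 3, simplified]
  have "H x (c + j) = core_row (gate_at a b) (a, b, n, e, s, w) c j x" if "j \<in> {1, 3, 4}" "x \<le> 19" for j x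
    using assms that unfolding encodes_def tile_gate.simps by blast
  note h = this[of 1, simplified] this[of 3, simplified] this[of 4, simplified]
  show "\<And>x y. x = c \<Longrightarrow> y \<le> c + 4 \<Longrightarrow> y \<le> 19 \<Longrightarrow> V x y = raw (Place a b)"
    "\<And>x y. x = c \<Longrightarrow> c + 5 \<le> y \<Longrightarrow> y \<le> 19 \<Longrightarrow> V x y = raw (Place a (inc b))"
    "\<And>x y. x = c + 1 \<Longrightarrow> y \<le> c \<Longrightarrow> y \<le> 19 \<Longrightarrow> V x y = raw (Tag (fst s))"
    "\<And>x y. x = c + 1 \<Longrightarrow> c + 3 \<le> y \<Longrightarrow> y \<le> 19 \<Longrightarrow> V x y = raw (Tag (fst n))"
    "\<And>x y. x = c + 3 \<Longrightarrow> y \<le> c \<Longrightarrow> y \<le> 19 \<Longrightarrow> V x y = raw (snd s)"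
    "\<And>x y. x = c + 3 \<Longrightarrow> c + 3 \<le> y \<Longrightarrow> y \<le> 19 \<Longrightarrow> V x y = raw (snd n)"
    using v by auto
  show "\<And>x y. y = c + 4 \<Longrightarrow> x \<le> c + 4 \<Longrightarrow> x \<le> 19 \<Longrightarrow> H x y = raw (Place a b)"
    "\<And>x y. y = c + 4 \<Longrightarrow> c + 5 \<le> x \<Longrightarrow> x \<le> 19 \<Longrightarrow> H x y = raw (Place (inc a) b)"
    "\<And>x y. y = c + 3 \<Longrightarrow> x \<le> c + 2 \<Longrightarrow> x \<le> 19 \<Longrightarrow> H x y = raw (Tag (fst w))"
    "\<And>x y. y = c + 3 \<Longrightarrow> c + 5 \<le> x \<Longrightarrow> x \<le> 19 \<Longrightarrow> H x y = raw (Tag (fst e))"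
    "\<And>x y. y = c + 1 \<Longrightarrow> x \<le> c + 2 \<Longrightarrow> x \<le> 19 \<Longrightarrow> H x y = raw (snd w)"
    "\<And>x y. y = c + 1 \<Longrightarrow> c + 5 \<le> x \<Longrightarrow> x \<le> 19 \<Longrightarrow> H x y = raw (snd e)"
    using h by auto
qed

lemma vert_core:
  assumes "x \<notin> {0, 1, 17, 18}"
  shows "vert g t x y = core_col g t (2 + 5 * ((x - 2) div 5)) ((x - 2) mod 5) y"
  using assms by (cases t) (simp del: core_col.simps)

lemma horiz_core:
  assumes "y \<notin> {0, 1, 17, 18}"
  shows "horiz g t x y = core_row g t (2 + 5 * ((y - 2) div 5)) ((y - 2) mod 5) x"
  using assms by (cases t) (simp del: core_row.simps)

lemma vert_link:
  "vert g (a, b, n, e, s, w) 0 y = link_line 5 15 (Tag (fst w)) y"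
  "vert g (a, b, n, e, s, w) 1 y = link_line 3 13 (snd w) y"
  "vert g (a, b, n, e, s, w) 17 y = link_line 5 15 (Tag (fst e)) y"
  "vert g (a, b, n, e, s, w) 18 y = link_line 3 13 (snd e) y"
  by simp_all

lemma horiz_link:
  "horiz g (a, b, n, e, s, w) x 0 = link_line 3 13 (Tag (fst s)) x"
  "horiz g (a, b, n, e, s, w) x 1 = link_line 5 15 (snd s) x"
  "horiz g (a, b, n, e, s, w) x 17 = link_line 3 13 (Tag (fst n)) x"
  "horiz g (a, b, n, e, s, w) x 18 = link_line 5 15 (snd n) x"
  by simp_all

lemma core_index:
  fixes x :: nat
  assumes "x < 19" "x \<notin> {0, 1, 17, 18}"
  shows "\<exists>k<3. \<exists>i<5. x = 2 + 5 * k + i \<and> (x - 2) div 5 = k \<and> (x - 2) mod 5 = i"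
proof -
  have "x < 17" using assms by (cases "x = 17"; cases "x = 18") auto
  then have "(x - 2) div 5 < 3" by (simp add: div_less_iff_less_mult)
  moreover have "x = 2 + 5 * ((x - 2) div 5) + (x - 2) mod 5"
    using assms div_mult_mod_eq[of "x - 2" 5] by (auto simp: mult.commute)
  moreover have "(x - 2) mod 5 < 5" by simp
  ultimately show ?thesis by blast
qed

text \<open>Each copy decodes a tile of its own. The places agree by \<open>LinkP\<close>, the tags
  and digits by two link lines for each of the four sides; so there is one tile, and it determines
  the signals of the cores, their extensions and the link lines.\<close>

lemma signals_decode:
  fixes V H :: "nat \<Rightarrow> nat \<Rightarrow> signal"
  assumes cell: "\<And>x y. x < 19 \<Longrightarrow> y < 19 \<Longrightarrow> rel (gate_at x y) (V x (Suc y)) (H (Suc x) y) (V x y) (H x y)"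
  obtains t where "valid t"
    "\<And>x y. x < 19 \<Longrightarrow> y \<le> 19 \<Longrightarrow> V x y = vert (tile_gate t) t x y"
    "\<And>x y. x \<le> 19 \<Longrightarrow> y < 19 \<Longrightarrow> H x y = horiz (tile_gate t) t x y"
proof -
  obtain t0 where t0: "valid t0" "encodes_core 2 V H t0" "encodes 2 V H t0"
    using copy_encodes[of 0 2, OF _ _ cell] by auto
  obtain t1 where t1: "valid t1" "encodes_core 7 V H t1" "encodes 7 V H t1"
    using copy_encodes[of 1 7, OF _ _ cell] by auto
  obtain t2 where t2: "valid t2" "encodes_core 12 V H t2" "encodes 12 V H t2"
    using copy_encodes[of 2 12, OF _ _ cell] by auto
  obtain a0 b0 n0 e0 s0 w0 where T0: "t0 = (a0, b0, n0, e0, s0, w0)" by (cases t0)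
  obtain a1 b1 n1 e1 s1 w1 where T1: "t1 = (a1, b1, n1, e1, s1, w1)" by (cases t1)
  obtain a2 b2 n2 e2 s2 w2 where T2: "t2 = (a2, b2, n2, e2, s2, w2)" by (cases t2)
  \<comment> \<open>Here the place wire of copy 0, north of its core, crosses those of copies 1 and
    2. Both show \<open>inc b\<close>, which determines \<open>b\<close> only because places are
    below 19.\<close>
  have linkP: "gate_at 2 11 = LinkP" "gate_at 2 16 = LinkP" by (simp_all add: gate_at_def)
  have "H 2 11 = raw (Place a1 b1)" by (rule encodes_lines(7)[OF t1(3)[unfolded T1]]) simp_all
  moreover have "H 2 16 = raw (Place a2 b2)" by (rule encodes_lines(7)[OF t2(3)[unfolded T2]]) simp_all
  moreover have "V 2 11 = raw (Place a0 (inc b0))" "V 2 16 = raw (Place a0 (inc b0))"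
    by (rule encodes_lines(2)[OF t0(3)[unfolded T0]]; simp)+
  ultimately have "a0 = a1 \<and> inc b0 = inc b1" "a0 = a2 \<and> inc b0 = inc b2"
    using cell[of 2 11] cell[of 2 16] by (simp_all add: linkP rel_def)
  then have ab: "a1 = a0" "b1 = b0" "a2 = a0" "b2 = b0"
    using t0(1) t1(1) t2(1) T0 T1 T2 inc_inj by auto
  have r0: "Tag (fst s0) = Tag (fst s1)" "Tag (fst s1) = Tag (fst s2)"
    "\<And>x. x \<le> 19 \<Longrightarrow> H x 0 = link_line 3 13 (Tag (fst s0)) x"
  proof -
    have v0: "V 3 0 = raw (Tag (fst s0))" by (rule encodes_lines(3)[OF t0(3)[unfolded T0]]) simp_all
    have v1: "V 8 0 = raw (Tag (fst s1))" by (rule encodes_lines(3)[OF t1(3)[unfolded T1]]) simp_all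
    have v2: "V 13 0 = raw (Tag (fst s2))" by (rule encodes_lines(3)[OF t2(3)[unfolded T2]]) simp_all
    note v = v0 v1 v2
    have g: "gate_at x 0 = (if x = 3 then FirstR else if x = 3 + 5 then Link else if x = 3 + 10 then LastR else Cross)"
      if "x < 19" for x
      by (rule gate_at_link_row(1)[OF that]) simp
    show "Tag (fst s0) = Tag (fst s1)" "Tag (fst s1) = Tag (fst s2)"
      "\<And>x. x \<le> 19 \<Longrightarrow> H x 0 = link_line 3 13 (Tag (fst s0)) x"
      using link_row[of 0 V H 3 "Tag (fst s0)" "Tag (fst s1)" "Tag (fst s2)", OF cell g] v by simp_all
  qed
  have r1: "snd s0 = snd s1" "snd s1 = snd s2"
    "\<And>x. x \<le> 19 \<Longrightarrow> H x 1 = link_line 5 15 (snd s0) x"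
  proof -
    have v0: "V 5 1 = raw (snd s0)" by (rule encodes_lines(5)[OF t0(3)[unfolded T0]]) simp_all
    have v1: "V 10 1 = raw (snd s1)" by (rule encodes_lines(5)[OF t1(3)[unfolded T1]]) simp_all
    have v2: "V 15 1 = raw (snd s2)" by (rule encodes_lines(5)[OF t2(3)[unfolded T2]]) simp_all
    note v = v0 v1 v2
    have g: "gate_at x 1 = (if x = 5 then FirstR else if x = 5 + 5 then Link else if x = 5 + 10 then LastR else Cross)"
      if "x < 19" for x
      by (rule gate_at_link_row(2)[OF that]) simp
    show "snd s0 = snd s1" "snd s1 = snd s2"
      "\<And>x. x \<le> 19 \<Longrightarrow> H x 1 = link_line 5 15 (snd s0) x"
      using link_row[of 1 V H 5 "snd s0" "snd s1" "snd s2", OF cell g] v by simp_all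
  qed
  have r17: "Tag (fst n0) = Tag (fst n1)" "Tag (fst n1) = Tag (fst n2)"
    "\<And>x. x \<le> 19 \<Longrightarrow> H x 17 = link_line 3 13 (Tag (fst n0)) x"
  proof -
    have v0: "V 3 17 = raw (Tag (fst n0))" by (rule encodes_lines(4)[OF t0(3)[unfolded T0]]) simp_all
    have v1: "V 8 17 = raw (Tag (fst n1))" by (rule encodes_lines(4)[OF t1(3)[unfolded T1]]) simp_all
    have v2: "V 13 17 = raw (Tag (fst n2))" by (rule encodes_lines(4)[OF t2(3)[unfolded T2]]) simp_all
    note v = v0 v1 v2
    have g: "gate_at x 17 = (if x = 3 then FirstR else if x = 3 + 5 then Link else if x = 3 + 10 then LastR else Cross)"
      if "x < 19" for x
      by (rule gate_at_link_row(1)[OF that]) simp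
    show "Tag (fst n0) = Tag (fst n1)" "Tag (fst n1) = Tag (fst n2)"
      "\<And>x. x \<le> 19 \<Longrightarrow> H x 17 = link_line 3 13 (Tag (fst n0)) x"
      using link_row[of 17 V H 3 "Tag (fst n0)" "Tag (fst n1)" "Tag (fst n2)", OF cell g] v by simp_all
  qed
  have r18: "snd n0 = snd n1" "snd n1 = snd n2"
    "\<And>x. x \<le> 19 \<Longrightarrow> H x 18 = link_line 5 15 (snd n0) x"
  proof -
    have v0: "V 5 18 = raw (snd n0)" by (rule encodes_lines(6)[OF t0(3)[unfolded T0]]) simp_all
    have v1: "V 10 18 = raw (snd n1)" by (rule encodes_lines(6)[OF t1(3)[unfolded T1]]) simp_all
    have v2: "V 15 18 = raw (snd n2)" by (rule encodes_lines(6)[OF t2(3)[unfolded T2]]) simp_all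
    note v = v0 v1 v2
    have g: "gate_at x 18 = (if x = 5 then FirstR else if x = 5 + 5 then Link else if x = 5 + 10 then LastR else Cross)"
      if "x < 19" for x
      by (rule gate_at_link_row(2)[OF that]) simp
    show "snd n0 = snd n1" "snd n1 = snd n2"
      "\<And>x. x \<le> 19 \<Longrightarrow> H x 18 = link_line 5 15 (snd n0) x"
      using link_row[of 18 V H 5 "snd n0" "snd n1" "snd n2", OF cell g] v by simp_all
  qed
  have c0: "Tag (fst w0) = Tag (fst w1)" "Tag (fst w1) = Tag (fst w2)"
    "\<And>y. y \<le> 19 \<Longrightarrow> V 0 y = link_line 5 15 (Tag (fst w0)) y"
  proof -
    have v0: "H 0 5 = raw (Tag (fst w0))" by (rule encodes_lines(9)[OF t0(3)[unfolded T0]]) simp_all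
    have v1: "H 0 10 = raw (Tag (fst w1))" by (rule encodes_lines(9)[OF t1(3)[unfolded T1]]) simp_all
    have v2: "H 0 15 = raw (Tag (fst w2))" by (rule encodes_lines(9)[OF t2(3)[unfolded T2]]) simp_all
    note v = v0 v1 v2
    have g: "gate_at 0 y = (if y = 5 then FirstC else if y = 5 + 5 then Link else if y = 5 + 10 then LastC else Cross)"
      if "y < 19" for y
      by (rule gate_at_link_col(1)[OF that]) simp
    show "Tag (fst w0) = Tag (fst w1)" "Tag (fst w1) = Tag (fst w2)"
      "\<And>y. y \<le> 19 \<Longrightarrow> V 0 y = link_line 5 15 (Tag (fst w0)) y"
      using link_col[of 0 V H 5 "Tag (fst w0)" "Tag (fst w1)" "Tag (fst w2)", OF cell g] v by simp_all
  qed
  have c1: "snd w0 = snd w1" "snd w1 = snd w2"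
    "\<And>y. y \<le> 19 \<Longrightarrow> V 1 y = link_line 3 13 (snd w0) y"
  proof -
    have v0: "H 1 3 = raw (snd w0)" by (rule encodes_lines(11)[OF t0(3)[unfolded T0]]) simp_all
    have v1: "H 1 8 = raw (snd w1)" by (rule encodes_lines(11)[OF t1(3)[unfolded T1]]) simp_all
    have v2: "H 1 13 = raw (snd w2)" by (rule encodes_lines(11)[OF t2(3)[unfolded T2]]) simp_all
    note v = v0 v1 v2
    have g: "gate_at 1 y = (if y = 3 then FirstC else if y = 3 + 5 then Link else if y = 3 + 10 then LastC else Cross)"
      if "y < 19" for y
      by (rule gate_at_link_col(2)[OF that]) simp
    show "snd w0 = snd w1" "snd w1 = snd w2"
      "\<And>y. y \<le> 19 \<Longrightarrow> V 1 y = link_line 3 13 (snd w0) y"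
      using link_col[of 1 V H 3 "snd w0" "snd w1" "snd w2", OF cell g] v by simp_all
  qed
  have c17: "Tag (fst e0) = Tag (fst e1)" "Tag (fst e1) = Tag (fst e2)"
    "\<And>y. y \<le> 19 \<Longrightarrow> V 17 y = link_line 5 15 (Tag (fst e0)) y"
  proof -
    have v0: "H 17 5 = raw (Tag (fst e0))" by (rule encodes_lines(10)[OF t0(3)[unfolded T0]]) simp_all
    have v1: "H 17 10 = raw (Tag (fst e1))" by (rule encodes_lines(10)[OF t1(3)[unfolded T1]]) simp_all
    have v2: "H 17 15 = raw (Tag (fst e2))" by (rule encodes_lines(10)[OF t2(3)[unfolded T2]]) simp_all
    note v = v0 v1 v2
    have g: "gate_at 17 y = (if y = 5 then FirstC else if y = 5 + 5 then Link else if y = 5 + 10 then LastC else Cross)"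
      if "y < 19" for y
      by (rule gate_at_link_col(1)[OF that]) simp
    show "Tag (fst e0) = Tag (fst e1)" "Tag (fst e1) = Tag (fst e2)"
      "\<And>y. y \<le> 19 \<Longrightarrow> V 17 y = link_line 5 15 (Tag (fst e0)) y"
      using link_col[of 17 V H 5 "Tag (fst e0)" "Tag (fst e1)" "Tag (fst e2)", OF cell g] v by simp_all
  qed
  have c18: "snd e0 = snd e1" "snd e1 = snd e2"
    "\<And>y. y \<le> 19 \<Longrightarrow> V 18 y = link_line 3 13 (snd e0) y"
  proof -
    have v0: "H 18 3 = raw (snd e0)" by (rule encodes_lines(12)[OF t0(3)[unfolded T0]]) simp_all
    have v1: "H 18 8 = raw (snd e1)" by (rule encodes_lines(12)[OF t1(3)[unfolded T1]]) simp_all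
    have v2: "H 18 13 = raw (snd e2)" by (rule encodes_lines(12)[OF t2(3)[unfolded T2]]) simp_all
    note v = v0 v1 v2
    have g: "gate_at 18 y = (if y = 3 then FirstC else if y = 3 + 5 then Link else if y = 3 + 10 then LastC else Cross)"
      if "y < 19" for y
      by (rule gate_at_link_col(2)[OF that]) simp
    show "snd e0 = snd e1" "snd e1 = snd e2"
      "\<And>y. y \<le> 19 \<Longrightarrow> V 18 y = link_line 3 13 (snd e0) y"
      using link_col[of 18 V H 3 "snd e0" "snd e1" "snd e2", OF cell g] v by simp_all
  qed
  have eqs: "t1 = t0" "t2 = t0"
    using ab r0 r1 r17 r18 c0 c1 c17 c18 unfolding T0 T1 T2 by (simp_all add: prod_eq_iff)
  show thesis
  proof (rule that[OF t0(1)])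
    have core: "V (c + i) y = core_col (tile_gate t0) t0 c i y"
      if k: "k < 3" "c = 2 + 5 * k" and d: "encodes_core c V H t0" "encodes c V H t0" and i: "i < 5" and y: "y \<le> 19" for k c i y
    proof (cases "i \<in> {0, 1, 3}")
      case True then show ?thesis using encodes_col[OF d(2), of i y] y by simp
    next
      case False
      \<comment> \<open>In an intact macro-tile the south-east cell of the core is available too;
        being a crossing, it carries the blank to the side that \<open>encodes_core\<close> leaves
        open.\<close>
      have "gate_at (c + 4) c = Cross" using gate_at_core[OF k(1), of 4 0] k(2) by (simp add: core_def)
      then have "V (c + 4) (Suc c) = V (c + 4) c" using cell[of "c + 4" c] rel_Cross k by auto
      moreover have "core_col g t 0 4 1 = core_col g t 0 4 0" for g t by (cases t) simp
      ultimately have "V (c + 4) (c + 0) = core_col (tile_gate t0) t0 0 4 0"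
        using encodes_core_col[OF d(1), of 4 1] by simp
      then have "V (c + i) (c + j) = core_col (tile_gate t0) t0 0 i j" if "j \<le> 5" for j
        using encodes_core_col[OF d(1), of i j] i that by (cases "(i, j) = (4, 0)") auto
      then show ?thesis using col_outside[OF k(1) i k(2) _ _ y, of V H "tile_gate t0" t0] cell k i by simp
    qed
    have core': "H x (c + j) = core_row (tile_gate t0) t0 c j x"
      if k: "k < 3" "c = 2 + 5 * k" and d: "encodes_core c V H t0" "encodes c V H t0" and j: "j < 5" and x: "x \<le> 19" for k c j x
    proof (cases "j \<in> {1, 3, 4}")
      case True then show ?thesis using encodes_row[OF d(2), of j x] x by simp
    next
      case False
      have "gate_at (c + 4) c = Cross" using gate_at_core[OF k(1), of 4 0] k(2) by (simp add: core_def)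
      then have "H (Suc (c + 4)) c = H (c + 4) c" using cell[of "c + 4" c] rel_Cross k by auto
      moreover have "core_row g t 0 0 4 = core_row g t 0 0 5" for g t by (cases t) simp
      ultimately have "H (c + 5) (c + 0) = core_row (tile_gate t0) t0 0 0 5"
        using encodes_core_row[OF d(1), of 4 0] by (simp add: add.commute[of c])
      then have "H (c + i) (c + j) = core_row (tile_gate t0) t0 0 j i" if "i \<le> 5" for i
        using encodes_core_row[OF d(1), of i j] j that by (cases "(i, j) = (5, 0)") auto
      then show ?thesis using row_outside[OF k(1) j k(2) _ _ x, of V H "tile_gate t0" t0] cell k j by simp
    qed
    note t1' = t1[unfolded eqs] and t2' = t2[unfolded eqs]
    have dec: "encodes_core (2 + 5 * k) V H t0 \<and> encodes (2 + 5 * k) V H t0" if "k < 3" for k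
    proof -
      have "2 + 5 * k = 2 \<or> 2 + 5 * k = 7 \<or> 2 + 5 * k = 12" using that by presburger
      then show ?thesis using t0(2,3) t1'(2,3) t2'(2,3) by (elim disjE; simp only:)
    qed
    show "V x y = vert (tile_gate t0) t0 x y" if x: "x < 19" and y: "y \<le> 19" for x y
    proof (cases "x \<in> {0, 1, 17, 18}")
      case True then show ?thesis unfolding T0
        by (elim insertE emptyE) (simp_all only: vert_link c0(3)[OF y] c1(3)[OF y] c17(3)[OF y] c18(3)[OF y])
    next
      case False
      then obtain k i where ki: "k < 3" "i < 5" "x = 2 + 5 * k + i" "(x - 2) div 5 = k" "(x - 2) mod 5 = i"
        using core_index[OF x] by blast
      have "V (2 + 5 * k + i) y = core_col (tile_gate t0) t0 (2 + 5 * k) i y"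
        using core[OF ki(1) refl _ _ ki(2) y] dec[OF ki(1)] by blast
      then show ?thesis by (simp only: vert_core[OF False] ki(4,5) ki(3)[symmetric])
    qed
    show "H x y = horiz (tile_gate t0) t0 x y" if x: "x \<le> 19" and y: "y < 19" for x y
    proof (cases "y \<in> {0, 1, 17, 18}")
      case True then show ?thesis unfolding T0
        by (elim insertE emptyE) (simp_all only: horiz_link r0(3)[OF x] r1(3)[OF x] r17(3)[OF x] r18(3)[OF x])
    next
      case False
      then obtain k j where kj: "k < 3" "j < 5" "y = 2 + 5 * k + j" "(y - 2) div 5 = k" "(y - 2) mod 5 = j"
        using core_index[OF y] by blast
      have "H x (2 + 5 * k + j) = core_row (tile_gate t0) t0 (2 + 5 * k) j x"
        using core'[OF kj(1) refl _ _ kj(2) x] dec[OF kj(1)] by blast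
      then show ?thesis by (simp only: horiz_core[OF False] kj(4,5) kj(3)[symmetric])
    qed
  qed
qed

section \<open>The tile set\<close>

definition colour :: "nat \<Rightarrow> nat \<Rightarrow> signal \<Rightarrow> nat" where
  "colour x y b = to_nat (x, y, b)"

lemma colour_eq [simp]: "colour x y b = colour x' y' b' \<longleftrightarrow> x = x' \<and> y = y' \<and> b = b'"
  by (auto simp: colour_def)

text \<open>A side bears the coordinates of the cell to its east or north, so matching alone makes
  the coordinates advance modulo 19.\<close>

fun tile_of :: "ctile \<Rightarrow> tile" where
  "tile_of (x, y, n, e, s, w) = (colour x (inc y) n, colour (inc x) y e, colour x y s, colour x y w)"

lemma tile_of_simps:
  "north (tile_of (x, y, n, e, s, w)) = colour x (inc y) n"
  "east (tile_of (x, y, n, e, s, w)) = colour (inc x) y e"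
  "south (tile_of (x, y, n, e, s, w)) = colour x y s"
  "west (tile_of (x, y, n, e, s, w)) = colour x y w"
  by (simp_all add: north_def east_def south_def west_def)

lemma inj_tile_of: "inj tile_of"
proof (rule injI)
  fix t u assume "tile_of t = tile_of u"
  then show "t = u" by (cases t; cases u) simp
qed

declare tile_of.simps [simp del]

definition untile :: "tile \<Rightarrow> ctile" where "untile = inv tile_of"

lemma untile_tile_of [simp]: "untile (tile_of t) = t"
  unfolding untile_def by (rule inv_f_f[OF inj_tile_of])

text \<open>A crossing passes every digit, so \<open>valid\<close> by itself admits infinitely many
  tiles. The bound makes the set finite, and both substitution and decoding have to respect
  it.\<close>

fun small :: "dig \<Rightarrow> bool" where
  "small (Place a b) \<longleftrightarrow> a < 19 \<and> b < 19"
| "small _ \<longleftrightarrow> True"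

fun admissible :: "ctile \<Rightarrow> bool" where
  "admissible (x, y, n, e, s, w) \<longleftrightarrow> valid (x, y, n, e, s, w) \<and>
     small (snd n) \<and> small (snd e) \<and> small (snd s) \<and> small (snd w)"

definition tiles :: "tile set" where "tiles = tile_of ` {t. admissible t}"

lemma finite_tiles: "finite tiles"
proof -
  have g: "finite (UNIV :: gate set)"
    by (rule finite_subset[of _ "{Raw, Cross, Link, FirstR, LastR, FirstC, LastC, LinkP, PosN, PosE,
      TagN, TagE, TagS, TagW, MergeN, MergeE, MergeS, MergeW, Check}"]) (use gate.exhaust in auto)
  have "{d. small d} \<subseteq> {Blank} \<union> (\<lambda>(a, b). Place a b) ` ({..<19} \<times> {..<19}) \<union> Tag ` UNIV"
  proof
    fix d assume "d \<in> {d. small d}"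
    then show "d \<in> {Blank} \<union> (\<lambda>(a, b). Place a b) ` ({..<19} \<times> {..<19}) \<union> Tag ` UNIV" by (cases d) auto
  qed
  then have d: "finite {d. small d}" by (rule finite_subset) (use g in auto)
  let ?B = "(UNIV :: gate set) \<times> {d. small d}"
  have "{t. admissible t} \<subseteq> {..<19} \<times> {..<19} \<times> ?B \<times> ?B \<times> ?B \<times> ?B" by auto
  then have "finite {t. admissible t}" by (rule finite_subset) (use g d in auto)
  then show ?thesis by (simp add: tiles_def)
qed

definition child :: "ctile \<Rightarrow> nat \<Rightarrow> nat \<Rightarrow> ctile" where
  "child t x y = (x, y, vert (tile_gate t) t x (Suc y), horiz (tile_gate t) t (Suc x) y,
     vert (tile_gate t) t x y, horiz (tile_gate t) t x y)"

definition substitution :: "tile \<Rightarrow> cell \<Rightarrow> tile" where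
  "substitution r p = tile_of (child (untile r) (nat (fst p)) (nat (snd p)))"

lemma small_core:
  assumes "a < 19" "b < 19" "small (snd n)" "small (snd e)" "small (snd s)" "small (snd w)"
  shows "small (snd (core_col g (a, b, n, e, s, w) c i y))" "small (snd (core_row g (a, b, n, e, s, w) c i y))"
  using assms inc_less by (auto simp: lift_def)

lemma small_vert_horiz:
  assumes "admissible t"
  shows "small (snd (vert g t x y))" "small (snd (horiz g t x y))"
proof -
  obtain a b n e s w where t: "t = (a, b, n, e, s, w)" by (cases t)
  have A: "a < 19" "b < 19" "small (snd n)" "small (snd e)" "small (snd s)" "small (snd w)"
    using assms by (simp_all add: t)
  show "small (snd (vert g t x y))" "small (snd (horiz g t x y))"
    unfolding t vert.simps horiz.simps using small_core[OF A] A
    by (auto simp: link_line_def simp del: core_col.simps core_row.simps)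
qed

lemma admissible_child:
  assumes "admissible t" "x < 19" "y < 19"
  shows "admissible (child t x y)"
proof -
  obtain a b n e s w where t: "t = (a, b, n, e, s, w)" by (cases t)
  have "a < 19" "b < 19" "rel (gate_at a b) n e s w" using assms(1) by (simp_all add: t)
  from child_valid[OF this assms(2,3)] have "valid (child t x y)"
    using assms(2,3) by (simp only: child_def valid.simps t tile_gate.simps)
  then show ?thesis using small_vert_horiz[OF assms(1)]
    by (simp add: child_def del: valid.simps vert.simps horiz.simps)
qed

section \<open>Borders of images\<close>

lemma east_west_iff:
  "east (tile_of (x, y, n, e, s, w)) = west (tile_of (x', y', n', e', s', w')) \<longleftrightarrow> x' = inc x \<and> y' = y \<and> w' = e"
  by (auto simp: tile_of_simps)

lemma north_south_iff:
  "north (tile_of (x, y, n, e, s, w)) = south (tile_of (x', y', n', e', s', w')) \<longleftrightarrow> x' = x \<and> y' = inc y \<and> s' = n"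
  by (auto simp: tile_of_simps)

lemma core_base:
  fixes y :: nat
  assumes "y \<notin> {0, 1, 17, 18}" "y < 19"
  shows "2 + 5 * ((y - 2) div 5) + 5 \<le> 19"
proof -
  obtain k where "k < 3" "(y - 2) div 5 = k" using core_index[OF assms(2,1)] by blast
  then show ?thesis by simp
qed

text \<open>On the left and right border only the place, the tag and the digit of that side are
  visible; link lines and the inner lines of the cores are blank there. \<open>PosE\<close> has
  advanced the place to that of the eastern neighbour.\<close>

lemma horiz_match:
  assumes "y < 19"
  shows "horiz g (a, b, n, e, s, w) 19 y = horiz g' (inc a, b, n', e', s', e) 0 y"
proof (cases "y \<in> {0, 1, 17, 18}")
  case True then show ?thesis
    by (elim insertE emptyE) (simp_all only: horiz_link link_line_def, simp_all)
next
  case False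
  note c = core_base[OF False assms]
  show ?thesis unfolding horiz_core[OF False] using c by simp
qed

lemma vert_match:
  assumes "x < 19"
  shows "vert g (a, b, n, e, s, w) x 19 = vert g' (a, inc b, n', e', n, w') x 0"
proof (cases "x \<in> {0, 1, 17, 18}")
  case True then show ?thesis
    by (elim insertE emptyE) (simp_all only: vert_link link_line_def, simp_all)
next
  case False
  note c = core_base[OF False assms]
  show ?thesis unfolding vert_core[OF False] using c by simp
qed

lemma encodes_vert_horiz:
  assumes k: "k < 3"
  shows "encodes (2 + 5 * k) (vert (tile_gate t) t) (horiz (tile_gate t) t) t"
proof -
  have x: "2 + 5 * k + i \<notin> {0, 1, 17, 18}" "(2 + 5 * k + i - 2) div 5 = k" "(2 + 5 * k + i - 2) mod 5 = i"
    if "i < 5" for i using k that by auto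
  show ?thesis unfolding encodes_def
  proof (intro conjI allI impI)
    fix i y :: nat assume "i \<in> {0, 1, 3}" "y \<le> 19"
    then have i: "i < 5" by auto
    show "vert (tile_gate t) t (2 + 5 * k + i) y = core_col (tile_gate t) t (2 + 5 * k) i y"
      unfolding vert_core[OF x(1)[OF i]] x(2,3)[OF i] ..
  next
    fix j x' :: nat assume "j \<in> {1, 3, 4}" "x' \<le> 19"
    then have j: "j < 5" by auto
    show "horiz (tile_gate t) t x' (2 + 5 * k + j) = core_row (tile_gate t) t (2 + 5 * k) j x'"
      unfolding horiz_core[OF x(1)[OF j]] x(2,3)[OF j] ..
  qed
qed

text \<open>A colour consists of a place, a tag and a digit, and three border lines of a single copy
  show them all. So agreement in one copy already forces matching.\<close>

lemma encodes_east_west: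
  assumes t: "encodes c V H t" and u: "encodes c V' H' u" and c: "c \<le> 12"
    and eq: "\<And>y. y \<in> {c + 1, c + 3, c + 4} \<Longrightarrow> H 19 y = H' 0 y"
  shows "east (tile_of t) = west (tile_of u)"
proof -
  obtain a b n e s w where teq: "t = (a, b, n, e, s, w)" by (cases t)
  obtain a' b' n' e' s' w' where ueq: "u = (a', b', n', e', s', w')" by (cases u)
  note l = encodes_lines[OF t[unfolded teq]] and l' = encodes_lines[OF u[unfolded ueq]]
  have "raw (Place (inc a) b) = raw (Place a' b')" "raw (Tag (fst e)) = raw (Tag (fst w'))" "raw (snd e) = raw (snd w')"
    using eq[of "c + 4"] l(8)[of "c + 4" 19] l'(7)[of "c + 4" 0] eq[of "c + 3"] l(10)[of "c + 3" 19] l'(9)[of "c + 3" 0]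
      eq[of "c + 1"] l(12)[of "c + 1" 19] l'(11)[of "c + 1" 0] c by simp_all
  then show ?thesis by (simp add: teq ueq tile_of_simps prod_eq_iff)
qed

lemma encodes_north_south:
  assumes t: "encodes c V H t" and u: "encodes c V' H' u" and c: "c \<le> 12"
    and eq: "\<And>x. x \<in> {c, c + 1, c + 3} \<Longrightarrow> V x 19 = V' x 0"
  shows "north (tile_of t) = south (tile_of u)"
proof -
  obtain a b n e s w where teq: "t = (a, b, n, e, s, w)" by (cases t)
  obtain a' b' n' e' s' w' where ueq: "u = (a', b', n', e', s', w')" by (cases u)
  note l = encodes_lines[OF t[unfolded teq]] and l' = encodes_lines[OF u[unfolded ueq]]
  have "raw (Place a (inc b)) = raw (Place a' b')" "raw (Tag (fst n)) = raw (Tag (fst s'))" "raw (snd n) = raw (snd s')"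
    using eq[of c] l(2)[of c 19] l'(1)[of c 0] eq[of "c + 1"] l(4)[of "c + 1" 19] l'(3)[of "c + 1" 0]
      eq[of "c + 3"] l(6)[of "c + 3" 19] l'(5)[of "c + 3" 0] c by simp_all
  then show ?thesis by (simp add: teq ueq tile_of_simps prod_eq_iff)
qed

text \<open>The full columns of different copies are never adjacent, nor are the full rows, also
  cyclically. A window thus meets full columns of at most one copy and full rows of at most one, and
  the isolated needed cells never bring in a third. The finitely many windows, including those that
  wrap around, are evaluated.\<close>

lemma two_by_two:
  "\<forall>x\<in>set [0..<19]. \<forall>y\<in>set [0..<19]. \<exists>k\<in>set [0..<3].
     \<not> needed k x y \<and> \<not> needed k (inc x) y \<and> \<not> needed k x (inc y) \<and> \<not> needed k (inc x) (inc y)"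
  by code_simp

section \<open>Reading signals off tilings\<close>

lemma subst_eq: "i < 19 \<Longrightarrow> j < 19 \<Longrightarrow> substitution (tile_of t) (int i, int j) = tile_of (child t i j)"
  by (simp add: substitution_def)

lemma sq_int: "p \<in> sq 19 \<longleftrightarrow> (\<exists>i<19. \<exists>j<19. p = (int i, int j))"
proof
  assume "p \<in> sq 19"
  then have "nat (fst p) < 19 \<and> nat (snd p) < 19 \<and> p = (int (nat (fst p)), int (nat (snd p)))"
    by (auto simp: sq_def)
  then show "\<exists>i<19. \<exists>j<19. p = (int i, int j)" by blast
qed (auto simp: sq_def)

definition coord_x :: "tile \<Rightarrow> int" where "coord_x r = int (fst (untile r))"
definition coord_y :: "tile \<Rightarrow> int" where "coord_y r = int (fst (snd (untile r)))"

lemma coord_tile_of: "coord_x (tile_of (x, y, t)) = int x" "coord_y (tile_of (x, y, t)) = int y"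
  by (simp_all add: coord_x_def coord_y_def)

lemma int_inc: "int (inc x) = (int x + 1) mod 19"
  by (simp add: inc_def zmod_int add.commute)

lemma tilesE:
  assumes "r \<in> tiles"
  obtains x y n e s w where "r = tile_of (x, y, n, e, s, w)" "admissible (x, y, n, e, s, w)" "x < 19" "y < 19"
    "rel (gate_at x y) n e s w"
proof -
  obtain t where "r = tile_of t" "admissible t" using assms by (auto simp: tiles_def)
  then show thesis using that by (cases t) auto
qed

text \<open>Replaces four signals per cell by two arrays in which a shared side has one entry.
  \<open>Q\<close> may have holes, so that the lemma serves intact macro-tiles and surviving copies
  alike.\<close>

lemma tiling_cells:
  assumes M: "tiling tiles Q M" and Q: "Q \<subseteq> sq 19"
    and coord: "\<And>p. p \<in> Q \<Longrightarrow> coord_x (M p) = fst p \<and> coord_y (M p) = snd p"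
  obtains V H where
    "\<And>x y. (int x, int y) \<in> Q \<Longrightarrow> M (int x, int y) = tile_of (x, y, V x (Suc y), H (Suc x) y, V x y, H x y)"
    "\<And>x y. (int x, int y) \<in> Q \<Longrightarrow> rel (gate_at x y) (V x (Suc y)) (H (Suc x) y) (V x y) (H x y)"
    "\<And>x y. (int x, int y) \<in> Q \<Longrightarrow> small (snd (V x (Suc y))) \<and> small (snd (H (Suc x) y)) \<and>
       small (snd (V x y)) \<and> small (snd (H x y))"
proof -
  define sig where "sig x y = snd (snd (untile (M (int x, int y))))" for x y :: nat
  have cell: "\<exists>n e s w. M (int x, int y) = tile_of (x, y, n, e, s, w) \<and> sig x y = (n, e, s, w) \<and>
      admissible (x, y, n, e, s, w)" if q: "(int x, int y) \<in> Q" for x y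
  proof -
    have "M (int x, int y) \<in> tiles" using M q by (auto simp: tiling_def)
    then obtain x' y' n e s w where t: "M (int x, int y) = tile_of (x', y', n, e, s, w)" "admissible (x', y', n, e, s, w)"
      by (rule tilesE)
    have "x' = x" "y' = y" using coord[OF q] by (simp_all add: t coord_tile_of)
    then show ?thesis using t unfolding sig_def
      by (intro exI[of _ n] exI[of _ e] exI[of _ s] exI[of _ w]) simp
  qed
  \<comment> \<open>A side is read from the cell north of it if that cell is in \<open>Q\<close>,
    and from the cell south of it otherwise. If neither is in \<open>Q\<close>, the value is
    arbitrary, as is the truncated \<open>y - 1\<close> at 0; the conclusions only mention sides of
    cells in \<open>Q\<close>.\<close>
  define V where "V x y = (if (int x, int y) \<in> Q then fst (snd (snd (sig x y))) else fst (sig x (y - 1)))" for x y :: nat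
  define H where "H x y = (if (int x, int y) \<in> Q then snd (snd (snd (sig x y))) else fst (snd (sig (x - 1) y)))" for x y :: nat
  have north: "V x (Suc y) = fst (sig x y)" if q: "(int x, int y) \<in> Q" for x y
  proof (cases "(int x, int (Suc y)) \<in> Q")
    case True
    then have "north (M (int x, int y)) = south (M (int x, int (Suc y)))"
      using M q unfolding tiling_def by (simp add: add.commute)
    then show ?thesis using cell[OF q] cell[OF True] True by (auto simp: V_def tile_of_simps)
  qed (simp add: V_def)
  have east: "H (Suc x) y = fst (snd (sig x y))" if q: "(int x, int y) \<in> Q" for x y
  proof (cases "(int (Suc x), int y) \<in> Q")
    case True
    then have "east (M (int x, int y)) = west (M (int (Suc x), int y))"
      using M q unfolding tiling_def by (simp add: add.commute)
    then show ?thesis using cell[OF q] cell[OF True] True by (auto simp: H_def tile_of_simps)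
  qed (simp add: H_def)
  have sw: "V x y = fst (snd (snd (sig x y)))" "H x y = snd (snd (snd (sig x y)))" if "(int x, int y) \<in> Q" for x y
    using that by (simp_all add: V_def H_def)
  show thesis
  proof (rule that)
    fix x y assume q: "(int x, int y) \<in> Q"
    obtain n e s w where c: "M (int x, int y) = tile_of (x, y, n, e, s, w)" "sig x y = (n, e, s, w)"
      "admissible (x, y, n, e, s, w)" using cell[OF q] by blast
    show "M (int x, int y) = tile_of (x, y, V x (Suc y), H (Suc x) y, V x y, H x y)"
      unfolding north[OF q] east[OF q] sw[OF q] using c by simp
    show "rel (gate_at x y) (V x (Suc y)) (H (Suc x) y) (V x y) (H x y)"
      unfolding north[OF q] east[OF q] sw[OF q] using c by simp
    show "small (snd (V x (Suc y))) \<and> small (snd (H (Suc x) y)) \<and> small (snd (V x y)) \<and> small (snd (H x y))"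
      unfolding north[OF q] east[OF q] sw[OF q] using c by simp
  qed
qed

text \<open>Decoding yields only \<open>valid\<close>. The bound on the digits is inherited from the
  border cells where the digit wires end.\<close>

lemma encodes_admissible:
  assumes "valid t" "encodes c V H t" "c \<le> 12" "small (snd (V (c + 3) 19))" "small (snd (V (c + 3) 0))"
    "small (snd (H 19 (c + 1)))" "small (snd (H 0 (c + 1)))"
  shows "admissible t"
proof -
  obtain a b n e s w where teq: "t = (a, b, n, e, s, w)" by (cases t)
  note l = encodes_lines[OF assms(2)[unfolded teq]]
  show ?thesis using assms(1,3-) l(5)[of "c + 3" 0] l(6)[of "c + 3" 19] l(11)[of "c + 1" 0] l(12)[of "c + 1" 19]
    by (simp add: teq del: valid.simps)
qed

lemma decode_block:
  assumes M: "tiling tiles (sq 19) M"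
    and coord: "\<forall>p\<in>sq 19. coord_x (M p) = fst p \<and> coord_y (M p) = snd p"
  shows "\<exists>t\<in>tiles. \<forall>p\<in>sq 19. M p = substitution t p"
proof (rule tiling_cells[OF M subset_refl bspec[OF coord]])
  fix V H
  assume cell: "\<And>x y. (int x, int y) \<in> sq 19 \<Longrightarrow> M (int x, int y) = tile_of (x, y, V x (Suc y), H (Suc x) y, V x y, H x y)"
    and rl: "\<And>x y. (int x, int y) \<in> sq 19 \<Longrightarrow> rel (gate_at x y) (V x (Suc y)) (H (Suc x) y) (V x y) (H x y)"
    and sm: "\<And>x y. (int x, int y) \<in> sq 19 \<Longrightarrow> small (snd (V x (Suc y))) \<and> small (snd (H (Suc x) y)) \<and>
       small (snd (V x y)) \<and> small (snd (H x y))"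
  have sq: "(int x, int y) \<in> sq 19 \<longleftrightarrow> x < 19 \<and> y < 19" for x y by (auto simp: sq_def)
  obtain t where t: "valid t"
    and V: "\<And>x y. x < 19 \<Longrightarrow> y \<le> 19 \<Longrightarrow> V x y = vert (tile_gate t) t x y"
    and H: "\<And>x y. x \<le> 19 \<Longrightarrow> y < 19 \<Longrightarrow> H x y = horiz (tile_gate t) t x y"
    by (rule signals_decode[of V H]) (rule rl, simp add: sq, rule that)
  have "encodes 2 V H t" using encodes_vert_horiz[of 0 t] V H by (simp add: encodes_def)
  then have "admissible t"
    by (rule encodes_admissible[OF t]) (use sm[of 5 18] sm[of 5 0] sm[of 18 3] sm[of 0 3] in \<open>simp_all add: sq_def\<close>)
  moreover have "M p = substitution (tile_of t) p" if p: "p \<in> sq 19" for p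
  proof -
    obtain x y where xy: "x < 19" "y < 19" "p = (int x, int y)" using p unfolding sq_int by blast
    show ?thesis unfolding xy(3) subst_eq[OF xy(1,2)] using cell[of x y] xy V H
      by (simp add: sq child_def del: vert.simps horiz.simps)
  qed
  ultimately show ?thesis unfolding tiles_def by blast
qed

lemma needed_row:
  assumes "k < 3"
  shows "needed k 0 y \<longleftrightarrow> y \<in> {2 + 5 * k + 1, 2 + 5 * k + 3, 2 + 5 * k + 4}"
    "y \<in> {2 + 5 * k + 1, 2 + 5 * k + 3, 2 + 5 * k + 4} \<Longrightarrow> needed k 18 y"
  using assms by (auto simp: needed_def Let_def)

lemma needed_col:
  assumes "k < 3"
  shows "needed k x 0 \<longleftrightarrow> x \<in> {2 + 5 * k, 2 + 5 * k + 1, 2 + 5 * k + 3}"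
    "x \<in> {2 + 5 * k, 2 + 5 * k + 1, 2 + 5 * k + 3} \<Longrightarrow> needed k x 18"
  using assms by (auto simp: needed_def Let_def)

lemma inc_18: "inc 18 = 0" by (simp add: inc_def)

lemma subst_sides:
  assumes "j < 19"
  shows "west (substitution (tile_of t) (0, int j)) = colour 0 j (horiz (tile_gate t) t 0 j)"
    "east (substitution (tile_of t) (18, int j)) = colour 0 j (horiz (tile_gate t) t 19 j)"
    "south (substitution (tile_of t) (int j, 0)) = colour j 0 (vert (tile_gate t) t j 0)"
    "north (substitution (tile_of t) (int j, 18)) = colour j 0 (vert (tile_gate t) t j 19)"
  using subst_eq[of 0 j t] subst_eq[of 18 j t] subst_eq[of j 0 t] subst_eq[of j 18 t] assms
  by (simp_all add: child_def tile_of_simps inc_18 del: vert.simps horiz.simps)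

lemma subst_east_west:
  assumes k: "k < 3"
    and eq: "\<And>j. j < 19 \<Longrightarrow> needed k 0 j \<Longrightarrow> east (substitution (tile_of t) (18, int j)) = west (substitution (tile_of u) (0, int j))"
  shows "east (tile_of t) = west (tile_of u)"
proof (rule encodes_east_west[OF encodes_vert_horiz[OF k] encodes_vert_horiz[OF k]])
  fix y assume y: "y \<in> {2 + 5 * k + 1, 2 + 5 * k + 3, 2 + 5 * k + 4}"
  then have "y < 19" using k by auto
  then show "horiz (tile_gate t) t 19 y = horiz (tile_gate u) u 0 y"
    using eq[of y] y by (simp only: needed_row(1)[OF k] subst_sides colour_eq)
qed (use k in simp)

lemma subst_north_south:
  assumes k: "k < 3"
    and eq: "\<And>i. i < 19 \<Longrightarrow> needed k i 0 \<Longrightarrow> north (substitution (tile_of t) (int i, 18)) = south (substitution (tile_of u) (int i, 0))"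
  shows "north (tile_of t) = south (tile_of u)"
proof (rule encodes_north_south[OF encodes_vert_horiz[OF k] encodes_vert_horiz[OF k]])
  fix x assume x: "x \<in> {2 + 5 * k, 2 + 5 * k + 1, 2 + 5 * k + 3}"
  then have "x < 19" using k by auto
  then show "vert (tile_gate t) t x 19 = vert (tile_gate u) u x 0"
    using eq[of x] x by (simp only: needed_col(1)[OF k] subst_sides colour_eq)
qed (use k in simp)

lemma east_west_subst:
  assumes "east (tile_of t) = west (tile_of u)" "j < 19"
  shows "east (substitution (tile_of t) (18, int j)) = west (substitution (tile_of u) (0, int j))"
proof -
  obtain a b n e s w where teq: "t = (a, b, n, e, s, w)" by (cases t)
  obtain a' b' n' e' s' w' where ueq: "u = (a', b', n', e', s', w')" by (cases u)
  have "a' = inc a" "b' = b" "w' = e" using assms(1) by (simp_all add: teq ueq east_west_iff)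
  then have "horiz (tile_gate t) t 19 j = horiz (tile_gate u) u 0 j"
    unfolding teq ueq by (simp only:) (rule horiz_match[OF assms(2)])
  then show ?thesis by (simp only: subst_sides[OF assms(2)])
qed

lemma north_south_subst:
  assumes "north (tile_of t) = south (tile_of u)" "i < 19"
  shows "north (substitution (tile_of t) (int i, 18)) = south (substitution (tile_of u) (int i, 0))"
proof -
  obtain a b n e s w where teq: "t = (a, b, n, e, s, w)" by (cases t)
  obtain a' b' n' e' s' w' where ueq: "u = (a', b', n', e', s', w')" by (cases u)
  have "a' = a" "b' = inc b" "s' = n" using assms(1) by (simp_all add: teq ueq north_south_iff)
  then have "vert (tile_gate t) t i 19 = vert (tile_gate u) u i 0"
    unfolding teq ueq by (simp only:) (rule vert_match[OF assms(2)])
  then show ?thesis by (simp only: subst_sides[OF assms(2)])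
qed

lemma subst_inj:
  assumes "\<forall>p\<in>sq 19. substitution (tile_of t) p = substitution (tile_of u) p"
  shows "t = u"
proof -
  obtain a b n e s w where teq: "t = (a, b, n, e, s, w)" by (cases t)
  obtain a' b' n' e' s' w' where ueq: "u = (a', b', n', e', s', w')" by (cases u)
  have c: "child t i j = child u i j" if "i < 19" "j < 19" for i j
  proof -
    have "(int i, int j) \<in> sq 19" using that by (simp add: sq_def)
    then have "tile_of (child t i j) = tile_of (child u i j)" using assms subst_eq[OF that] by metis
    then show ?thesis by (metis untile_tile_of)
  qed
  have "vert (tile_gate t) t x y = vert (tile_gate u) u x y" if "x < 19" "y \<le> 19" for x y
  proof (cases y)
    case 0 then show ?thesis using c[of x 0] that by (simp add: child_def del: vert.simps horiz.simps)
  next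
    case (Suc y') then show ?thesis using c[of x y'] that by (simp add: child_def del: vert.simps horiz.simps)
  qed
  moreover have "horiz (tile_gate t) t x y = horiz (tile_gate u) u x y" if "x \<le> 19" "y < 19" for x y
  proof (cases x)
    case 0 then show ?thesis using c[of 0 y] that by (simp add: child_def del: vert.simps horiz.simps)
  next
    case (Suc x') then show ?thesis using c[of x' y] that by (simp add: child_def del: vert.simps horiz.simps)
  qed
  ultimately have e: "encodes 2 (vert (tile_gate t) t) (horiz (tile_gate t) t) u"
    using encodes_vert_horiz[of 0 u] by (simp add: encodes_def)
  have "encodes 2 (vert (tile_gate t) t) (horiz (tile_gate t) t) t" using encodes_vert_horiz[of 0 t] by simp
  note l = encodes_lines[OF this[unfolded teq]] and l' = encodes_lines[OF e[unfolded teq ueq]]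
  show ?thesis using l(1)[of 2 0] l'(1)[of 2 0] l(3)[of 3 0] l'(3)[of 3 0] l(4)[of 3 19] l'(4)[of 3 19]
      l(5)[of 5 0] l'(5)[of 5 0] l(6)[of 5 19] l'(6)[of 5 19] l(9)[of 5 0] l'(9)[of 5 0] l(10)[of 5 19] l'(10)[of 5 19]
      l(11)[of 3 0] l'(11)[of 3 0] l(12)[of 3 19] l'(12)[of 3 19]
    by (simp add: teq ueq prod_eq_iff del: vert.simps horiz.simps)
qed

text \<open>The reading half of \<open>redundant\<close>. The wires that end on the border run
  entirely through needed cells, so the tile decoded inside accounts for the colours of
  \<open>M\<close> at both of their ends.\<close>

lemma copy_reads:
  assumes k: "k < 3" and Q: "Q = {(int x, int y) | x y. x < 19 \<and> y < 19 \<and> needed k x y}"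
    and M: "tiling tiles Q M" and coord: "\<forall>p\<in>Q. coord_x (M p) = fst p \<and> coord_y (M p) = snd p"
  obtains t where "admissible t"
    "\<And>j. j < 19 \<Longrightarrow> needed k 0 j \<Longrightarrow> west (M (0, int j)) = west (substitution (tile_of t) (0, int j)) \<and>
       east (M (18, int j)) = east (substitution (tile_of t) (18, int j))"
    "\<And>i. i < 19 \<Longrightarrow> needed k i 0 \<Longrightarrow> south (M (int i, 0)) = south (substitution (tile_of t) (int i, 0)) \<and>
       north (M (int i, 18)) = north (substitution (tile_of t) (int i, 18))"
proof (rule tiling_cells[OF M _ bspec[OF coord]])
  show "Q \<subseteq> sq 19" by (auto simp: Q sq_def)
  fix V H
  assume cell: "\<And>x y. (int x, int y) \<in> Q \<Longrightarrow> M (int x, int y) = tile_of (x, y, V x (Suc y), H (Suc x) y, V x y, H x y)"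
    and rl: "\<And>x y. (int x, int y) \<in> Q \<Longrightarrow> rel (gate_at x y) (V x (Suc y)) (H (Suc x) y) (V x y) (H x y)"
    and sm: "\<And>x y. (int x, int y) \<in> Q \<Longrightarrow> small (snd (V x (Suc y))) \<and> small (snd (H (Suc x) y)) \<and>
       small (snd (V x y)) \<and> small (snd (H x y))"
  define c where "c = 2 + 5 * k"
  have inQ: "(int x, int y) \<in> Q \<longleftrightarrow> x < 19 \<and> y < 19 \<and> needed k x y" for x y by (auto simp: Q)
  obtain t where t: "valid t" "encodes c V H t"
    using copy_encodes[OF k c_def, of V H] rl inQ by blast
  have c: "c \<le> 12" "c + 3 < 19" "c + 1 < 19" using k by (simp_all add: c_def)
  note row = needed_row[OF k, folded c_def] and col = needed_col[OF k, folded c_def]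
  have "needed k (c + 3) 18" "needed k (c + 3) 0" "needed k 18 (c + 1)" "needed k 0 (c + 1)"
    using row col by simp_all
  then have q: "(int (c + 3), int 18) \<in> Q" "(int (c + 3), int 0) \<in> Q" "(int 18, int (c + 1)) \<in> Q" "(int 0, int (c + 1)) \<in> Q"
    unfolding inQ using c by simp_all
  have adm: "admissible t"
    by (rule encodes_admissible[OF t c(1)]) (use sm[OF q(1)] sm[OF q(2)] sm[OF q(3)] sm[OF q(4)] in simp_all)
  have e: "encodes c (vert (tile_gate t) t) (horiz (tile_gate t) t) t"
    unfolding c_def by (rule encodes_vert_horiz[OF k])
  show thesis
  proof (rule that[OF adm])
    fix j :: nat assume j: "j < 19" "needed k 0 j"
    then have j': "needed k 18 j" using row by blast
    obtain r where r: "r \<in> {1, 3, 4}" "j = c + r" using j(2) row(1) by auto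
    have h: "H x j = horiz (tile_gate t) t x j" if "x \<le> 19" for x
      using encodes_row[OF t(2) r(1) that r(2)] encodes_row[OF e r(1) that r(2)] by simp
    have "M (0, int j) = tile_of (0, j, V 0 (Suc j), H (Suc 0) j, V 0 j, H 0 j)"
      "M (18, int j) = tile_of (18, j, V 18 (Suc j), H 19 j, V 18 j, H 18 j)"
    proof -
      have q: "(int 0, int j) \<in> Q" "(int 18, int j) \<in> Q" unfolding inQ using j j' by simp_all
      show "M (0, int j) = tile_of (0, j, V 0 (Suc j), H (Suc 0) j, V 0 j, H 0 j)"
        "M (18, int j) = tile_of (18, j, V 18 (Suc j), H 19 j, V 18 j, H 18 j)"
        using cell[OF q(1)] cell[OF q(2)] by simp_all
    qed
    then show "west (M (0, int j)) = west (substitution (tile_of t) (0, int j)) \<and>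
       east (M (18, int j)) = east (substitution (tile_of t) (18, int j))"
      unfolding subst_sides[OF j(1)] using h[of 0] h[of 19]
      by (simp add: tile_of_simps inc_18 del: vert.simps horiz.simps)
  next
    fix i :: nat assume i: "i < 19" "needed k i 0"
    then have i': "needed k i 18" using col by blast
    obtain r where r: "r \<in> {0, 1, 3}" "i = c + r" using i(2) col(1) by auto
    have v: "V i y = vert (tile_gate t) t i y" if "y \<le> 19" for y
      using encodes_col[OF t(2) r(1) that r(2)] encodes_col[OF e r(1) that r(2)] by simp
    have "M (int i, 0) = tile_of (i, 0, V i (Suc 0), H (Suc i) 0, V i 0, H i 0)"
      "M (int i, 18) = tile_of (i, 18, V i 19, H (Suc i) 18, V i 18, H i 18)"
    proof -
      have q: "(int i, int 0) \<in> Q" "(int i, int 18) \<in> Q" unfolding inQ using i i' by simp_all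
      show "M (int i, 0) = tile_of (i, 0, V i (Suc 0), H (Suc i) 0, V i 0, H i 0)"
        "M (int i, 18) = tile_of (i, 18, V i 19, H (Suc i) 18, V i 18, H i 18)"
        using cell[OF q(1)] cell[OF q(2)] by simp_all
    qed
    then show "south (M (int i, 0)) = south (substitution (tile_of t) (int i, 0)) \<and>
       north (M (int i, 18)) = north (substitution (tile_of t) (int i, 18))"
      unfolding subst_sides[OF i(1)] using v[of 0] v[of 19]
      by (simp add: tile_of_simps inc_18 del: vert.simps horiz.simps)
  qed
qed

lemma mod_near:
  assumes "x < 19"
  shows "(int x - a) mod 19 \<in> {0, 1} \<longleftrightarrow> x = nat (a mod 19) \<or> x = inc (nat (a mod 19))"
proof -
  define m where "m = nat (a mod 19)"
  have m: "m < 19" "a mod 19 = int m" by (simp_all add: m_def nat_less_iff)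
  have "(int x - a) mod 19 = (int x - int m) mod 19" using m(2) by (metis mod_diff_right_eq)
  also have "\<dots> = (if m \<le> x then int x - int m else int x - int m + 19)"
    using assms m(1) by (auto simp: mod_pos_pos_trivial intro: int_mod_pos_eq[of _ _ "- 1"])
  finally show ?thesis unfolding m_def[symmetric] using assms m(1) by (auto simp: inc_def mod_if)
qed

lemma copy_avoiding_hole:
  fixes a b :: int
  obtains k where "k < 3"
    "\<And>x y. x < 19 \<Longrightarrow> y < 19 \<Longrightarrow> needed k x y \<Longrightarrow> \<not> ((int x - a) mod 19 \<in> {0, 1} \<and> (int y - b) mod 19 \<in> {0, 1})"
proof -
  have "nat (a mod 19) \<in> set [0..<19]" "nat (b mod 19) \<in> set [0..<19]" by (simp_all add: nat_less_iff)
  then obtain k where k: "k \<in> set [0..<3]" "\<not> needed k (nat (a mod 19)) (nat (b mod 19))"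
    "\<not> needed k (inc (nat (a mod 19))) (nat (b mod 19))" "\<not> needed k (nat (a mod 19)) (inc (nat (b mod 19)))"
    "\<not> needed k (inc (nat (a mod 19))) (inc (nat (b mod 19)))"
    using two_by_two by blast
  show thesis
  proof (rule that[of k])
    show "k < 3" using k(1) by simp
    fix x y :: nat assume "x < 19" "y < 19" "needed k x y"
    then show "\<not> ((int x - a) mod 19 \<in> {0, 1} \<and> (int y - b) mod 19 \<in> {0, 1})"
      unfolding mod_near[OF \<open>x < 19\<close>] mod_near[OF \<open>y < 19\<close>] using k(2-) by blast
  qed
qed

lemma all_below_19: "(\<forall>j. 0 \<le> j \<and> j < int 19 \<longrightarrow> Pr j) \<longleftrightarrow> (\<forall>j<19. Pr (int j))"
  by (metis nat_0_le nat_less_iff of_nat_0_le_iff of_nat_less_iff)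

lemma tilesD:
  assumes "r \<in> tiles"
  shows "\<exists>t. admissible t \<and> r = tile_of t"
  using assms unfolding tiles_def by blast

section \<open>The tile set as an instance of the abstract scheme\<close>

interpretation robust_substitution tiles 19 substitution coord_x coord_y
proof
  show "2 < (19::nat)" by simp
  show "0 \<le> coord_x t \<and> coord_x t < int 19 \<and> 0 \<le> coord_y t \<and> coord_y t < int 19" if "t \<in> tiles" for t
    using that by (rule tilesE) (simp add: coord_tile_of)
  show "coord_x u = (coord_x t + 1) mod int 19 \<and> coord_y u = coord_y t"
    if tu: "t \<in> tiles" "u \<in> tiles" and e: "east t = west u" for t u
  proof (rule tilesE[OF tu(1)], rule tilesE[OF tu(2)])
    fix x y n e' s w x' y' n' e'' s' w'
    assume "t = tile_of (x, y, n, e', s, w)" "u = tile_of (x', y', n', e'', s', w')"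
    then show ?thesis using e by (simp add: east_west_iff coord_tile_of int_inc)
  qed
  show "coord_x u = coord_x t \<and> coord_y u = (coord_y t + 1) mod int 19"
    if tu: "t \<in> tiles" "u \<in> tiles" and e: "north t = south u" for t u
  proof (rule tilesE[OF tu(1)], rule tilesE[OF tu(2)])
    fix x y n e' s w x' y' n' e'' s' w'
    assume "t = tile_of (x, y, n, e', s, w)" "u = tile_of (x', y', n', e'', s', w')"
    then show ?thesis using e by (simp add: north_south_iff coord_tile_of int_inc)
  qed
  show "tiling tiles (sq 19) (substitution r)" if r: "r \<in> tiles" for r
  proof -
    obtain t where t: "admissible t" "r = tile_of t" using tilesD[OF r] by blast
    show ?thesis unfolding tiling_def
    proof (intro conjI ballI allI impI)
      fix p assume "p \<in> sq 19"
      then obtain i j where "i < 19" "j < 19" "p = (int i, int j)" unfolding sq_int by blast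
      then show "substitution r p \<in> tiles"
        using admissible_child[OF t(1)] by (auto simp: t(2) subst_eq tiles_def simp del: admissible.simps)
    next
      fix x y assume A: "(x, y) \<in> sq 19 \<and> (x + 1, y) \<in> sq 19"
      then obtain i j where ij: "i < 18" "j < 19" "x = int i" "y = int j"
        by (intro that[of "nat x" "nat y"]) (auto simp: sq_def)
      have "x + 1 = int (Suc i)" by (simp add: ij)
      then have "substitution r (x, y) = tile_of (child t i j)" "substitution r (x + 1, y) = tile_of (child t (Suc i) j)"
        using subst_eq[of i j t] subst_eq[of "Suc i" j t] ij by (simp_all only: t(2))
      moreover have "inc i = Suc i" using ij(1) by (simp add: inc_def)
      ultimately show "east (substitution r (x, y)) = west (substitution r (x + 1, y))"
        by (simp add: child_def tile_of_simps del: vert.simps horiz.simps)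
    next
      fix x y assume A: "(x, y) \<in> sq 19 \<and> (x, y + 1) \<in> sq 19"
      then obtain i j where ij: "i < 19" "j < 18" "x = int i" "y = int j"
        by (intro that[of "nat x" "nat y"]) (auto simp: sq_def)
      have "y + 1 = int (Suc j)" by (simp add: ij)
      then have "substitution r (x, y) = tile_of (child t i j)" "substitution r (x, y + 1) = tile_of (child t i (Suc j))"
        using subst_eq[of i j t] subst_eq[of i "Suc j" t] ij by (simp_all only: t(2))
      moreover have "inc j = Suc j" using ij(2) by (simp add: inc_def)
      ultimately show "north (substitution r (x, y)) = south (substitution r (x, y + 1))"
        by (simp add: child_def tile_of_simps del: vert.simps horiz.simps)
    qed
  qed
  show "coord_x (substitution r p) = fst p \<and> coord_y (substitution r p) = snd p" if "r \<in> tiles" "p \<in> sq 19" for r p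
    using that(2) by (auto simp: sq_def substitution_def child_def coord_tile_of)
  show "r = s" if rs: "r \<in> tiles" "s \<in> tiles" and eq: "\<forall>p\<in>sq 19. substitution r p = substitution s p" for r s
    using tilesD[OF rs(1)] tilesD[OF rs(2)] subst_inj eq by blast
  show "east r = west s \<longleftrightarrow> (\<forall>j. 0 \<le> j \<and> j < int 19 \<longrightarrow> east (substitution r (int 19 - 1, j)) = west (substitution s (0, j)))"
    if rs: "r \<in> tiles" "s \<in> tiles" for r s
  proof -
    obtain t u where tu: "admissible t" "r = tile_of t" "admissible u" "s = tile_of u"
      using tilesD[OF rs(1)] tilesD[OF rs(2)] by blast
    have "east r = west s" if "\<forall>j<19. east (substitution r (18, int j)) = west (substitution s (0, int j))"
      unfolding tu(2,4) by (rule subst_east_west[of 0]) (use that tu in auto)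
    then show ?thesis unfolding all_below_19 using east_west_subst[of t u] by (auto simp: tu(2,4))
  qed
  show "north r = south s \<longleftrightarrow> (\<forall>i. 0 \<le> i \<and> i < int 19 \<longrightarrow> north (substitution r (i, int 19 - 1)) = south (substitution s (i, 0)))"
    if rs: "r \<in> tiles" "s \<in> tiles" for r s
  proof -
    obtain t u where tu: "admissible t" "r = tile_of t" "admissible u" "s = tile_of u"
      using tilesD[OF rs(1)] tilesD[OF rs(2)] by blast
    have "north r = south s" if "\<forall>i<19. north (substitution r (int i, 18)) = south (substitution s (int i, 0))"
      unfolding tu(2,4) by (rule subst_north_south[of 0]) (use that tu in auto)
    then show ?thesis unfolding all_below_19 using north_south_subst[of t u] by (auto simp: tu(2,4))
  qed
  show "\<exists>t\<in>tiles. \<forall>p\<in>sq 19. M p = substitution t p"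
    if "tiling tiles (sq 19) M" "\<forall>p\<in>sq 19. coord_x (M p) = fst p \<and> coord_y (M p) = snd p" for M
    using that by (rule decode_block)
  show "\<exists>Q \<subseteq> sq 19.
       (\<forall>p\<in>Q. \<not> ((fst p - a) mod int 19 \<in> {0, 1} \<and> (snd p - b) mod int 19 \<in> {0, 1})) \<and>
       (\<forall>M. tiling tiles Q M \<longrightarrow> (\<forall>p\<in>Q. coord_x (M p) = fst p \<and> coord_y (M p) = snd p) \<longrightarrow>
          (\<exists>t\<in>tiles. (\<forall>j. (0, j) \<in> Q \<and> (int 19 - 1, j) \<in> Q \<longrightarrow>
                west (M (0, j)) = west (substitution t (0, j)) \<and> east (M (int 19 - 1, j)) = east (substitution t (int 19 - 1, j))) \<and>
              (\<forall>i. (i, 0) \<in> Q \<and> (i, int 19 - 1) \<in> Q \<longrightarrow>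
                south (M (i, 0)) = south (substitution t (i, 0)) \<and> north (M (i, int 19 - 1)) = north (substitution t (i, int 19 - 1))))) \<and>
       (\<forall>r\<in>tiles. \<forall>s\<in>tiles.
          ((\<forall>j. (0, j) \<in> Q \<and> (int 19 - 1, j) \<in> Q \<longrightarrow> east (substitution r (int 19 - 1, j)) = west (substitution s (0, j))) \<longrightarrow> east r = west s) \<and>
          ((\<forall>i. (i, 0) \<in> Q \<and> (i, int 19 - 1) \<in> Q \<longrightarrow> north (substitution r (i, int 19 - 1)) = south (substitution s (i, 0))) \<longrightarrow> north r = south s))"
    for a b
  proof -
    obtain k where k: "k < 3" and avoid: "\<And>x y. x < 19 \<Longrightarrow> y < 19 \<Longrightarrow> needed k x y \<Longrightarrow>
        \<not> ((int x - a) mod 19 \<in> {0, 1} \<and> (int y - b) mod 19 \<in> {0, 1})"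
      by (rule copy_avoiding_hole[of a b]) (rule that)
    define Q where "Q = {(int x, int y) | x y. x < 19 \<and> y < 19 \<and> needed k x y}"
    have row: "((0, j) \<in> Q \<and> (18, j) \<in> Q) \<longleftrightarrow> (\<exists>y<19. j = int y \<and> needed k 0 y)" for j
      using needed_row[OF k] by (auto simp: Q_def)
    have col: "((i, 0) \<in> Q \<and> (i, 18) \<in> Q) \<longleftrightarrow> (\<exists>x<19. i = int x \<and> needed k x 0)" for i
      using needed_col[OF k] by (auto simp: Q_def)
    have n18: "int 19 - 1 = 18" by simp
    show ?thesis
    proof (intro exI[of _ Q] conjI allI impI ballI)
      show "Q \<subseteq> sq 19" by (auto simp: Q_def sq_def)
      show "\<not> ((fst p - a) mod int 19 \<in> {0, 1} \<and> (snd p - b) mod int 19 \<in> {0, 1})" if pQ: "p \<in> Q" for p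
      proof -
        obtain x y where xy: "p = (int x, int y)" "x < 19" "y < 19" "needed k x y" using pQ unfolding Q_def by blast
        have n19: "int 19 = 19" by simp
        show ?thesis unfolding xy(1) fst_conv snd_conv n19 by (rule avoid[OF xy(2-4)])
      qed
    next
      fix M assume M: "tiling tiles Q M" "\<forall>p\<in>Q. coord_x (M p) = fst p \<and> coord_y (M p) = snd p"
      obtain t where t: "admissible t"
        "\<And>j. j < 19 \<Longrightarrow> needed k 0 j \<Longrightarrow> west (M (0, int j)) = west (substitution (tile_of t) (0, int j)) \<and>
           east (M (18, int j)) = east (substitution (tile_of t) (18, int j))"
        "\<And>i. i < 19 \<Longrightarrow> needed k i 0 \<Longrightarrow> south (M (int i, 0)) = south (substitution (tile_of t) (int i, 0)) \<and>
           north (M (int i, 18)) = north (substitution (tile_of t) (int i, 18))"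
        by (rule copy_reads[OF k Q_def M]) (rule that)
      have "tile_of t \<in> tiles" unfolding tiles_def using t(1) by blast
      then show "\<exists>t\<in>tiles. (\<forall>j. (0, j) \<in> Q \<and> (int 19 - 1, j) \<in> Q \<longrightarrow>
                west (M (0, j)) = west (substitution t (0, j)) \<and> east (M (int 19 - 1, j)) = east (substitution t (int 19 - 1, j))) \<and>
              (\<forall>i. (i, 0) \<in> Q \<and> (i, int 19 - 1) \<in> Q \<longrightarrow>
                south (M (i, 0)) = south (substitution t (i, 0)) \<and> north (M (i, int 19 - 1)) = north (substitution t (i, int 19 - 1)))"
        unfolding row col n18 using t(2,3) by blast
    next
      fix r s assume rs: "r \<in> tiles" "s \<in> tiles"
      obtain t u where tu: "admissible t" "r = tile_of t" "admissible u" "s = tile_of u"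
        using tilesD[OF rs(1)] tilesD[OF rs(2)] by blast
      show "east r = west s"
        if "\<forall>j. (0, j) \<in> Q \<and> (int 19 - 1, j) \<in> Q \<longrightarrow> east (substitution r (int 19 - 1, j)) = west (substitution s (0, j))"
        using subst_east_west[OF k] that unfolding row n18 tu(2,4) by blast
      show "north r = south s"
        if "\<forall>i. (i, 0) \<in> Q \<and> (i, int 19 - 1) \<in> Q \<longrightarrow> north (substitution r (i, int 19 - 1)) = south (substitution s (i, 0))"
        using subst_north_south[OF k] that unfolding col n18 tu(2,4) by blast
    qed
  qed
  show "\<exists>t\<in>tiles. \<exists>p q. 1 \<le> p \<and> p \<le> int 19 - 2 \<and> 1 \<le> q \<and> q \<le> int 19 - 2 \<and> substitution t (p, q) = t"
  proof -
    \<comment> \<open>At \<open>(5, 8)\<close> the wire of the north digit from copy 0 crosses that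
      of the west digit to copy 1. If all signals of the tile are blank, both wires are blank, and
      the crossing at this very place is the tile itself.\<close>
    let ?t = "(5, 8, raw Blank, raw Blank, raw Blank, raw Blank) :: ctile"
    have g: "gate_at 5 8 = Cross" by (simp add: gate_at_def)
    have "admissible ?t" by (simp add: g rel_def)
    moreover have "child ?t 5 8 = ?t" by (simp add: child_def)
    then have "substitution (tile_of ?t) (5, 8) = tile_of ?t" by (simp add: substitution_def)
    ultimately show ?thesis unfolding tiles_def
      by (intro bexI[of _ "tile_of ?t"] exI[of _ 5] exI[of _ 8]) auto
  qed
qed

theorem mainTheorem15:
  shows "\<exists>\<tau> :: tile set. \<exists>c1 c2 :: nat.
           finite \<tau> \<and> (\<exists>U. tiling \<tau> UNIV U) \<and> self_similar \<tau> \<and>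
           0 < c1 \<and> c1 < c2 \<and> robust \<tau> c1 c2"
proof (rule exI[of _ tiles], rule exI[of _ "nat scale"], rule exI[of _ "nat scale + 1"], intro conjI)
  show "finite tiles" by (rule finite_tiles)
  show "\<exists>U. tiling tiles UNIV U" by (rule plane_tiling)
  show "self_similar tiles" unfolding self_similar_def using simulates_self by (intro exI[of _ 19] exI[of _ substitution]) simp
  show "0 < nat scale" by (simp add: scale_def)
  show "nat scale < nat scale + 1" by simp
  show "robust tiles (nat scale) (nat scale + 1)" by (rule robust_scale)
qed

end
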